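(* Let $\mu,\tau$ be two distributions over $\Omega=\{1,\ldots,N\}$ and $\varepsilon>0$. There exists an algorithm, with conditional sampling access to $\mu$ and to $\tau$, which with probability at least $2/3$ distinguishes between the case $\mu=\tau$ and the case $d_{\mathrm{TV}}(\mu,\tau)>\varepsilon$, using $O\big((\log\log N/\varepsilon+1/\varepsilon^5)\cdot\mathrm{poly}(\log\varepsilon^{-1})\big)$ conditional samples.
   Context: Conditional sampling access to a distribution $\mu$ over $\Omega$: an oracle which, given a set $A\subseteq\Omega$, returns an element of $A$ distributed according to $\mu$ conditioned on belonging to $A$, independently of past calls. $d_{\mathrm{TV}}(\mu,\tau)=\frac12\sum_{x\in\Omega}|\mu(x)-\tau(x)|$. *)

theory Defs
  imports "HOL-Probability.Probability" "HOL-Computational_Algebra.Polynomial"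
begin

definition tv_dist :: "'a set \<Rightarrow> 'a pmf \<Rightarrow> 'a pmf \<Rightarrow> real" where
  "tv_dist \<Omega> \<mu> \<tau> = 1 / 2 * (\<Sum>x\<in>\<Omega>. \<bar>pmf \<mu> x - pmf \<tau> x\<bar>)"

text \<open>
  An oracle maps a query set to the distribution of its answer. If a nonempty query set has
  mass zero, conditioning on it is undefined, and we only require that the answer lies in the set.
  On queries that are empty or not contained in the ground set, nothing is required.
\<close>

definition cond_oracle :: "'a set \<Rightarrow> 'a pmf \<Rightarrow> ('a set \<Rightarrow> 'a pmf) \<Rightarrow> bool" where
  "cond_oracle \<Omega> \<mu> orc \<longleftrightarrow>
     (\<forall>A. A \<subseteq> \<Omega> \<and> A \<noteq> {} \<longrightarrow>
        set_pmf (orc A) \<subseteq> A \<and>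
        (measure_pmf.prob \<mu> A > 0 \<longrightarrow> orc A = cond_pmf \<mu> A))"

text \<open>
  A randomized adaptive algorithm with access to two oracles, as a decision tree: it stops with an
  answer, or draws internal randomness, or asks one of the oracles for a conditional sample from
  a set, and continues depending on the outcome. The tree is fixed before the oracles are,
  so the oracles influence the computation only through the samples they return.
\<close>

datatype source = Mu | Tau

datatype 'a algorithm =
    Answer bool
  | Toss "nat pmf" "nat \<Rightarrow> 'a algorithm"
  | Sample source "'a set" "'a \<Rightarrow> 'a algorithm"

text \<open>
  Each call draws afresh from the answer distribution; this is the independence of past calls.
\<close>

primrec run :: "('a set \<Rightarrow> 'a pmf) \<Rightarrow> ('a set \<Rightarrow> 'a pmf) \<Rightarrow> 'a algorithm \<Rightarrow> bool pmf" where
  "run orc_mu orc_tau (Answer b) = return_pmf b"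
| "run orc_mu orc_tau (Toss p f) = bind_pmf p (\<lambda>i. run orc_mu orc_tau (f i))"
| "run orc_mu orc_tau (Sample s A f) =
     bind_pmf (case s of Mu \<Rightarrow> orc_mu A | Tau \<Rightarrow> orc_tau A) (\<lambda>x. run orc_mu orc_tau (f x))"

text \<open>
  Worst-case sample complexity: at most \<open>n\<close> calls, to both oracles together, on every path.
\<close>

primrec samples_at_most :: "'a algorithm \<Rightarrow> nat \<Rightarrow> bool" where
  "samples_at_most (Answer b) n \<longleftrightarrow> True"
| "samples_at_most (Toss p f) n \<longleftrightarrow> (\<forall>i\<in>set_pmf p. samples_at_most (f i) n)"
| "samples_at_most (Sample s A f) n \<longleftrightarrow> n > 0 \<and> (\<forall>x. samples_at_most (f x) (n - 1))"

text \<open>The answer \<open>True\<close> stands for equality, \<open>False\<close> for being far apart.\<close>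

definition distinguishes :: "'a set \<Rightarrow> real \<Rightarrow> 'a algorithm \<Rightarrow> bool" where
  "distinguishes \<Omega> \<epsilon> T \<longleftrightarrow>
     (\<forall>\<mu> \<tau> orc_mu orc_tau.
        set_pmf \<mu> \<subseteq> \<Omega> \<longrightarrow> set_pmf \<tau> \<subseteq> \<Omega> \<longrightarrow>
        cond_oracle \<Omega> \<mu> orc_mu \<longrightarrow> cond_oracle \<Omega> \<tau> orc_tau \<longrightarrow>
          (\<mu> = \<tau> \<longrightarrow> pmf (run orc_mu orc_tau T) True \<ge> 2 / 3) \<and>
          (tv_dist \<Omega> \<mu> \<tau> > \<epsilon> \<longrightarrow> pmf (run orc_mu orc_tau T) False \<ge> 2 / 3))"

end

theory Submission
  imports Defs "HOL-Library.Nat_Bijection"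
begin

text \<open>
  For a point \<open>x\<close> let \<open>k\<^sub>\<nu>(x) = \<Sum>\<^sub>y min 1 (\<nu> y / \<nu> x)\<close>. If \<open>x\<close> has \<open>i\<close> heavier points above it,
  then \<open>k\<^sub>\<nu>(x) - i\<close> is the reciprocal of the probability of \<open>x\<close> among the points not heavier
  than \<open>x\<close>, that is, of the hazard of \<open>\<nu>\<close> at \<open>x\<close> when the points are visited in decreasing order.
  A distribution is determined by its hazards, robustly: if \<open>k\<^sub>\<mu>\<close> and \<open>k\<^sub>\<tau>\<close> agree up to a factor
  \<open>1 \<plusminus> \<delta>\<close> outside a set of mass \<open>\<delta>\<close>, then \<open>\<mu>\<close> and \<open>\<tau>\<close> are at distance \<open>O(\<delta> log (1 / \<delta>))\<close>.
  So it suffices to draw \<open>O(1 / \<delta>)\<close> points \<open>x\<close> and to compare \<open>k\<^sub>\<mu>(x)\<close> with \<open>k\<^sub>\<tau>(x)\<close>.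

  Conditioning on \<open>insert x S\<close> for a random set \<open>S\<close> that contains each point with probability \<open>r\<close>
  gives access to \<open>r k\<^sub>\<nu>(x)\<close> as soon as \<open>r\<close> is about \<open>\<delta> / k\<^sub>\<nu>(x)\<close>, and such an \<open>r\<close> is found by a
  binary search over the powers of two. One sample per step is enough, because the probability of
  a wrong answer decays geometrically with the distance from the right scale. This costs
  \<open>log log N\<close> samples per point, and the comparison costs \<open>\<delta>\<close> to the power \<open>-4\<close>, up to logarithms.
  Every test compares sums of differences that are symmetric when \<open>\<mu> = \<tau>\<close>, whatever the point and
  the rate, so equality is never rejected except with small probability.
\<close>

section \<open>Scores and total variation distance\<close>

text \<open>The two distributions order the points differently, and neither order is visible through
  the oracles. The score keeps the rank as a summand, so the two scores of a point can be compared
  without knowing its ranks; ranks are subtracted only in the analysis, once equal points have been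
  traded for equal ranks. A relative error \<delta> at the scale \<open>r k\<close> = O(\<delta>)
  means a precision of \<delta>^2. Plain repetition would take \<delta>^(-4) rounds, each with
  \<delta>^(-2) samples for the probability that decides between \<open>x\<close> and
  \<open>S\<close>. The fine probe instead repeats until a draw escapes from \<open>x\<close> and
  estimates that probability once; its acceptance probabilities then differ by order \<delta>, and
  \<delta>^(-2) rounds suffice. The price is a geometric factor that depends on the escape
  probability. The cheap coarse probe, run \<delta>^(-4) times, keeps this factor nearly the same on
  both sides. A second obstacle is a point that only one distribution takes: the other oracle may
  answer arbitrarily on null sets and has no score there. Such points are handled through the sizes
  of the supports.\<close>

lemma decreasing_enumeration:
  fixes h :: "'a \<Rightarrow> real"
  assumes "finite X"
  shows "\<exists>f. bij_betw f {..<card X} X \<and> (\<forall>i j. i \<le> j \<longrightarrow> j < card X \<longrightarrow> h (f j) \<le> h (f i))"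
  using assms
proof (induction "card X" arbitrary: X)
  case 0
  then show ?case by (auto simp: bij_betw_def)
next
  case (Suc n)
  then have "X \<noteq> {}" by auto
  define a where "a = arg_min_on h X"
  have a: "a \<in> X" "\<And>x. x \<in> X \<Longrightarrow> h a \<le> h x"
    using Suc.prems \<open>X \<noteq> {}\<close> arg_min_if_finite[of X h] unfolding a_def
    by (auto simp: not_less[symmetric])
  have card: "card (X - {a}) = n" using Suc a by simp
  from Suc.hyps(1)[of "X - {a}"] obtain f where
    f: "bij_betw f {..<n} (X - {a})" "\<And>i j. i \<le> j \<Longrightarrow> j < n \<Longrightarrow> h (f j) \<le> h (f i)"
    using card Suc.prems by auto
  define g where "g = f(n := a)"
  have "bij_betw g {..<n} (X - {a})"
    using f(1) by (rule bij_betw_cong[THEN iffD1, rotated]) (auto simp: g_def)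
  moreover have "bij_betw g {n} {a}" by (auto simp: g_def bij_betw_def)
  ultimately have "bij_betw g ({..<n} \<union> {n}) (X - {a} \<union> {a})"
    by (rule bij_betw_combine) auto
  moreover have "{..<n} \<union> {n} = {..<card X}" using Suc.hyps(2) by auto
  moreover have "X - {a} \<union> {a} = X" using a by auto
  moreover have "h (g j) \<le> h (g i)" if "i \<le> j" "j < card X" for i j
  proof (cases "j = n")
    case True
    have "g i \<in> X" using calculation(1,2,3) that by (auto simp: bij_betw_def)
    then show ?thesis using True a by (simp add: g_def)
  next
    case False
    then show ?thesis using f(2)[of i j] that Suc.hyps(2) by (simp add: g_def)
  qed
  ultimately show ?case by auto
qed

text \<open>Pigeonhole: \<open>{..i}\<close> has one element too many for
  \<open>{..<i}\<close>.\<close>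

lemma permutation_crosses_down:
  fixes \<sigma> :: "nat \<Rightarrow> nat"
  assumes "bij_betw \<sigma> {..<n} {..<n}" "i < n"
  obtains x where "x \<le> i" "i \<le> \<sigma> x"
proof -
  have "\<not> \<sigma> ` {..i} \<subseteq> {..<i}"
  proof
    assume "\<sigma> ` {..i} \<subseteq> {..<i}"
    then have "card (\<sigma> ` {..i}) \<le> i" using card_mono[of "{..<i}"] by fastforce
    moreover have "inj_on \<sigma> {..i}"
      using assms by (auto simp: bij_betw_def intro: inj_on_subset)
    ultimately show False by (simp add: card_image)
  qed
  then show ?thesis using that by (auto simp: image_subset_iff not_less)
qed

lemma permutation_crosses_up:
  fixes \<sigma> :: "nat \<Rightarrow> nat"
  assumes "bij_betw \<sigma> {..<n} {..<n}" "i < n"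
  obtains x where "i \<le> x" "x < n" "\<sigma> x \<le> i"
proof -
  have "\<not> \<sigma> ` {i..<n} \<subseteq> {i<..<n}"
  proof
    assume "\<sigma> ` {i..<n} \<subseteq> {i<..<n}"
    then have "card (\<sigma> ` {i..<n}) \<le> card {i<..<n}" by (intro card_mono) auto
    moreover have "inj_on \<sigma> {i..<n}"
      using assms(1) by (auto simp: bij_betw_def intro: inj_on_subset)
    ultimately show False using assms(2) by (simp add: card_image)
  qed
  moreover have "\<sigma> x < n" if "x < n" for x using assms(1) that by (auto simp: bij_betw_def)
  ultimately show ?thesis using that by (force simp: image_subset_iff not_less)
qed

text \<open>\<open>\<nu>\<close> is a bare function and \<open>A\<close> is explicit because the
  same notion is applied to sorted sequences, to restrictions of mass below 1 and to whole
  distributions. Where \<open>\<nu> x = 0\<close>, division by zero makes the score 0, so the value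
  carries no information there.\<close>

definition score :: "'a set \<Rightarrow> ('a \<Rightarrow> real) \<Rightarrow> 'a \<Rightarrow> real" where
  "score A \<nu> x = (\<Sum>y\<in>A. min 1 (\<nu> y / \<nu> x))"

lemma score_decreasing:
  fixes u :: "nat \<Rightarrow> real"
  assumes dec: "\<And>i j. i \<le> j \<Longrightarrow> j < n \<Longrightarrow> u j \<le> u i" and "i < n" "u i > 0"
  shows "score {..<n} u i = real i + (\<Sum>l\<in>{i..<n}. u l) / u i"
proof -
  have "{..<n} = {..<i} \<union> {i..<n}" using assms by auto
  then have "score {..<n} u i = (\<Sum>y<i. min 1 (u y / u i)) + (\<Sum>y\<in>{i..<n}. min 1 (u y / u i))"
    unfolding score_def by (simp add: sum.union_disjoint ivl_disj_int)
  also have "(\<Sum>y<i. min 1 (u y / u i)) = (\<Sum>y<i. 1)"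
    using dec[of _ i] assms by (intro sum.cong) auto
  also have "(\<Sum>y\<in>{i..<n}. min 1 (u y / u i)) = (\<Sum>y\<in>{i..<n}. u y / u i)"
    using dec[of i] assms by (intro sum.cong) auto
  finally show ?thesis by (simp add: sum_divide_distrib)
qed

text \<open>A hazard is at most the drop of \<open>ln U\<close> over its step, so the sum
  telescopes. The last step is bounded by 1 on its own, since nothing keeps \<open>U k\<close> away
  from 0. This is the source of the factor log (1 / \<delta>).\<close>

lemma sum_ratio_tail_le_ln:
  fixes u :: "nat \<Rightarrow> real"
  assumes "\<And>i. i < k \<Longrightarrow> u i \<le> U i" "\<And>i. U (Suc i) = U i - u i"
    "\<And>i. i < k \<Longrightarrow> U i \<ge> \<alpha>" "\<alpha> > 0" "\<alpha> \<le> 1" "U 0 \<le> 1"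
  shows "(\<Sum>i<k. u i / U i) \<le> 1 + ln (1 / \<alpha>)"
proof -
  have aux: "(\<Sum>i<j. u i / U i) \<le> ln (1 / U j)" if "j < k" for j
    using that
  proof (induction j)
    case 0
    then show ?case using assms(3)[of 0] assms(4,6) by (simp add: ln_div)
  next
    case (Suc j)
    have p: "U j > 0" "U (Suc j) > 0" using assms(3)[of j] assms(3)[of "Suc j"] assms(4) Suc by auto
    have "ln (U (Suc j) / U j) \<le> U (Suc j) / U j - 1" using p by (intro ln_le_minus_one) auto
    also have "\<dots> = - (u j / U j)" using p(1) unfolding assms(2) by (simp add: field_simps)
    finally have "u j / U j \<le> ln (U j) - ln (U (Suc j))" using p by (simp add: ln_div)
    then show ?case using Suc p by (simp add: ln_div)
  qed
  show ?thesis
  proof (cases k)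
    case 0
    have "ln \<alpha> \<le> 0" using assms(4,5) by simp
    then have "ln \<alpha> \<le> 1" by linarith
    then show ?thesis using assms(4) 0 by (simp add: ln_div)
  next
    case (Suc j)
    have U: "U j \<ge> \<alpha>" using assms(3) Suc by auto
    have "(\<Sum>i<k. u i / U i) \<le> ln (1 / U j) + u j / U j" using aux[of j] Suc by simp
    moreover have "ln (1 / U j) \<le> ln (1 / \<alpha>)"
      using U assms(4) by (simp add: ln_div)
    moreover have "u j / U j \<le> 1" using assms(1)[of j] U assms(4) Suc by simp
    ultimately show ?thesis by linarith
  qed
qed

text \<open>
  One step of a coupling of two chains with hazards \<open>u / U\<close> and \<open>w / W\<close>, whose reciprocals are close.
\<close>
lemma overlap_step:
  fixes u w U W z :: real
  assumes "0 < u" "0 < w" "u \<le> U" "w \<le> W" "0 \<le> z"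
    and uw: "U / u \<le> W / w + z / w" and wu: "W / w \<le> U / u + z / u"
  shows "min u w + min (U - u) (W - w) \<ge> min U W - z * (u / U + w / W)"
proof -
  have pos: "U > 0" "W > 0" using assms by auto
  have 1: "U * w \<le> W * u + z * u" using uw assms by (simp add: field_simps)
  have 2: "W * u \<le> U * w + z * w" using wu assms by (simp add: field_simps)
  have nn: "z * (u / U) \<ge> 0" "z * (w / W) \<ge> 0" using assms pos by auto
  \<comment> \<open>If both minima are taken in the same chain, their sum is exactly
    \<open>U\<close> or \<open>W\<close>. Mass is lost only if one chain gives the jump and the
    other the survival; \<open>mixed\<close> bounds this loss, with \<open>a\<close>,
    \<open>P\<close> for the first chain and \<open>b\<close>, \<open>Q\<close> for the
    second.\<close>
  have mixed: "a + (Q - b) \<ge> min P Q - z * (b / Q) - z * (a / P)"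
    if "a > 0" "b > 0" "P > 0" "Q > 0" "a \<le> P" "P * b \<le> Q * a + z * a" "a \<le> b" for a b P Q :: real
  proof (cases "P \<ge> Q")
    case True
    have "Q * (b - a) \<le> z * b"
    proof -
      have "Q * b \<le> P * b" using True that by (intro mult_right_mono) auto
      moreover have "z * a \<le> z * b" using that assms by (intro mult_left_mono) auto
      ultimately have "Q * b \<le> Q * a + z * b" using that(6) by linarith
      then show ?thesis by (simp add: right_diff_distrib)
    qed
    then have "b - a \<le> z * (b / Q)" using that by (simp add: field_simps)
    moreover have "z * (a / P) \<ge> 0" using that assms by simp
    ultimately show ?thesis using True by simp
  next
    case False
    have "b \<le> (Q * a + z * a) / P" using that by (simp add: field_simps)
    then have "b \<le> Q * (a / P) + z * (a / P)" by (simp add: add_divide_distrib)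
    moreover have "(Q - P) * (1 - a / P) \<ge> 0" using False that by (intro mult_nonneg_nonneg) auto
    moreover have "(Q - P) * (1 - a / P) = Q - P - Q * (a / P) + a" using that by (simp add: field_simps)
    moreover have "z * (b / Q) \<ge> 0" using that assms by simp
    moreover have "P \<le> Q" using False by simp
    ultimately show ?thesis by (simp add: min_def)
  qed
  have "u + (W - w) \<ge> min U W - z * (w / W) - z * (u / U)" if "u \<le> w"
    using mixed[of u w U W] assms pos 1 that by auto
  moreover have "w + (U - u) \<ge> min U W - z * (u / U) - z * (w / W)" if "w \<le> u"
    using mixed[of w u W U] assms pos 2 that by (auto simp: min.commute)
  ultimately show ?thesis using nn by (simp add: min_def distrib_left) (smt (verit))
qed


text \<open>Going down the ranks, \<open>c i\<close>, the smaller of the two tails, is paid out as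
  overlap except for \<open>z\<close> times the two hazards, and the hazards sum to O(log (1 / z))
  until a tail falls to 2 z. This compares values of equal rank; the second half passes to values of
  equal point. The tolerances are multiples of 1 / mass because discarding points of mass
  \<open>e\<close> lowers a score at mass \<open>q\<close> by at most \<open>e / q\<close>.
  \<open>u\<close> may vanish while \<open>w\<close> may not; \<open>P3\<close> stands in for the
  score that \<open>u\<close> lacks at such a point.\<close>

theorem overlap_of_close_scores:
  fixes u w :: "nat \<Rightarrow> real" and \<sigma> :: "nat \<Rightarrow> nat"
  assumes u_dec: "\<And>i j. i \<le> j \<Longrightarrow> j < n \<Longrightarrow> u j \<le> u i"
    and w_dec: "\<And>i j. i \<le> j \<Longrightarrow> j < n \<Longrightarrow> w j \<le> w i"
    and u_nonneg: "\<And>i. i < n \<Longrightarrow> u i \<ge> 0" and w_pos: "\<And>i. i < n \<Longrightarrow> w i > 0"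
    and \<sigma>: "bij_betw \<sigma> {..<n} {..<n}"
    and u_sum: "sum u {..<n} \<le> 1" "sum u {..<n} \<ge> 1 - z"
    and w_sum: "sum w {..<n} \<le> 1" "sum w {..<n} \<ge> 1 - z"
    and z: "0 < z" "z \<le> 1 / 2"
    and P1: "\<And>x. x < n \<Longrightarrow> u x > 0 \<Longrightarrow> score {..<n} w (\<sigma> x) \<le> score {..<n} u x + z / u x"
    and P2: "\<And>x. x < n \<Longrightarrow> u x > 0 \<Longrightarrow> score {..<n} u x \<le> score {..<n} w (\<sigma> x) + z / w (\<sigma> x)"
    and P3: "\<And>x i. x < n \<Longrightarrow> u x = 0 \<Longrightarrow> i < n \<Longrightarrow> u i > 0 \<Longrightarrow>
               score {..<n} u i \<le> score {..<n} w (\<sigma> x) + z / w (\<sigma> x)"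
  shows "(\<Sum>x<n. min (u x) (w (\<sigma> x))) \<ge> 1 - z * (31 + 16 * ln (1 / z))"
proof -
  define ku where "ku = score {..<n} u"
  define kw where "kw = score {..<n} w"
  define U where "U = (\<lambda>i. sum u {i..<n})"
  define W where "W = (\<lambda>i. sum w {i..<n})"
  define c where "c = (\<lambda>i. min (U i) (W i))"
  define ov where "ov = (\<lambda>i. min (u i) (w i))"
  have w_nonneg: "w i \<ge> 0" if "i < n" for i using w_pos[OF that] by simp
  have ku: "ku i = real i + U i / u i" if "i < n" "u i > 0" for i
    using score_decreasing[OF u_dec] that by (simp add: ku_def U_def)
  have kw: "kw i = real i + W i / w i" if "i < n" for i
    using score_decreasing[OF w_dec] w_pos that by (simp add: kw_def W_def)
  have U_Suc: "U (Suc i) = U i - u i" if "i < n" for i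
    using that by (simp add: U_def sum.atLeast_Suc_lessThan)
  have W_Suc: "W (Suc i) = W i - w i" if "i < n" for i
    using that by (simp add: W_def sum.atLeast_Suc_lessThan)
  have U_ge: "U i \<ge> u i" "U i \<ge> 0" if "i < n" for i
    using that u_nonneg by (auto simp: U_def intro!: member_le_sum sum_nonneg)
  have W_ge: "W i \<ge> w i" "W i > 0" if "i < n" for i
  proof -
    show "W i \<ge> w i" using that w_nonneg by (auto simp: W_def intro!: member_le_sum)
    with w_pos[OF that] show "W i > 0" by linarith
  qed
  have ku_mono: "ku i \<le> ku j" if "i \<le> j" "j < n" "u j > 0" for i j
    unfolding ku_def score_def
    by (intro sum_mono min.mono divide_left_mono order.refl u_dec u_nonneg mult_pos_pos) 
       (use that u_dec[of i j] in auto)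
  have kw_mono: "kw i \<le> kw j" if "i \<le> j" "j < n" for i j
    unfolding kw_def score_def
    by (intro sum_mono min.mono divide_left_mono order.refl w_dec w_nonneg mult_pos_pos) 
       (use that w_pos[of i] w_pos[of j] in auto)
  have \<sigma>_less: "\<sigma> x < n" if "x < n" for x using \<sigma> that by (auto simp: bij_betw_def)
  txt \<open>
    Scores increase along the decreasing orders, and a permutation of the indices has to cross \<open>i\<close>
    in both directions; hence the comparison of scores of one point carries over to points of equal rank.
  \<close>
  have S1: "kw i \<le> ku i + z / u i" if i: "i < n" "u i > 0" for i
  proof -
    obtain x where x: "x \<le> i" "i \<le> \<sigma> x" using permutation_crosses_down[OF \<sigma> i(1)] .
    have ux: "u x \<ge> u i" using x i u_dec by auto
    have "kw i \<le> kw (\<sigma> x)" using x i \<sigma>_less by (intro kw_mono) auto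
    also have "\<dots> \<le> ku x + z / u x" using P1[of x] x i ux by (simp add: ku_def kw_def)
    also have "\<dots> \<le> ku i + z / u i"
      using x i ux z by (intro add_mono ku_mono divide_left_mono) auto
    finally show ?thesis .
  qed
  have S2: "ku i \<le> kw i + z / w i" if i: "i < n" "u i > 0" for i
  proof -
    obtain x where x: "i \<le> x" "x < n" "\<sigma> x \<le> i" using permutation_crosses_up[OF \<sigma> i(1)] .
    have "ku i \<le> kw (\<sigma> x) + z / w (\<sigma> x)"
    proof (cases "u x > 0")
      case True
      have "ku i \<le> ku x" using x True by (intro ku_mono) auto
      also have "\<dots> \<le> kw (\<sigma> x) + z / w (\<sigma> x)" using P2[of x] x True by (simp add: ku_def kw_def)
      finally show ?thesis .
    next
      case False
      then show ?thesis using P3[of x i] x i u_nonneg[of x] by (simp add: ku_def kw_def)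
    qed
    also have "\<dots> \<le> kw i + z / w i"
      using x i w_pos[of i] w_pos[of "\<sigma> x"] z w_dec[of "\<sigma> x" i]
      by (intro add_mono kw_mono divide_left_mono) auto
    finally show ?thesis .
  qed
  \<comment> \<open>The factor 2 gives \<open>U i - z \<ge> U i / 2\<close> before
    \<open>stop\<close>, which absorbs a tolerance \<open>z / u i\<close> in
    \<open>drop\<close>.\<close>
  define \<alpha> where "\<alpha> = 2 * z"
  have \<alpha>: "0 < \<alpha>" "\<alpha> \<le> 1" using z by (auto simp: \<alpha>_def)
  define stop where "stop = (LEAST i. n \<le> i \<or> u i = 0 \<or> c i < \<alpha>)"
  have stop: "n \<le> stop \<or> u stop = 0 \<or> c stop < \<alpha>"
    unfolding stop_def by (rule LeastI[of _ n]) simp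
  have stop_le: "stop \<le> n" unfolding stop_def by (rule Least_le) simp
  have before: "i < n" "u i > 0" "U i \<ge> \<alpha>" "W i \<ge> \<alpha>" if "i < stop" for i
  proof -
    have *: "\<not> (n \<le> i \<or> u i = 0 \<or> c i < \<alpha>)"
      using that unfolding stop_def by (rule not_less_Least)
    then show "i < n" "U i \<ge> \<alpha>" "W i \<ge> \<alpha>" by (auto simp: c_def)
    with * u_nonneg[of i] show "u i > 0" by linarith
  qed
  have c_stop: "c stop \<le> \<alpha>"
  proof -
    have "U stop = 0" if "stop < n" "u stop = 0"
      unfolding U_def
    proof (rule sum.neutral, safe)
      fix x assume "x \<in> {stop..<n}"
      then show "u x = 0" using u_dec[of stop x] u_nonneg[of x] that by auto
    qed
    moreover have "U stop = 0" if "n \<le> stop" using that by (simp add: U_def)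
    ultimately have "U stop = 0 \<or> c stop < \<alpha>" using stop by (cases "n \<le> stop") auto
    then show ?thesis using \<alpha> by (auto simp: c_def min_le_iff_disj)
  qed
  define \<Lambda> where "\<Lambda> = 1 + ln (1 / \<alpha>)"
  define \<beta> where "\<beta> = (\<lambda>i. u i / U i + w i / W i)"
  have \<beta>_nonneg: "\<beta> i \<ge> 0" if "i < stop" for i
    using before[OF that] U_ge[of i] W_ge[of i] w_nonneg[of i] by (auto simp: \<beta>_def)
  have \<beta>_sum: "sum \<beta> {..<stop} \<le> 2 * \<Lambda>"
  proof -
    have U: "(\<Sum>i<stop. u i / U i) \<le> \<Lambda>"
    proof -
      define U' where "U' = (\<lambda>i. U 0 - sum u {..<i})"
      have eq: "U' i = U i" if "i \<le> n" for i
      proof -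
        have "{0..<n} = {..<i} \<union> {i..<n}" using that by auto
        then show ?thesis unfolding U'_def U_def by (simp add: sum.union_disjoint ivl_disj_int)
      qed
      have eq': "U' i = U i" if "i < stop" for i using eq before(1)[OF that] by simp
      have U0: "U' 0 \<le> 1" using u_sum by (simp add: U'_def U_def atLeast0LessThan)
      have "(\<Sum>i<stop. u i / U' i) \<le> 1 + ln (1 / \<alpha>)"
      proof (rule sum_ratio_tail_le_ln)
        show "U' (Suc i) = U' i - u i" for i by (simp add: U'_def)
      qed (use before eq' U0 \<alpha> U_ge in auto)
      then show ?thesis using eq stop_le by (simp add: \<Lambda>_def)
    qed
    have W: "(\<Sum>i<stop. w i / W i) \<le> \<Lambda>"
    proof -
      define W' where "W' = (\<lambda>i. W 0 - sum w {..<i})"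
      have eq: "W' i = W i" if "i \<le> n" for i
      proof -
        have "{0..<n} = {..<i} \<union> {i..<n}" using that by auto
        then show ?thesis unfolding W'_def W_def by (simp add: sum.union_disjoint ivl_disj_int)
      qed
      have eq': "W' i = W i" if "i < stop" for i using eq before(1)[OF that] by simp
      have W0: "W' 0 \<le> 1" using w_sum by (simp add: W'_def W_def atLeast0LessThan)
      have "(\<Sum>i<stop. w i / W' i) \<le> 1 + ln (1 / \<alpha>)"
      proof (rule sum_ratio_tail_le_ln)
        show "W' (Suc i) = W' i - w i" for i by (simp add: W'_def)
      qed (use before eq' W0 \<alpha> W_ge in auto)
      then show ?thesis using eq stop_le by (simp add: \<Lambda>_def)
    qed
    show ?thesis using U W by (simp add: \<beta>_def sum.distrib)
  qed
  have step: "ov i \<ge> c i - c (Suc i) - z * \<beta> i" if "i < stop" for i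
  proof -
    note b = before[OF that]
    have "U i / u i \<le> W i / w i + z / w i" using S2[of i] ku[of i] kw[of i] b by simp
    moreover have "W i / w i \<le> U i / u i + z / u i" using S1[of i] ku[of i] kw[of i] b by simp
    ultimately have "min (u i) (w i) + min (U i - u i) (W i - w i) \<ge> min (U i) (W i) - z * (u i / U i + w i / W i)"
      using b U_ge[of i] W_ge[of i] w_pos[of i] z by (intro overlap_step) auto
    then show ?thesis unfolding ov_def c_def \<beta>_def U_Suc[OF b(1)] W_Suc[OF b(1)] by linarith
  qed
  have ov_sum: "sum ov {..<stop} \<ge> 1 - z - \<alpha> - 2 * z * \<Lambda>"
  proof -
    have "(\<Sum>i<stop. c i - c (Suc i) - z * \<beta> i) \<le> sum ov {..<stop}"
      using step by (intro sum_mono) auto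
    moreover have "(\<Sum>i<stop. c i - c (Suc i) - z * \<beta> i) = c 0 - c stop - z * sum \<beta> {..<stop}"
      using sum_lessThan_telescope'[of c stop] by (simp only: sum_subtractf sum_distrib_left)
    moreover have "c 0 \<ge> 1 - z" using u_sum w_sum by (simp add: c_def U_def W_def atLeast0LessThan)
    moreover have "z * sum \<beta> {..<stop} \<le> z * (2 * \<Lambda>)" using \<beta>_sum z by (intro mult_left_mono) auto
    ultimately show ?thesis using c_stop by linarith
  qed
  define V where "V = U stop + z"
  have U_stop: "U stop \<le> z + \<alpha> + 2 * z * \<Lambda>"
  proof -
    have "{..<n} = {..<stop} \<union> {stop..<n}" using stop_le by auto
    then have "sum u {..<n} = sum u {..<stop} + U stop"
      unfolding U_def by (simp add: sum.union_disjoint ivl_disj_int)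
    moreover have "sum ov {..<stop} \<le> sum u {..<stop}" by (intro sum_mono) (auto simp: ov_def)
    ultimately show ?thesis using ov_sum u_sum by linarith
  qed
  have U_stop_nn: "U stop \<ge> 0" unfolding U_def using u_nonneg by (intro sum_nonneg) auto
  txt \<open>
    The matching of the two orders can only lose on points that \<open>\<sigma>\<close> moves down. Those that stay
    above \<open>stop\<close> have almost the mass of the rank they move to; those that cross \<open>stop\<close> are few, because
    the score of the last one is at least the number of points above it.
  \<close>
  define Cr where "Cr = {x \<in> {..<stop}. stop \<le> \<sigma> x}"
  have crossing: "sum u Cr \<le> 3 * V"
  proof (cases "Cr = {}")
    case True
    then show ?thesis using U_stop_nn z by (simp add: V_def)
  next
    case False
    have finCr: "finite Cr" by (simp add: Cr_def)
    define a where "a = Min Cr"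
    have a: "a \<in> Cr" "\<And>x. x \<in> Cr \<Longrightarrow> a \<le> x"
      using False finCr by (auto simp: a_def)
    have CrD: "x < stop" "x < n" "u x > 0" "stop \<le> \<sigma> x" "\<sigma> x < n" "u x \<le> u a" if "x \<in> Cr" for x
      using that before[of x] a(2)[OF that] u_dec[of a x] \<sigma>_less by (auto simp: Cr_def)
    have ku_le: "ku d \<le> (\<Sum>y<stop. min 1 (u y / u d)) + U stop / u d" if "d \<in> Cr" for d
    proof -
      have "{..<n} = {..<stop} \<union> {stop..<n}" using stop_le by auto
      then have "ku d = (\<Sum>y<stop. min 1 (u y / u d)) + (\<Sum>y\<in>{stop..<n}. min 1 (u y / u d))"
        unfolding ku_def score_def by (simp add: sum.union_disjoint ivl_disj_int)
      also have "(\<Sum>y\<in>{stop..<n}. min 1 (u y / u d)) \<le> (\<Sum>y\<in>{stop..<n}. u y / u d)"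
        by (intro sum_mono) auto
      finally show ?thesis by (simp add: U_def sum_divide_distrib)
    qed
    have deep: "kw (\<sigma> d) \<ge> real (\<sigma> d) + 1" if "d \<in> Cr" for d
      using kw[of "\<sigma> d"] W_ge[of "\<sigma> d"] w_pos[of "\<sigma> d"] CrD[OF that] by simp
    have up: "kw (\<sigma> d) \<le> (\<Sum>y<stop. min 1 (u y / u d)) + V / u d" if "d \<in> Cr" for d
      using P1[of d] ku_le[OF that] CrD[OF that] by (simp add: ku_def kw_def V_def add_divide_distrib)
    \<comment> \<open>\<open>a\<close> is the heaviest crossing point. Those of at least half its
      mass are counted by depth: their images occupy distinct ranks from \<open>stop\<close> on, so
      the deepest image has score at least \<open>stop + card T\<close>, whereas by
      \<open>up\<close> it has at most \<open>stop + V / u d\<close>.\<close>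
    define T where "T = {x \<in> Cr. u x \<ge> u a / 2}"
    define R where "R = {x \<in> Cr. u x < u a / 2}"
    have fin: "finite T" "finite R" using finCr by (auto simp: T_def R_def)
    have aT: "a \<in> T" using a CrD[of a] by (auto simp: T_def)
    have "sum u T \<le> 2 * V"
    proof -
      define e where "e = Max (\<sigma> ` T)"
      have "e \<in> \<sigma> ` T" unfolding e_def using fin aT by (intro Max_in) auto
      then obtain d where d: "d \<in> T" "\<sigma> d = e" by auto
      have "\<sigma> ` T \<subseteq> {stop..e}" using fin CrD by (auto simp: e_def T_def)
      then have "card (\<sigma> ` T) \<le> card {stop..e}" by (intro card_mono) auto
      moreover have "inj_on \<sigma> T"
        using \<sigma> CrD by (auto simp: bij_betw_def T_def intro: inj_on_subset)
      moreover have "stop \<le> e" using d CrD by (auto simp: T_def)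
      ultimately have card: "stop + card T \<le> e + 1" by (simp add: card_image)
      have dC: "d \<in> Cr" using d by (simp add: T_def)
      have "(\<Sum>y<stop. min 1 (u y / u d)) \<le> (\<Sum>y<stop. 1)" by (intro sum_mono) auto
      then have "real (card T) \<le> V / u d" using up[OF dC] deep[OF dC] card d(2) by simp
      then have *: "real (card T) * u d \<le> V" using CrD[OF dC] by (simp add: field_simps)
      have "sum u T \<le> (\<Sum>x\<in>T. 2 * u d)"
        using d CrD by (intro sum_mono) (force simp: T_def)
      then show ?thesis using * by simp
    qed
    moreover have "sum u R \<le> V"
    proof -
      \<comment> \<open>Each lighter crossing point contributes at most 1/2 to the bound
        \<open>up\<close> at \<open>a\<close>, which must still reach \<open>stop + 1\<close>; hence
        they are few.\<close>
      have "(\<Sum>y<stop. min 1 (u y / u a)) \<le> (\<Sum>y<stop. 1 - (if y \<in> R then 1/2 else 0))"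
        using CrD[OF a(1)] by (intro sum_mono) (auto simp: R_def field_simps)
      also have "\<dots> = real stop - real (card R) / 2"
      proof -
        have "{..<stop} \<inter> R = R" using CrD by (auto simp: R_def)
        then show ?thesis by (simp add: sum_subtractf sum.If_cases)
      qed
      finally have "real (card R) / 2 \<le> V / u a"
        using up[OF a(1)] deep[OF a(1)] CrD(4)[OF a(1), folded of_nat_le_iff[where 'a = real]]
        by linarith
      then have *: "real (card R) * (u a / 2) \<le> V" using CrD[OF a(1)] by (simp add: field_simps)
      have "sum u R \<le> (\<Sum>x\<in>R. u a / 2)" by (intro sum_mono) (auto simp: R_def)
      then show ?thesis using * by simp
    qed
    moreover have "sum u Cr = sum u T + sum u R"
    proof -
      have "Cr = T \<union> R" "T \<inter> R = {}" by (auto simp: T_def R_def)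
      then show ?thesis using fin by (simp add: sum.union_disjoint)
    qed
    ultimately show ?thesis by linarith
  qed
  \<comment> \<open>Both scores rise from rank \<open>x\<close> to rank
    \<open>i = \<sigma> x\<close>, but the two scores of the point itself agree up to the tolerance.
    So neither can rise much, and the overlap cannot fall much. The argument is run in the sequence
    that attains the minimum \<open>ov i\<close>.\<close>
  have drop: "ov x - ov (\<sigma> x) \<le> 4 * z * \<beta> (\<sigma> x)" if "x < \<sigma> x" "\<sigma> x < stop" for x
  proof -
    define i where "i = \<sigma> x"
    note bi = before[OF that(2), folded i_def]
    have bx: "x < n" "u x > 0" "w x > 0" "w i > 0" using that before[of x] bi w_pos by auto
    have Wi: "W i > 0" "U i > 0" using bi \<alpha> by auto
    have wi: "w i \<le> w x" and ui: "u i \<le> u x" using that bi by (auto simp: i_def intro: w_dec u_dec)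
    have ox: "ov x > 0" "ov x \<le> u x" "ov x \<le> w x" using bx by (auto simp: ov_def)
    have kwi: "kw i \<le> ku x + z / u x" using P1[of x] bx by (simp add: ku_def kw_def i_def)
    have range: "{x..<n} = {x..<i} \<union> {i..<n}" using that bi by (auto simp: i_def)
    \<comment> \<open>Each of the \<open>i - x\<close> positions in between adds 1 to the rank and
      takes at most \<open>w x\<close> from the tail. In the score these effects cancel, and only
      the change of the denominator remains.\<close>
    have gap_w: "W i / w i - W i / w x \<le> kw i - kw x"
    proof -
      have "W x = sum w {x..<i} + W i" unfolding W_def range by (simp add: sum.union_disjoint ivl_disj_int)
      moreover have "sum w {x..<i} \<le> (\<Sum>l\<in>{x..<i}. w x)" using bi by (intro sum_mono w_dec) auto
      ultimately have "W x \<le> (real i - real x) * w x + W i" using that by (simp add: i_def of_nat_diff)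
      then have "W x / w x \<le> (real i - real x) + W i / w x" using bx by (simp add: field_simps)
      then show ?thesis using kw[of i] kw[of x] bx bi by simp
    qed
    have gap_u: "U i / u i - U i / u x \<le> ku i - ku x"
    proof -
      have "U x = sum u {x..<i} + U i" unfolding U_def range by (simp add: sum.union_disjoint ivl_disj_int)
      moreover have "sum u {x..<i} \<le> (\<Sum>l\<in>{x..<i}. u x)" using bi by (intro sum_mono u_dec) auto
      ultimately have "U x \<le> (real i - real x) * u x + U i" using that by (simp add: i_def of_nat_diff)
      then have "U x / u x \<le> (real i - real x) + U i / u x" using bx by (simp add: field_simps)
      then show ?thesis using ku[of i] ku[of x] bx bi by simp
    qed
    show ?thesis
    proof (cases "w i \<le> u i")
      case True
      have "W i / w i - W i / w x \<le> z / w x + z / u x"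
        using gap_w kwi S2[of x] bx by simp
      then have "(W i / w i - W i / w x) * ov x \<le> (z / w x + z / u x) * ov x"
        using ox by (intro mult_right_mono) auto
      also have "\<dots> = z * (ov x / w x) + z * (ov x / u x)" by (simp add: algebra_simps)
      also have "\<dots> \<le> z * 1 + z * 1" using ox bx z by (intro add_mono mult_left_mono) auto
      finally have "W i * (ov x / w i) - W i * (ov x / w x) \<le> 2 * z" by (simp add: algebra_simps)
      moreover have "W i * (ov x / w x) \<le> W i * 1" using ox bx Wi by (intro mult_left_mono) auto
      ultimately have "W i * (ov x / w i - 1) \<le> 2 * z" by (simp add: algebra_simps)
      then have "ov x / w i - 1 \<le> 2 * z / W i" using Wi by (simp add: field_simps)
      then have "(ov x / w i - 1) * w i \<le> 2 * z / W i * w i" using bx by (intro mult_right_mono) auto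
      then have "ov x - w i \<le> 2 * z * (w i / W i)" using bx by (simp add: algebra_simps)
      moreover have "2 * z * (w i / W i) \<le> 4 * z * \<beta> i"
      proof -
        have "z * (w i / W i) \<ge> 0" "z * (u i / U i) \<ge> 0" using z bx bi Wi by auto
        moreover have "4 * z * \<beta> i = 4 * (z * (u i / U i)) + 4 * (z * (w i / W i))"
          by (simp add: \<beta>_def distrib_left)
        ultimately show ?thesis by simp
      qed
      ultimately show ?thesis using True by (simp add: ov_def i_def[symmetric] min_def)
    next
      case False
      have "U i / u i - U i / u x \<le> z / u x + z / w i"
        using gap_u kwi S2[of i] bx bi by simp
      also have "\<dots> \<le> z / u x + z / u i"
        using False z bi bx by (intro add_left_mono divide_left_mono mult_pos_pos) auto
      finally have "(U i / u i - U i / u x) * ov x \<le> (z / u x + z / u i) * ov x"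
        using ox by (intro mult_right_mono) auto
      also have "\<dots> = z * (ov x / u x) + z * (ov x / u i)" by (simp add: algebra_simps)
      also have "\<dots> \<le> z * 1 + z * (ov x / u i)" using ox bx z by (intro add_mono mult_left_mono) auto
      finally have "U i * (ov x / u i) - U i * (ov x / u x) \<le> z + z * (ov x / u i)" by (simp add: algebra_simps)
      moreover have "U i * (ov x / u x) \<le> U i * 1" using ox bx Wi by (intro mult_left_mono) auto
      ultimately have "U i * (ov x / u i - 1) \<le> 2 * z + z * (ov x / u i - 1)"
        by (simp add: right_diff_distrib)
      then have main: "(U i - z) * (ov x / u i - 1) \<le> 2 * z" by (simp add: left_diff_distrib)
      have "ov x / u i - 1 \<le> 4 * z / U i"
      proof (cases "ov x / u i - 1 \<le> 0")
        case True
        then show ?thesis using z Wi by (smt (verit) divide_nonneg_pos)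
      next
        case False
        have "U i / 2 * (ov x / u i - 1) \<le> (U i - z) * (ov x / u i - 1)"
          using False bi by (intro mult_right_mono) (auto simp: \<alpha>_def)
        then have "U i / 2 * (ov x / u i - 1) \<le> 2 * z" using main by linarith
        then show ?thesis using Wi by (simp add: field_simps)
      qed
      then have "(ov x / u i - 1) * u i \<le> 4 * z / U i * u i" using bi by (intro mult_right_mono) auto
      then have "ov x - u i \<le> 4 * z * (u i / U i)" using bi by (simp add: algebra_simps)
      moreover have "4 * z * (u i / U i) \<le> 4 * z * \<beta> i"
      proof -
        have "z * (w i / W i) \<ge> 0" using z bx bi Wi by auto
        then show ?thesis unfolding \<beta>_def by (simp add: distrib_left)
      qed
      ultimately show ?thesis using False by (simp add: ov_def i_def[symmetric] min_def)
    qed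
  qed
  define M where "M = (\<lambda>x. min (u x) (w (\<sigma> x)))"
  define Lo where "Lo = {x \<in> {..<stop}. \<sigma> x < stop}"
  have split: "{..<stop} = Lo \<union> Cr" "Lo \<inter> Cr = {}" "finite Lo" "finite Cr" by (auto simp: Lo_def Cr_def)
  have "sum ov {..<stop} = sum ov Lo + sum ov Cr" using split by (simp add: sum.union_disjoint)
  moreover have "sum ov Cr \<le> sum u Cr" by (intro sum_mono) (auto simp: ov_def)
  moreover have "sum ov Lo \<le> sum M Lo + 4 * z * (2 * \<Lambda>)"
  proof -
    \<comment> \<open>If \<sigma> moves \<open>x\<close> down, the overlap at the target rank is
      below \<open>M x\<close>; otherwise the overlap at \<open>x\<close> is. As \<sigma> is
      injective, each hazard is charged at most once.\<close>
    have "ov x \<le> M x + 4 * z * \<beta> (\<sigma> x)" if "x \<in> Lo" for x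
    proof -
      have x: "x < n" "\<sigma> x < n" "x < stop" "\<sigma> x < stop" using that stop_le by (auto simp: Lo_def)
      have nn: "4 * z * \<beta> (\<sigma> x) \<ge> 0" using \<beta>_nonneg x z by simp
      show ?thesis
      proof (cases "x < \<sigma> x")
        case True
        have "ov (\<sigma> x) \<le> M x" using u_dec[of x "\<sigma> x"] True x by (auto simp: ov_def M_def)
        then show ?thesis using drop[of x] True x by linarith
      next
        case False
        have "ov x \<le> M x" using w_dec[of "\<sigma> x" x] False x by (auto simp: ov_def M_def)
        then show ?thesis using nn by linarith
      qed
    qed
    then have "sum ov Lo \<le> sum M Lo + 4 * z * (\<Sum>x\<in>Lo. \<beta> (\<sigma> x))"
      by (simp add: sum_distrib_left flip: sum.distrib) (intro sum_mono, simp)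
    moreover have "(\<Sum>x\<in>Lo. \<beta> (\<sigma> x)) \<le> 2 * \<Lambda>"
    proof -
      have "inj_on \<sigma> Lo" using \<sigma> stop_le by (auto simp: bij_betw_def Lo_def intro: inj_on_subset)
      then have "(\<Sum>x\<in>Lo. \<beta> (\<sigma> x)) = sum \<beta> (\<sigma> ` Lo)" by (simp add: sum.reindex)
      also have "\<dots> \<le> sum \<beta> {..<stop}" using \<beta>_nonneg by (intro sum_mono2) (auto simp: Lo_def)
      finally show ?thesis using \<beta>_sum by linarith
    qed
    then have "4 * z * (\<Sum>x\<in>Lo. \<beta> (\<sigma> x)) \<le> 4 * z * (2 * \<Lambda>)" using z by (intro mult_left_mono) auto
    ultimately show ?thesis by linarith
  qed
  moreover have "sum M Lo \<le> sum M {..<n}"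
    using stop_le u_nonneg w_nonneg \<sigma>_less by (intro sum_mono2) (auto simp: M_def Lo_def)
  ultimately have "sum M {..<n} \<ge> 1 - z - \<alpha> - 2 * z * \<Lambda> - 8 * z * \<Lambda> - 3 * V"
    using ov_sum crossing by linarith
  moreover have "V \<le> 2 * z + \<alpha> + 2 * z * \<Lambda>" using U_stop by (simp add: V_def)
  \<comment> \<open>Here 7 z + 4 \<alpha> = 15 z, and 16 z \<Lambda> brings another 16 z and the
    logarithmic term: the origin of 31 and 16.\<close>
  ultimately have "sum M {..<n} \<ge> 1 - 7 * z - 4 * \<alpha> - 16 * z * \<Lambda>" by linarith
  moreover have "\<Lambda> \<le> 1 + ln (1 / z)" using z by (simp add: \<Lambda>_def \<alpha>_def ln_div ln_mult)
  then have "z * \<Lambda> \<le> z * (1 + ln (1 / z))" using z by (intro mult_left_mono) auto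
  ultimately show ?thesis using z by (simp add: M_def \<alpha>_def algebra_simps)
qed


section \<open>From sorted sequences to distributions on a finite set\<close>

lemma score_mult_le:
  assumes "finite A" "\<nu> x > 0" "\<And>y. y \<in> A \<Longrightarrow> \<nu> y \<ge> 0"
  shows "score A \<nu> x * \<nu> x \<le> sum \<nu> A"
proof -
  have "score A \<nu> x * \<nu> x = (\<Sum>y\<in>A. min 1 (\<nu> y / \<nu> x) * \<nu> x)" by (simp add: score_def sum_distrib_right)
  also have "\<dots> \<le> (\<Sum>y\<in>A. \<nu> y / \<nu> x * \<nu> x)" using assms by (intro sum_mono mult_right_mono) auto
  finally show ?thesis using assms by simp
qed

lemma score_subset_bounds:
  assumes "finite \<Omega>" "A \<subseteq> \<Omega>" "\<nu> x > 0" "\<And>y. y \<in> \<Omega> \<Longrightarrow> \<nu> y \<ge> 0"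
  shows "score A \<nu> x \<le> score \<Omega> \<nu> x" "score \<Omega> \<nu> x \<le> score A \<nu> x + sum \<nu> (\<Omega> - A) / \<nu> x"
proof -
  have eq: "score \<Omega> \<nu> x = score A \<nu> x + (\<Sum>y\<in>\<Omega> - A. min 1 (\<nu> y / \<nu> x))"
    unfolding score_def using assms(1,2) by (simp add: sum.subset_diff[of A \<Omega>] add.commute)
  show "score A \<nu> x \<le> score \<Omega> \<nu> x"
    unfolding eq using assms by (auto intro!: sum_nonneg)
  have "(\<Sum>y\<in>\<Omega> - A. min 1 (\<nu> y / \<nu> x)) \<le> (\<Sum>y\<in>\<Omega> - A. \<nu> y / \<nu> x)" by (intro sum_mono) auto
  then show "score \<Omega> \<nu> x \<le> score A \<nu> x + sum \<nu> (\<Omega> - A) / \<nu> x"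
    unfolding eq by (simp add: sum_divide_distrib)
qed

lemma score_le_card_support:
  assumes "finite A" "\<nu> x > 0" "\<And>y. y \<in> A \<Longrightarrow> \<nu> y \<ge> 0"
  shows "score A \<nu> x \<le> real (card {y \<in> A. \<nu> y > 0})"
proof -
  have "score A \<nu> x \<le> (\<Sum>y\<in>A. if \<nu> y > 0 then 1 else 0)"
    unfolding score_def using assms by (intro sum_mono) (auto simp: divide_nonpos_pos)
  also have "\<dots> = real (card {y \<in> A. \<nu> y > 0})"
    using assms(1) by (simp add: sum.If_cases Collect_conj_eq Int_commute)
  finally show ?thesis .
qed

lemma score_bij_betw:
  assumes "bij_betw f I A"
  shows "score A \<nu> (f i) = score I (\<nu> \<circ> f) i"
  unfolding score_def using sum.reindex_bij_betw[OF assms, of "\<lambda>y. min 1 (\<nu> y / \<nu> (f i))"] by simp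

text \<open>The sequences are the values on \<open>X\<close>, the good points that \<tau> can take,
  sorted once by \<mu> and once by \<tau>; \<sigma> relates the two enumerations. Points that only
  \<tau> takes stay in \<open>X\<close>: \<mu> has no score there, and \<open>G2\<close> uses the
  size of the support of \<mu>, which bounds every score of \<mu>. Points that only \<mu> takes go
  into the discarded mass \<open>e\<close>.\<close>

theorem overlap_of_close_scores_set:
  fixes \<mu> \<tau> :: "'a \<Rightarrow> real"
  assumes fin: "finite \<Omega>"
    and nonneg: "\<And>x. x \<in> \<Omega> \<Longrightarrow> \<mu> x \<ge> 0" "\<And>x. x \<in> \<Omega> \<Longrightarrow> \<tau> x \<ge> 0"
    and sums: "sum \<mu> \<Omega> = 1" "sum \<tau> \<Omega> = 1"
    and G1: "\<And>x. x \<in> G \<Longrightarrow> x \<in> \<Omega> \<Longrightarrow> \<mu> x > 0 \<Longrightarrow> \<tau> x > 0 \<Longrightarrow> score \<Omega> \<tau> x \<le> (1 + \<eta>) * score \<Omega> \<mu> x"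
    and G1': "\<And>x. x \<in> G \<Longrightarrow> x \<in> \<Omega> \<Longrightarrow> \<mu> x > 0 \<Longrightarrow> \<tau> x > 0 \<Longrightarrow> score \<Omega> \<mu> x \<le> (1 + \<eta>) * score \<Omega> \<tau> x"
    and G2: "\<And>x. x \<in> G \<Longrightarrow> x \<in> \<Omega> \<Longrightarrow> \<mu> x = 0 \<Longrightarrow> \<tau> x > 0 \<Longrightarrow>
               real (card {y \<in> \<Omega>. \<mu> y > 0}) \<le> (1 + \<eta>) * score \<Omega> \<tau> x"
    and rest: "sum \<mu> {x \<in> \<Omega>. x \<notin> G \<or> \<tau> x = 0} \<le> e" "sum \<tau> {x \<in> \<Omega>. x \<notin> G} \<le> e"
    and \<eta>: "\<eta> \<ge> 0" and z: "\<eta> + e \<le> z" "0 < z" "z \<le> 1 / 2"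
  shows "(\<Sum>x\<in>\<Omega>. min (\<mu> x) (\<tau> x)) \<ge> 1 - z * (31 + 16 * ln (1 / z))"
proof -
  define X where "X = {x \<in> \<Omega>. x \<in> G \<and> \<tau> x > 0}"
  define n where "n = card X"
  have X: "finite X" "X \<subseteq> \<Omega>" using fin by (auto simp: X_def)
  have XD: "x \<in> \<Omega>" "x \<in> G" "\<tau> x > 0" "\<mu> x \<ge> 0" if "x \<in> X" for x using that nonneg by (auto simp: X_def)
  have diff: "\<Omega> - X = {x \<in> \<Omega>. x \<notin> G \<or> \<tau> x = 0}" using nonneg(2) by (force simp: X_def)
  have \<mu>X: "sum \<mu> (\<Omega> - X) \<le> e" using rest(1) diff by simp
  have \<tau>X: "sum \<tau> (\<Omega> - X) \<le> e"
  proof -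
    have "sum \<tau> (\<Omega> - X) = sum \<tau> {x \<in> \<Omega>. x \<notin> G}"
      unfolding diff using fin by (intro sum.mono_neutral_right) auto
    then show ?thesis using rest(2) by simp
  qed
  have total: "sum \<mu> X = 1 - sum \<mu> (\<Omega> - X)" "sum \<tau> X = 1 - sum \<tau> (\<Omega> - X)"
    using sums sum.subset_diff[OF X(2) fin, of \<mu>] sum.subset_diff[OF X(2) fin, of \<tau>] by auto
  have nn: "sum \<mu> (\<Omega> - X) \<ge> 0" "sum \<tau> (\<Omega> - X) \<ge> 0" using nonneg by (auto intro!: sum_nonneg)
  \<comment> \<open>A score at mass \<open>q\<close> is at most 1 / q, so the relative error \<eta>
    becomes \<open>\<eta> / q\<close>; together with the discarded mass this is what
    \<open>\<eta> + e \<le> z\<close> pays for.\<close>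
  have transfer: "a' \<le> b' + z / q"
    if "a' \<le> a" "a \<le> (1 + \<eta>) * b" "b * q \<le> 1" "b \<le> b' + s / q" "s \<le> e" "q > 0" for a a' b b' s q :: real
  proof -
    have "b \<le> 1 / q" using that by (simp add: field_simps)
    then have "\<eta> * b \<le> \<eta> * (1 / q)" using \<eta> by (intro mult_left_mono) auto
    moreover have "s / q \<le> e / q" using that by (intro divide_right_mono) auto
    moreover have "(\<eta> + e) / q \<le> z / q" using that z by (intro divide_right_mono) auto
    ultimately show ?thesis using that by (simp add: algebra_simps add_divide_distrib)
  qed
  have Q1: "score X \<tau> x \<le> score X \<mu> x + z / \<mu> x" if "x \<in> X" "\<mu> x > 0" for x
    using score_subset_bounds[OF fin X(2), of \<tau> x] score_subset_bounds[OF fin X(2), of \<mu> x]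
      score_mult_le[OF fin, of \<mu> x] G1[of x] XD[OF that(1)] that nonneg sums \<mu>X
    by (intro transfer[of _ "score \<Omega> \<tau> x" "score \<Omega> \<mu> x"]) auto
  have Q2: "score X \<mu> x \<le> score X \<tau> x + z / \<tau> x" if "x \<in> X" "\<mu> x > 0" for x
    using score_subset_bounds[OF fin X(2), of \<tau> x] score_subset_bounds[OF fin X(2), of \<mu> x]
      score_mult_le[OF fin, of \<tau> x] G1'[of x] XD[OF that(1)] that nonneg sums \<tau>X
    by (intro transfer[of _ "score \<Omega> \<mu> x" "score \<Omega> \<tau> x"]) auto
  have Q3: "score X \<mu> y \<le> score X \<tau> x + z / \<tau> x" if "x \<in> X" "\<mu> x = 0" "y \<in> X" "\<mu> y > 0" for x y
  proof -
    have "score X \<mu> y \<le> real (card {y \<in> \<Omega>. \<mu> y > 0})"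
      using score_subset_bounds(1)[OF fin X(2), of \<mu> y] score_le_card_support[OF fin, of \<mu> y] nonneg that
      by force
    then show ?thesis
      using score_subset_bounds[OF fin X(2), of \<tau> x]
        score_mult_le[OF fin, of \<tau> x] G2[of x] XD[OF that(1)] that nonneg sums \<tau>X
      by (intro transfer[of _ "real (card {y \<in> \<Omega>. \<mu> y > 0})" "score \<Omega> \<tau> x"]) auto
  qed
  obtain f where f: "bij_betw f {..<n} X" "\<And>i j. i \<le> j \<Longrightarrow> j < n \<Longrightarrow> \<mu> (f j) \<le> \<mu> (f i)"
    using decreasing_enumeration[OF X(1), of \<mu>] unfolding n_def by blast
  obtain g where g: "bij_betw g {..<n} X" "\<And>i j. i \<le> j \<Longrightarrow> j < n \<Longrightarrow> \<tau> (g j) \<le> \<tau> (g i)"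
    using decreasing_enumeration[OF X(1), of \<tau>] unfolding n_def by blast
  define \<sigma> where "\<sigma> = inv_into {..<n} g \<circ> f"
  have \<sigma>: "bij_betw \<sigma> {..<n} {..<n}"
    unfolding \<sigma>_def using f(1) bij_betw_inv_into[OF g(1)] by (rule bij_betw_trans)
  have fX: "f x \<in> X" if "x < n" for x using f(1) that by (auto simp: bij_betw_def)
  have gX: "g x \<in> X" if "x < n" for x using g(1) that by (auto simp: bij_betw_def)
  have g\<sigma>: "g (\<sigma> x) = f x" if "x < n" for x
    using bij_betw_inv_into_right[OF g(1) fX[OF that]] by (simp add: \<sigma>_def)
  have su: "score {..<n} (\<mu> \<circ> f) i = score X \<mu> (f i)" for i
    using score_bij_betw[OF f(1)] by simp
  have sw: "score {..<n} (\<tau> \<circ> g) i = score X \<tau> (g i)" for i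
    using score_bij_betw[OF g(1)] by simp
  have sumf: "sum (\<mu> \<circ> f) {..<n} = sum \<mu> X" using sum.reindex_bij_betw[OF f(1), of \<mu>] by simp
  have sumg: "sum (\<tau> \<circ> g) {..<n} = sum \<tau> X" using sum.reindex_bij_betw[OF g(1), of \<tau>] by simp
  have ez: "e \<le> z" using \<eta> z by linarith
  have "(\<Sum>x<n. min ((\<mu> \<circ> f) x) ((\<tau> \<circ> g) (\<sigma> x))) \<ge> 1 - z * (31 + 16 * ln (1 / z))"
  proof (rule overlap_of_close_scores[OF _ _ _ _ \<sigma>])
    show "sum (\<mu> \<circ> f) {..<n} \<ge> 1 - z" "sum (\<tau> \<circ> g) {..<n} \<ge> 1 - z" 
      "sum (\<mu> \<circ> f) {..<n} \<le> 1" "sum (\<tau> \<circ> g) {..<n} \<le> 1" 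
      unfolding sumf sumg total using ez \<mu>X \<tau>X nn by auto
  qed (use f(2) g(2) XD fX gX Q1 Q2 Q3 g\<sigma> z in \<open>auto simp: su[unfolded comp_def] sw[unfolded comp_def] comp_def\<close>)
  also have "(\<Sum>x<n. min ((\<mu> \<circ> f) x) ((\<tau> \<circ> g) (\<sigma> x))) = (\<Sum>x\<in>X. min (\<mu> x) (\<tau> x))"
    using sum.reindex_bij_betw[OF f(1), of "\<lambda>x. min (\<mu> x) (\<tau> x)"] g\<sigma> by simp
  also have "\<dots> \<le> (\<Sum>x\<in>\<Omega>. min (\<mu> x) (\<tau> x))"
    using X fin nonneg by (intro sum_mono2) auto
  finally show ?thesis .
qed

section \<open>Random subsets\<close>

definition random_subset :: "'a set \<Rightarrow> real \<Rightarrow> 'a set pmf" where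
  "random_subset A r = map_pmf (\<lambda>f. {y \<in> A. f y}) (Pi_pmf A False (\<lambda>_. bernoulli_pmf r))"

lemma set_random_subset: "set_pmf (random_subset A r) \<subseteq> Pow A"
  by (auto simp: random_subset_def)

lemma random_subset_empty: "random_subset {} r = return_pmf {}"
  by (simp add: random_subset_def)

lemma random_subset_insert:
  assumes "finite A" "x \<notin> A"
  shows "random_subset (insert x A) r =
           bind_pmf (bernoulli_pmf r) (\<lambda>b. map_pmf (\<lambda>S. if b then insert x S else S) (random_subset A r))"
proof -
  have "{y \<in> insert x A. (f(x := b)) y} = (if b then insert x {y \<in> A. f y} else {y \<in> A. f y})" for f b
    using assms by auto
  then show ?thesis
    unfolding random_subset_def Pi_pmf_insert[OF assms] pair_pmf_def
    by (simp add: map_bind_pmf bind_map_pmf pmf.map_comp comp_def map_pmf_def[symmetric] bind_return_pmf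
        cong: map_pmf_cong)
qed

abbreviation subset_expectation :: "'a set \<Rightarrow> real \<Rightarrow> ('a set \<Rightarrow> real) \<Rightarrow> real" where
  "subset_expectation A r \<equiv> measure_pmf.expectation (random_subset A r)"

lemma finite_set_random_subset: "finite A \<Longrightarrow> finite (set_pmf (random_subset A r))"
  using set_random_subset by (rule finite_subset) simp

lemma integrable_random_subset:
  fixes f :: "'a set \<Rightarrow> real"
  shows "finite A \<Longrightarrow> integrable (measure_pmf (random_subset A r)) f"
  by (intro integrable_measure_pmf_finite finite_set_random_subset)

lemma subset_expectation_insert:
  assumes "finite A" "x \<notin> A" "0 \<le> r" "r \<le> 1"
  shows "subset_expectation (insert x A) r f =
           (1 - r) * subset_expectation A r f + r * subset_expectation A r (\<lambda>S. f (insert x S))"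
proof -
  have "subset_expectation (insert x A) r f =
          measure_pmf.expectation (bernoulli_pmf r)
            (\<lambda>b. subset_expectation A r (\<lambda>S. f (if b then insert x S else S)))"
    unfolding random_subset_insert[OF assms(1,2)]
    by (subst pmf_expectation_bind[where A = UNIV]) (use assms(1) finite_set_random_subset in \<open>auto simp: integral_measure_pmf[where A = UNIV]\<close>)
  then show ?thesis using assms by simp
qed

lemma subset_expectation_mono:
  assumes "finite A" "\<And>S. S \<subseteq> A \<Longrightarrow> f S \<le> (g S :: real)"
  shows "subset_expectation A r f \<le> subset_expectation A r g"
  using assms set_random_subset[of A r]
  by (intro integral_mono_AE) (auto intro: integrable_random_subset simp: AE_measure_pmf_iff)

lemma subset_expectation_cong:
  assumes "\<And>S. S \<subseteq> A \<Longrightarrow> f S = (g S :: real)"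
  shows "subset_expectation A r f = subset_expectation A r g"
  using assms set_random_subset[of A r]
  by (intro integral_cong_AE) (auto simp: AE_measure_pmf_iff)

lemma subset_expectation_sum:
  assumes "finite A" "0 \<le> r" "r \<le> 1"
  shows "subset_expectation A r (\<lambda>S. \<Sum>y\<in>S. c y) = r * (\<Sum>y\<in>A. c y)"
  using assms
proof (induction A rule: finite_induct)
  case empty
  then show ?case by (simp add: random_subset_empty)
next
  case (insert x A)
  have "subset_expectation A r (\<lambda>S. \<Sum>y\<in>insert x S. c y) = subset_expectation A r (\<lambda>S. c x + (\<Sum>y\<in>S. c y))"
    using insert by (intro subset_expectation_cong) (auto simp: finite_subset intro!: sum.insert)
  also have "\<dots> = c x + subset_expectation A r (\<lambda>S. \<Sum>y\<in>S. c y)"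
    using insert by (simp add: integrable_random_subset)
  finally show ?case using insert by (simp add: subset_expectation_insert algebra_simps)
qed

lemma subset_expectation_prod:
  assumes "finite A" "0 \<le> r" "r \<le> 1"
  shows "subset_expectation A r (\<lambda>S. \<Prod>y\<in>S. 1 - a y) = (\<Prod>y\<in>A. 1 - r * a y)"
  using assms
proof (induction A rule: finite_induct)
  case empty
  then show ?case by (simp add: random_subset_empty)
next
  case (insert x A)
  have "subset_expectation A r (\<lambda>S. \<Prod>y\<in>insert x S. 1 - a y) =
          subset_expectation A r (\<lambda>S. (1 - a x) * (\<Prod>y\<in>S. 1 - a y))"
    using insert by (intro subset_expectation_cong) (auto simp: finite_subset intro!: prod.insert)
  also have "\<dots> = (1 - a x) * (\<Prod>y\<in>A. 1 - r * a y)" using insert by simp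
  finally have "subset_expectation (insert x A) r (\<lambda>S. \<Prod>y\<in>S. 1 - a y) =
      (1 - r) * (\<Prod>y\<in>A. 1 - r * a y) + r * ((1 - a x) * (\<Prod>y\<in>A. 1 - r * a y))"
    using insert by (subst subset_expectation_insert) simp_all
  also have "\<dots> = (1 - r * a x) * (\<Prod>y\<in>A. 1 - r * a y)" by (simp add: algebra_simps)
  finally show ?case using insert by simp
qed

text \<open>By convexity the expectation lies above the value at the mean, so an upper bound has to
  lose a constant. Including one point changes \<open>u\<close> by \<open>a x\<close>, which is why
  \<open>u\<close> is general; the factor 1/2 is the price of \<open>v + a x \<le> 2 * v\<close>,
  valid as \<open>a x \<le> 1 \<le> v\<close>.\<close>

lemma subset_expectation_inverse_le:
  assumes "finite A" "0 \<le> r" "r \<le> 1" "\<And>y. y \<in> A \<Longrightarrow> 0 \<le> a y \<and> a y \<le> 1" "u \<ge> 1"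
  shows "subset_expectation A r (\<lambda>S. 1 / (u + (\<Sum>y\<in>S. a y))) \<le> 1 / (u + r * (\<Sum>y\<in>A. a y) / 2)"
  using assms
proof (induction A arbitrary: u rule: finite_induct)
  case empty
  then show ?case by (simp add: random_subset_empty)
next
  case (insert x A)
  define v where "v = u + r * sum a A / 2"
  have s: "sum a A \<ge> 0" using insert.prems by (intro sum_nonneg) auto
  have v: "v \<ge> 1" using insert.prems s by (simp add: v_def add_increasing2)
  have ax: "0 \<le> a x" "a x \<le> 1" using insert.prems by auto
  have 1: "subset_expectation A r (\<lambda>S. 1 / (u + (\<Sum>y\<in>S. a y))) \<le> 1 / v"
    using insert by (simp add: v_def)
  have "subset_expectation A r (\<lambda>S. 1 / (u + (\<Sum>y\<in>insert x S. a y))) =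
          subset_expectation A r (\<lambda>S. 1 / ((u + a x) + (\<Sum>y\<in>S. a y)))"
  proof (rule subset_expectation_cong)
    fix S assume "S \<subseteq> A"
    then have "finite S" "x \<notin> S" using insert by (auto intro: finite_subset)
    then show "1 / (u + (\<Sum>y\<in>insert x S. a y)) = 1 / ((u + a x) + (\<Sum>y\<in>S. a y))" by (simp add: add.assoc)
  qed
  also have "\<dots> \<le> 1 / (v + a x)"
    using insert.IH[of "u + a x"] insert.prems ax by (simp add: v_def algebra_simps)
  finally have 2: "subset_expectation A r (\<lambda>S. 1 / (u + (\<Sum>y\<in>insert x S. a y))) \<le> 1 / (v + a x)" .
  have "subset_expectation (insert x A) r (\<lambda>S. 1 / (u + (\<Sum>y\<in>S. a y))) \<le> (1 - r) * (1 / v) + r * (1 / (v + a x))"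
    using insert.hyps insert.prems
    by (subst subset_expectation_insert) (auto intro!: add_mono mult_left_mono 1 2 simp del: times_divide_eq_right)
  also have "\<dots> \<le> 1 / (v + r * a x / 2)"
  proof -
    have "v \<noteq> 0" "v + a x \<noteq> 0" using v ax by auto
    then have "a x / (v * (v + a x)) = 1 / v - 1 / (v + a x)" by (simp add: diff_frac_eq)
    then have "1 / (v + a x) = 1 / v - a x / (v * (v + a x))" by simp
    then have "(1 - r) * (1 / v) + r * (1 / (v + a x)) = 1 / v - r * (a x / (v * (v + a x)))"
      by (simp only: right_diff_distrib left_diff_distrib)
    then have "(1 - r) * (1 / v) + r * (1 / (v + a x)) = 1 / v - r * a x / (v * (v + a x))" by simp
    also have "\<dots> \<le> 1 / v - r * a x / (v * (2 * v))"
    proof (intro diff_left_mono divide_left_mono mult_left_mono mult_pos_pos)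
      show "v + a x \<le> 2 * v" using v ax by linarith
      show "0 \<le> r * a x" using ax insert.prems(1) by simp
    qed (use v ax in linarith)+
    also have "\<dots> \<le> 1 / (v + r * a x / 2)"
    proof -
      define q where "q = r * a x / 2"
      have q: "q \<ge> 0" using ax insert.prems by (simp add: q_def)
      have "1 / v - q / (v * v) \<le> 1 / (v + q)"
        using v q by (simp add: field_simps)
      then show ?thesis by (simp add: q_def)
    qed
    finally show ?thesis .
  qed
  also have "v + r * a x / 2 = u + r * sum a (insert x A) / 2"
    using insert by (simp add: v_def algebra_simps add_divide_distrib)
  finally show ?case .
qed

context
  fixes A :: "'a set" and r :: real and t :: "'a \<Rightarrow> real"
  assumes A: "finite A" and r: "0 \<le> r" "r \<le> 1" and t: "\<And>y. y \<in> A \<Longrightarrow> t y \<ge> 0"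
begin

lemma min_1_sum_le: "S \<subseteq> A \<Longrightarrow> min 1 (\<Sum>y\<in>S. t y) \<le> (\<Sum>y\<in>S. min 1 (t y))"
proof -
  assume "S \<subseteq> A"
  then have "finite S" using A by (rule finite_subset)
  then show ?thesis using \<open>S \<subseteq> A\<close>
  proof (induction S rule: finite_induct)
    case (insert x S)
    have "sum t S \<ge> 0" using insert t by (intro sum_nonneg) auto
    then show ?case using insert t[of x] by (auto simp: min_def split: if_splits)
  qed simp
qed

lemma expectation_min_le: "subset_expectation A r (\<lambda>S. min 1 (\<Sum>y\<in>S. t y)) \<le> r * (\<Sum>y\<in>A. min 1 (t y))"
  using subset_expectation_mono[OF A, of "\<lambda>S. min 1 (\<Sum>y\<in>S. t y)" "\<lambda>S. \<Sum>y\<in>S. min 1 (t y)" r]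
    subset_expectation_sum[OF A r, of "\<lambda>y. min 1 (t y)"] min_1_sum_le by simp

text \<open>One minus the product is the probability that some one of independent events of
  probabilities \<open>min 1 (t y)\<close> occurs, hence at most the sum by a union bound. Over the
  random set, the expectation of the product factorizes.\<close>

lemma expectation_min_ge:
  "subset_expectation A r (\<lambda>S. min 1 (\<Sum>y\<in>S. t y)) \<ge> 1 - exp (- (r * (\<Sum>y\<in>A. min 1 (t y))))"
proof -
  have prod_ge: "1 - (\<Prod>y\<in>S. 1 - min 1 (t y)) \<le> min 1 (\<Sum>y\<in>S. t y)" if "S \<subseteq> A" for S
  proof -
    have "finite S" using A that finite_subset by auto
    have "(\<Prod>y\<in>S. 1 - min 1 (t y)) \<ge> 0" by (intro prod_nonneg) auto
    moreover have "1 - (\<Prod>y\<in>S. 1 - min 1 (t y)) \<le> (\<Sum>y\<in>S. t y)"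
      using \<open>finite S\<close> that
    proof (induction S rule: finite_induct)
      case (insert x S)
      define P where "P = (\<Prod>y\<in>S. 1 - min 1 (t y))"
      have P: "0 \<le> P" "P \<le> 1" using insert t unfolding P_def by (auto intro!: prod_nonneg prod_le_1)
      have "1 - (1 - min 1 (t x)) * P = (1 - P) + min 1 (t x) * P" by (simp add: algebra_simps)
      also have "\<dots> \<le> (\<Sum>y\<in>S. t y) + t x * 1"
        using insert P t[of x] unfolding P_def[symmetric] by (intro add_mono mult_mono) auto
      finally show ?case using insert by (simp add: P_def)
    qed simp
    ultimately show ?thesis by simp
  qed
  have "(\<Prod>y\<in>A. 1 - r * min 1 (t y)) \<le> (\<Prod>y\<in>A. exp (- (r * min 1 (t y))))"
  proof (intro prod_mono conjI)
    fix y assume "y \<in> A"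
    have "r * min 1 (t y) \<le> 1 * 1" using r t[OF \<open>y \<in> A\<close>] by (intro mult_mono) auto
    then show "0 \<le> 1 - r * min 1 (t y)" by simp
    show "1 - r * min 1 (t y) \<le> exp (- (r * min 1 (t y)))"
      using exp_ge_add_one_self[of "- (r * min 1 (t y))"] by simp
  qed
  also have "\<dots> = exp (- (r * (\<Sum>y\<in>A. min 1 (t y))))"
    using A by (simp add: exp_sum sum_negf[symmetric] sum_distrib_left)
  finally have "1 - exp (- (r * (\<Sum>y\<in>A. min 1 (t y)))) \<le> 1 - (\<Prod>y\<in>A. 1 - r * min 1 (t y))" by simp
  also have "\<dots> = subset_expectation A r (\<lambda>S. 1 - (\<Prod>y\<in>S. 1 - min 1 (t y)))"
    using subset_expectation_prod[OF A r, of "\<lambda>y. min 1 (t y)"] A by (simp add: integrable_random_subset)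
  also have "\<dots> \<le> subset_expectation A r (\<lambda>S. min 1 (\<Sum>y\<in>S. t y))"
    using prod_ge A by (intro subset_expectation_mono) auto
  finally show ?thesis .
qed

lemma expectation_inverse_le:
  "subset_expectation A r (\<lambda>S. 1 / (1 + (\<Sum>y\<in>S. t y))) \<le> 1 / (1 + r * (\<Sum>y\<in>A. min 1 (t y)) / 2)"
proof -
  have "subset_expectation A r (\<lambda>S. 1 / (1 + (\<Sum>y\<in>S. t y))) \<le>
          subset_expectation A r (\<lambda>S. 1 / (1 + (\<Sum>y\<in>S. min 1 (t y))))"
  proof (intro subset_expectation_mono A divide_left_mono mult_pos_pos)
    fix S assume S: "S \<subseteq> A"
    show "1 + (\<Sum>y\<in>S. min 1 (t y)) \<le> 1 + (\<Sum>y\<in>S. t y)" by (intro add_left_mono sum_mono) auto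
    have "(\<Sum>y\<in>S. min 1 (t y)) \<ge> 0" "(\<Sum>y\<in>S. t y) \<ge> 0" using t S by (auto intro!: sum_nonneg)
    then show "1 + (\<Sum>y\<in>S. min 1 (t y)) > 0" "1 + (\<Sum>y\<in>S. t y) > 0" by linarith+
  qed auto
  also have "\<dots> \<le> 1 / (1 + r * (\<Sum>y\<in>A. min 1 (t y)) / 2)"
    using A r t by (intro subset_expectation_inverse_le) auto
  finally show ?thesis .
qed

text \<open>In each summand the denominator shrinks from the whole sum to \<open>1 + t y\<close>.
  Unlike \<open>min 1 (t y)\<close>, the bound stays below 1 at heavier points as well; this deficit
  later bounds the mass of points that only one distribution takes.\<close>

lemma expectation_fraction_le:
  "subset_expectation A r (\<lambda>S. (\<Sum>y\<in>S. t y) / (1 + (\<Sum>y\<in>S. t y))) \<le> r * (\<Sum>y\<in>A. t y / (1 + t y))"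
proof -
  have "(\<Sum>y\<in>S. t y) / (1 + (\<Sum>y\<in>S. t y)) \<le> (\<Sum>y\<in>S. t y / (1 + t y))" if S: "S \<subseteq> A" for S
  proof -
    have fin: "finite S" using A S finite_subset by auto
    have "(\<Sum>y\<in>S. t y / (1 + (\<Sum>y\<in>S. t y))) \<le> (\<Sum>y\<in>S. t y / (1 + t y))"
    proof (intro sum_mono divide_left_mono mult_pos_pos)
      fix y assume y: "y \<in> S"
      show "1 + t y \<le> 1 + (\<Sum>y\<in>S. t y)" using y S fin t by (auto intro!: member_le_sum)
      show "t y \<ge> 0" using y S t by auto
      then show "1 + t y > 0" by linarith
      have "(\<Sum>y\<in>S. t y) \<ge> 0" using S t by (intro sum_nonneg) auto
      then show "1 + (\<Sum>y\<in>S. t y) > 0" by linarith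
    qed
    then show ?thesis by (simp add: sum_divide_distrib)
  qed
  then show ?thesis
    using subset_expectation_mono[OF A, of "\<lambda>S. (\<Sum>y\<in>S. t y) / (1 + (\<Sum>y\<in>S. t y))" "\<lambda>S. \<Sum>y\<in>S. t y / (1 + t y)" r]
      subset_expectation_sum[OF A r, of "\<lambda>y. t y / (1 + t y)"] by simp
qed

lemma expectation_hits:
  assumes "B \<subseteq> A"
  shows "subset_expectation A r (\<lambda>S. if S \<inter> B = {} then 0 else 1) = 1 - (1 - r) ^ card B"
proof -
  have "(if S \<inter> B = {} then 0 else 1 :: real) = 1 - (\<Prod>y\<in>S. 1 - (if y \<in> B then 1 else 0))" if "S \<subseteq> A" for S
  proof -
    have "finite S" using A that finite_subset by auto
    then show ?thesis by (cases "S \<inter> B = {}") (auto intro!: prod.neutral simp: prod_zero_iff)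
  qed
  then have "subset_expectation A r (\<lambda>S. if S \<inter> B = {} then 0 else 1) =
      subset_expectation A r (\<lambda>S. 1 - (\<Prod>y\<in>S. 1 - (if y \<in> B then 1 else 0)))"
    by (rule subset_expectation_cong)
  also have "\<dots> = 1 - (\<Prod>y\<in>A. 1 - r * (if y \<in> B then 1 else 0))"
    using subset_expectation_prod[OF A r, of "\<lambda>y. if y \<in> B then 1 else 0"] A
    by (simp add: integrable_random_subset)
  also have "(\<Prod>y\<in>A. 1 - r * (if y \<in> B then 1 else 0)) = (\<Prod>y\<in>A. if y \<in> B then 1 - r else 1)"
    by (intro prod.cong) auto
  also have "\<dots> = (1 - r) ^ card B"
    using A assms by (simp add: prod.If_cases Int_absorb1)
  finally show ?thesis .
qed

end

text \<open>Let \<open>x\<close> be the heaviest point of \<open>P\<close>. Every point of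
  \<open>B\<close> not heavier than \<open>x\<close> contributes at least 1/2 to the sum, so there
  are at most \<open>2 * \<xi> * card B\<close> of them, and \<open>P\<close> is among them. At
  least half of \<open>B\<close> is then heavier than \<open>x\<close>, so
  \<open>card B * \<mu> x \<le> 2\<close>, and \<open>P\<close> has mass at most
  \<open>2 * \<xi> * 2\<close>.\<close>

lemma mass_of_light_points:
  fixes \<mu> :: "'a \<Rightarrow> real"
  assumes fin: "finite B" and pos: "\<And>x. x \<in> B \<Longrightarrow> \<mu> x > 0" and total: "sum \<mu> B \<le> 1" and P: "P \<subseteq> B"
    and light: "\<And>x. x \<in> P \<Longrightarrow> 1 + (\<Sum>y\<in>B - {x}. \<mu> x / (\<mu> x + \<mu> y)) \<le> \<xi> * real (card B)"
    and \<xi>: "0 \<le> \<xi>" "\<xi> \<le> 1 / 4"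
  shows "sum \<mu> P \<le> 4 * \<xi>"
proof (cases "P = {}")
  case True
  then show ?thesis using \<xi> by simp
next
  case False
  have finP: "finite P" using P fin finite_subset by auto
  have "Max (\<mu> ` P) \<in> \<mu> ` P" using False finP by (intro Max_in) auto
  then obtain x where x: "x \<in> P" "Max (\<mu> ` P) = \<mu> x" by auto
  then have x: "x \<in> P" "\<And>y. y \<in> P \<Longrightarrow> \<mu> y \<le> \<mu> x"
    using finP Max_ge[of "\<mu> ` P"] by auto
  have xB: "x \<in> B" "\<mu> x > 0" using x P pos by auto
  \<comment> \<open>The summand 1 accounts for \<open>x\<close> itself, which the sum leaves
    out.\<close>
  have half: "1 / 2 * real (card C) \<le> \<xi> * real (card B)"
    if C: "C \<subseteq> B" "\<And>y. y \<in> C \<Longrightarrow> \<mu> y \<le> \<mu> x" for C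
  proof -
    have finC: "finite C" using C fin finite_subset by auto
    have "1 / 2 * real (card C) \<le> 1 + 1 / 2 * real (card (C - {x}))"
      using finC by (cases "x \<in> C") (simp_all add: card_Diff_singleton)
    also have "1 / 2 * real (card (C - {x})) = (\<Sum>y\<in>C - {x}. 1 / 2)" by simp
    also have "\<dots> \<le> (\<Sum>y\<in>C - {x}. \<mu> x / (\<mu> x + \<mu> y))"
    proof (intro sum_mono)
      fix y assume "y \<in> C - {x}"
      then have "0 < \<mu> y" "\<mu> y \<le> \<mu> x" using C pos by auto
      then show "1 / 2 \<le> \<mu> x / (\<mu> x + \<mu> y)" by (simp add: field_simps)
    qed
    also have "\<dots> \<le> (\<Sum>y\<in>B - {x}. \<mu> x / (\<mu> x + \<mu> y))"
    proof (intro sum_mono2)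
      fix y assume "y \<in> B - {x} - (C - {x})"
      then have "0 < \<mu> y" using pos by auto
      then show "0 \<le> \<mu> x / (\<mu> x + \<mu> y)" using xB by simp
    qed (use fin C in auto)
    finally show ?thesis using light[OF x(1)] by simp
  qed
  define C where "C = {y \<in> B. \<mu> y \<le> \<mu> x}"
  have "1 / 2 * real (card C) \<le> \<xi> * real (card B)" by (rule half) (auto simp: C_def)
  then have cardC: "real (card C) \<le> 2 * \<xi> * real (card B)" by simp
  have "1 / 2 * real (card P) \<le> \<xi> * real (card B)" using P x(2) by (rule half)
  then have cardP: "real (card P) \<le> 2 * \<xi> * real (card B)" by simp
  have "card C \<le> card B" using fin by (intro card_mono) (auto simp: C_def)
  then have cardD: "real (card (B - C)) = real (card B) - real (card C)"
    using fin by (subst card_Diff_subset) (auto simp: C_def of_nat_diff)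
  have "2 * \<xi> * real (card B) \<le> 1 / 2 * real (card B)" using \<xi> by (intro mult_right_mono) auto
  then have "real (card B) / 2 \<le> real (card (B - C))" using cardC cardD by linarith
  then have "real (card B) / 2 * \<mu> x \<le> real (card (B - C)) * \<mu> x" using xB by (intro mult_right_mono) auto
  also have "\<dots> = (\<Sum>y\<in>B - C. \<mu> x)" by simp
  also have "\<dots> \<le> sum \<mu> (B - C)" by (intro sum_mono) (auto simp: C_def)
  also have "\<dots> \<le> sum \<mu> B" using fin pos by (intro sum_mono2) (auto intro: less_imp_le)
  finally have B: "real (card B) * \<mu> x \<le> 2" using total by simp
  have "sum \<mu> P \<le> (\<Sum>y\<in>P. \<mu> x)" using x by (intro sum_mono) auto
  also have "\<dots> = real (card P) * \<mu> x" by simp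
  also have "\<dots> \<le> 2 * \<xi> * real (card B) * \<mu> x" using cardP xB by (intro mult_right_mono) auto
  also have "\<dots> = 2 * \<xi> * (real (card B) * \<mu> x)" by simp
  also have "\<dots> \<le> 2 * \<xi> * 2" using B \<xi> by (intro mult_left_mono) auto
  finally show ?thesis by simp
qed

section \<open>Sampling programs and the sign test\<close>

text \<open>Decision trees with an arbitrary result type, so that procedures can be composed.\<close>

datatype 'r prog =
    Ret 'r
  | PToss "nat pmf" "nat \<Rightarrow> 'r prog"
  | PSample source "nat set" "nat \<Rightarrow> 'r prog"

primrec pbind :: "'r prog \<Rightarrow> ('r \<Rightarrow> 's prog) \<Rightarrow> 's prog" where
  "pbind (Ret r) k = k r"
| "pbind (PToss p f) k = PToss p (\<lambda>i. pbind (f i) k)"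
| "pbind (PSample s A f) k = PSample s A (\<lambda>x. pbind (f x) k)"

primrec sem :: "(source \<Rightarrow> nat set \<Rightarrow> nat pmf) \<Rightarrow> 'r prog \<Rightarrow> 'r pmf" where
  "sem orc (Ret r) = return_pmf r"
| "sem orc (PToss p f) = bind_pmf p (\<lambda>i. sem orc (f i))"
| "sem orc (PSample s A f) = bind_pmf (orc s A) (\<lambda>x. sem orc (f x))"

text \<open>Ranging over all outcomes of a toss, and not only over its support, this is stronger
  than \<open>samples_at_most\<close> and spares reasoning about supports.\<close>

primrec samples_le :: "'r prog \<Rightarrow> nat \<Rightarrow> bool" where
  "samples_le (Ret r) n \<longleftrightarrow> True"
| "samples_le (PToss p f) n \<longleftrightarrow> (\<forall>i. samples_le (f i) n)"
| "samples_le (PSample s A f) n \<longleftrightarrow> n > 0 \<and> (\<forall>x. samples_le (f x) (n - 1))"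

primrec compile :: "bool prog \<Rightarrow> nat algorithm" where
  "compile (Ret b) = Answer b"
| "compile (PToss p f) = Toss p (\<lambda>i. compile (f i))"
| "compile (PSample s A f) = Sample s A (\<lambda>x. compile (f x))"

lemma run_compile: "run om ot (compile p) = sem (case_source om ot) p"
  by (induction p) (auto intro!: bind_pmf_cong split: source.splits)

lemma samples_at_most_compile: "samples_le p n \<Longrightarrow> samples_at_most (compile p) n"
  by (induction p arbitrary: n) auto

lemma sem_pbind [simp]: "sem orc (pbind p k) = bind_pmf (sem orc p) (\<lambda>r. sem orc (k r))"
  by (induction p) (auto simp: bind_return_pmf bind_assoc_pmf)

lemma samples_le_mono: "samples_le p m \<Longrightarrow> m \<le> n \<Longrightarrow> samples_le p n"
proof (induction p arbitrary: m n)
  case (PSample s A f)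
  have le: "m - 1 \<le> n - 1" using PSample.prems by auto
  have "samples_le (f x) (n - 1)" for x
    using PSample.IH[of "f x", OF _ _ le] PSample.prems by simp
  then show ?case using PSample.prems by simp
next
  case (PToss p f)
  have "samples_le (f i) n" for i using PToss.IH[of "f i" m n] PToss.prems by simp
  then show ?case by simp
qed simp

lemma samples_le_pbind: "samples_le p m \<Longrightarrow> (\<And>r. samples_le (k r) n) \<Longrightarrow> samples_le (pbind p k) (m + n)"
proof (induction p arbitrary: m)
  case (Ret r)
  then show ?case using samples_le_mono[of "k r" n "m + n"] by simp
next
  case (PSample s A f)
  have "samples_le (pbind (f x) k) (m - 1 + n)" for x
    using PSample.IH[of "f x" "m - 1"] PSample.prems by simp
  moreover have "m - 1 + n = m + n - 1" using PSample.prems by auto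
  ultimately show ?case using PSample.prems by simp
next
  case (PToss p f)
  have "samples_le (pbind (f i) k) (m + n)" for i
    using PToss.IH[of "f i" m] PToss.prems by simp
  then show ?case by simp
qed

definition query :: "source \<Rightarrow> nat set \<Rightarrow> nat prog" where
  "query s A = PSample s A Ret"

text \<open>Tosses return natural numbers, so a set travels as its code; the code is faithful on
  finite sets.\<close>

definition draw_subset :: "nat set \<Rightarrow> real \<Rightarrow> nat set prog" where
  "draw_subset A r = PToss (map_pmf set_encode (random_subset A r)) (\<lambda>i. Ret (set_decode i))"

definition flip :: "real \<Rightarrow> bool prog" where
  "flip q = PToss (map_pmf of_bool (bernoulli_pmf q)) (\<lambda>i. Ret (i = 1))"

lemma sem_query [simp]: "sem orc (query s A) = orc s A"
  by (simp add: query_def bind_return_pmf')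

lemma sem_draw_subset [simp]:
  assumes "finite A"
  shows "sem orc (draw_subset A r) = random_subset A r"
proof -
  have "sem orc (draw_subset A r) = map_pmf (set_decode \<circ> set_encode) (random_subset A r)"
    by (simp add: draw_subset_def bind_map_pmf map_pmf_def bind_assoc_pmf bind_return_pmf comp_def)
  also have "\<dots> = map_pmf id (random_subset A r)"
    using assms set_random_subset[of A r]
    by (intro map_pmf_cong) (auto simp: set_encode_inverse[OF finite_subset[OF _ assms]])
  finally show ?thesis by simp
qed

lemma sem_flip [simp]: "sem orc (flip q) = bernoulli_pmf q"
proof -
  have "sem orc (flip q) = map_pmf (\<lambda>b. of_bool b = (1::nat)) (bernoulli_pmf q)"
    by (simp add: flip_def bind_map_pmf map_pmf_def bind_assoc_pmf bind_return_pmf)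
  also have "(\<lambda>b. of_bool b = (1::nat)) = id" by auto
  finally show ?thesis by simp
qed

lemma samples_le_query: "samples_le (query s A) 1" by (simp add: query_def)
lemma samples_le_draw_subset: "samples_le (draw_subset A r) 0" by (simp add: draw_subset_def)
lemma samples_le_flip: "samples_le (flip q) 0" by (simp add: flip_def)

section \<open>Sums of independent runs and their signs\<close>

primrec sum_of :: "real prog \<Rightarrow> nat \<Rightarrow> real prog" where
  "sum_of p 0 = Ret 0"
| "sum_of p (Suc n) = pbind p (\<lambda>v. pbind (sum_of p n) (\<lambda>w. Ret (v + w)))"

lemma samples_le_sum_of: "samples_le p m \<Longrightarrow> samples_le (sum_of p n) (n * m)"
proof (induction n)
  case (Suc n)
  have "samples_le (sum_of p (Suc n)) (m + (n * m + 0))"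
    unfolding sum_of.simps by (intro samples_le_pbind Suc) auto
  then show ?case by simp
qed simp

lemma finite_sem_sum_of:
  "finite (set_pmf (sem orc p)) \<Longrightarrow> finite (set_pmf (sem orc (sum_of p n)))"
  by (induction n) auto

lemma expectation_bind_finite:
  fixes h :: "'b \<Rightarrow> real"
  assumes "finite (set_pmf P)" "\<And>x. x \<in> set_pmf P \<Longrightarrow> finite (set_pmf (f x))"
  shows "measure_pmf.expectation (bind_pmf P f) h =
           measure_pmf.expectation P (\<lambda>x. measure_pmf.expectation (f x) h)"
  using assms 
  by (subst pmf_expectation_bind[where A = "set_pmf P"]) (auto simp: integral_measure_pmf[where A = "set_pmf P"])

text \<open>The centre \<open>k\<close> is arbitrary because the induction moves the first summand
  into it. At \<open>k = real n * m\<close> the result is the variance of the sum.\<close>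

lemma sum_of_second_moment:
  fixes orc p
  defines "P \<equiv> sem orc p"
  defines "m \<equiv> measure_pmf.expectation P (\<lambda>v. v)"
  assumes fin: "finite (set_pmf P)"
  shows "measure_pmf.expectation (sem orc (sum_of p n)) (\<lambda>s. (s - k)\<^sup>2) =
           (k - real n * m)\<^sup>2 + real n * (measure_pmf.expectation P (\<lambda>v. v\<^sup>2) - m\<^sup>2)"
proof (induction n arbitrary: k)
  case 0
  then show ?case by (simp add: power2_eq_square)
next
  case (Suc n)
  define v where "v = measure_pmf.expectation P (\<lambda>v. v\<^sup>2) - m\<^sup>2"
  have int: "integrable (measure_pmf P) g" for g :: "real \<Rightarrow> real"
    using fin by (rule integrable_measure_pmf_finite)
  have finS: "finite (set_pmf (sem orc (sum_of p n)))"
    using fin unfolding P_def by (rule finite_sem_sum_of)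
  have "measure_pmf.expectation (sem orc (sum_of p (Suc n))) (\<lambda>s. (s - k)\<^sup>2) =
      measure_pmf.expectation P (\<lambda>a. measure_pmf.expectation (sem orc (sum_of p n)) (\<lambda>s. (s - (k - a))\<^sup>2))"
    using fin finS unfolding sum_of.simps sem_pbind P_def[symmetric]
    by (simp add: expectation_bind_finite algebra_simps)
  also have "\<dots> = measure_pmf.expectation P (\<lambda>a. (k - a - real n * m)\<^sup>2 + real n * v)"
    by (simp add: Suc v_def)
  also have "\<dots> = measure_pmf.expectation P (\<lambda>a. a\<^sup>2 - 2 * (k - real n * m) * a + ((k - real n * m)\<^sup>2 + real n * v))"
    by (intro Bochner_Integration.integral_cong) (auto simp: power2_eq_square algebra_simps)
  also have "\<dots> = measure_pmf.expectation P (\<lambda>a. a\<^sup>2) - 2 * (k - real n * m) * m + ((k - real n * m)\<^sup>2 + real n * v)"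
    using int by (simp add: m_def)
  also have "\<dots> = (k - real (Suc n) * m)\<^sup>2 + real (Suc n) * v"
    by (simp add: v_def power2_eq_square algebra_simps)
  finally show ?case by (simp add: v_def)
qed

abbreviation accept :: "(source \<Rightarrow> nat set \<Rightarrow> nat pmf) \<Rightarrow> bool prog \<Rightarrow> real" where
  "accept orc p \<equiv> pmf (sem orc p) True"

lemma expectation_bool: 
  fixes f :: "bool \<Rightarrow> real"
  shows "measure_pmf.expectation P f = pmf P True * f True + (1 - pmf P True) * f False"
  by (simp add: integral_measure_pmf[where A = UNIV] UNIV_bool pmf_False_conv_True)

lemma pmf_bind_bool:
  "pmf (bind_pmf P f) y = pmf P True * pmf (f True) y + (1 - pmf P True) * pmf (f False) y"
  by (simp add: pmf_bind expectation_bool)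

definition difference :: "bool prog \<Rightarrow> bool prog \<Rightarrow> real prog" where
  "difference p q = pbind p (\<lambda>b. pbind q (\<lambda>c. Ret (of_bool b - of_bool c)))"

primrec all_positive :: "real prog \<Rightarrow> nat \<Rightarrow> bool prog" where
  "all_positive d 0 = Ret True"
| "all_positive d (Suc l) = pbind d (\<lambda>v. if v > 0 then all_positive d l else Ret False)"

text \<open>A sign test has no threshold to calibrate. Demanding \<open>L\<close> positive sums in a
  row makes a false alarm exponentially unlikely, and for detection it is enough that each sum fails
  with probability at most 1 / (10 L).\<close>

definition exceeds :: "nat \<Rightarrow> nat \<Rightarrow> bool prog \<Rightarrow> bool prog \<Rightarrow> bool prog" where
  "exceeds L R p q = all_positive (sum_of (difference p q) R) L"

lemma accept_all_positive: "accept orc (all_positive d l) = measure_pmf.prob (sem orc d) {0<..} ^ l"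
proof (induction l)
  case (Suc l)
  have "accept orc (all_positive d (Suc l)) =
      measure_pmf.expectation (sem orc d) (\<lambda>v. indicator {0<..} v * accept orc (all_positive d l))"
    unfolding all_positive.simps sem_pbind pmf_bind
    by (intro Bochner_Integration.integral_cong) (auto simp: indicator_def)
  also have "\<dots> = measure_pmf.prob (sem orc d) {0<..} * accept orc (all_positive d l)" by simp
  finally show ?case using Suc by simp
qed simp

lemma samples_le_exceeds:
  assumes "samples_le p m" "samples_le q m"
  shows "samples_le (exceeds L R p q) (L * (R * (2 * m)))"
proof -
  have "samples_le (difference p q) (m + (m + 0))"
    unfolding difference_def using assms by (intro samples_le_pbind) auto
  then have "samples_le (sum_of (difference p q) R) (R * (2 * m))"
    using samples_le_sum_of by (metis add_0_right mult_2)
  then have "samples_le (all_positive (sum_of (difference p q) R) l) (l * (R * (2 * m)))" for l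
  proof (induction l)
    case (Suc l)
    then have "samples_le (all_positive (sum_of (difference p q) R) (Suc l)) (R * (2 * m) + l * (R * (2 * m)))"
      unfolding all_positive.simps by (intro samples_le_pbind) auto
    then show ?case by simp
  qed simp
  then show ?thesis by (simp add: exceeds_def)
qed

lemma sum_of_difference_swap:
  "map_pmf uminus (sem orc (sum_of (difference p q) n)) = sem orc (sum_of (difference q p) n)"
proof (induction n)
  case (Suc n)
  have "map_pmf uminus (sem orc (sum_of (difference p q) (Suc n))) =
     bind_pmf (sem orc p) (\<lambda>b. bind_pmf (sem orc q) (\<lambda>c.
       bind_pmf (map_pmf uminus (sem orc (sum_of (difference p q) n))) (\<lambda>w. return_pmf (of_bool c - of_bool b + w))))"
    by (simp add: difference_def map_bind_pmf bind_assoc_pmf bind_return_pmf bind_map_pmf)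
  also have "\<dots> = bind_pmf (sem orc q) (\<lambda>c. bind_pmf (sem orc p) (\<lambda>b.
       bind_pmf (sem orc (sum_of (difference q p) n)) (\<lambda>w. return_pmf (of_bool c - of_bool b + w))))"
    unfolding Suc by (rule bind_commute_pmf)
  also have "\<dots> = sem orc (sum_of (difference q p) (Suc n))"
    by (simp add: difference_def bind_assoc_pmf bind_return_pmf)
  finally show ?case .
qed simp

lemma sum_of_sem_cong: "sem orc p = sem orc q \<Longrightarrow> sem orc (sum_of p n) = sem orc (sum_of q n)"
  by (induction n) auto

text \<open>The sum of differences is symmetric here, so it is positive with probability at most \<open>1 / 2\<close>.\<close>

lemma accept_exceeds_equal_le:
  assumes "sem orc p = sem orc q"
  shows "accept orc (exceeds L R p q) \<le> (1 / 2) ^ L"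
proof -
  define D where "D = sem orc (sum_of (difference p q) R)"
  have "sem orc (sum_of (difference q p) R) = D"
    unfolding D_def using assms by (intro sum_of_sem_cong) (simp add: difference_def)
  then have sym: "map_pmf uminus D = D"
    using sum_of_difference_swap[of orc p q R] by (simp add: D_def)
  have "measure_pmf.prob D {0<..} = measure_pmf.prob (map_pmf uminus D) {0<..}" by (simp add: sym)
  also have "\<dots> = measure_pmf.prob D {..<0}" by (auto simp: vimage_def intro!: arg_cong[where f = "measure_pmf.prob D"])
  finally have "2 * measure_pmf.prob D {0<..} = measure_pmf.prob D {0<..} + measure_pmf.prob D {..<0}" by simp
  also have "\<dots> = measure_pmf.prob D ({0<..} \<union> {..<0})"
    by (subst measure_pmf.finite_measure_Union) auto
  also have "\<dots> \<le> 1" by simp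
  finally show ?thesis
    unfolding exceeds_def accept_all_positive D_def[symmetric] by (intro power_mono) auto
qed

text \<open>Chebyshev's inequality around the mean \<open>k\<close>: the variance is at most R / 2,
  so one sum is nonpositive with probability at most 1 / (2 R \<theta>^2) \<le> 1 / (10 L).
  Bernoulli's inequality combines the \<open>L\<close> sums.\<close>

lemma accept_exceeds_separated_ge:
  assumes sep: "accept orc p - accept orc q \<ge> \<theta>" and \<theta>: "\<theta> > 0"
    and R: "real R * \<theta>\<^sup>2 \<ge> 5 * real L" and L: "L > 0"
  shows "accept orc (exceeds L R p q) \<ge> 9 / 10"
proof -
  define D where "D = sem orc (sum_of (difference p q) R)"
  define a b where "a = accept orc p" and "b = accept orc q"
  define P where "P = sem orc (difference p q)"
  have finP: "finite (set_pmf P)" by (simp add: P_def difference_def)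
  have finD: "finite (set_pmf D)" using finP unfolding P_def D_def by (rule finite_sem_sum_of)
  have ab: "0 \<le> a" "a \<le> 1" "0 \<le> b" "b \<le> 1" by (auto simp: a_def b_def pmf_le_1)
  have E: "measure_pmf.expectation P h = a * (b * h 0 + (1 - b) * h 1) + (1 - a) * (b * h (-1) + (1 - b) * h 0)"
    for h :: "real \<Rightarrow> real"
    by (simp add: P_def difference_def expectation_bind_finite expectation_bool a_def b_def)
  have m: "measure_pmf.expectation P (\<lambda>v. v) = a - b" by (simp add: E algebra_simps)
  have v: "measure_pmf.expectation P (\<lambda>v. v\<^sup>2) - (a - b)\<^sup>2 = a * (1 - a) + b * (1 - b)"
    by (simp add: E power2_eq_square algebra_simps)
  have quarter: "c * (1 - c) \<le> 1 / 4" for c :: real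
    using zero_le_power2[of "c - 1/2"] by (simp add: power2_eq_square algebra_simps)
  have "0 < 5 * real L" using L by simp
  also note R
  finally have R0: "real R > 0" using \<theta> by (simp add: zero_less_mult_iff)
  define k where "k = real R * (a - b)"
  have kpos: "k \<ge> real R * \<theta>" "k > 0"
  proof -
    show "k \<ge> real R * \<theta>" using sep R0 by (simp add: k_def a_def b_def)
    moreover have "real R * \<theta> > 0" using R0 \<theta> by simp
    ultimately show "k > 0" by linarith
  qed
  have "measure_pmf.prob D {..0} = measure_pmf.expectation D (indicator {..0})" by simp
  also have "\<dots> \<le> measure_pmf.expectation D (\<lambda>s. (s - k)\<^sup>2 / k\<^sup>2)"
  proof (rule integral_mono)
    fix s
    have "k\<^sup>2 \<le> (s - k)\<^sup>2" if "s \<le> 0"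
      using kpos that by (intro abs_le_square_iff[THEN iffD1]) auto
    then show "indicator {..0} s \<le> (s - k)\<^sup>2 / k\<^sup>2"
      using kpos by (auto simp: indicator_def)
  qed (use finD in \<open>auto intro: integrable_measure_pmf_finite\<close>)
  also have "\<dots> = measure_pmf.expectation D (\<lambda>s. (s - k)\<^sup>2) / k\<^sup>2" by simp
  also have "measure_pmf.expectation D (\<lambda>s. (s - k)\<^sup>2) = real R * (a * (1 - a) + b * (1 - b))"
    using sum_of_second_moment[of orc "difference p q" R k] finP m v
    unfolding D_def P_def by (simp add: k_def)
  also have "\<dots> / k\<^sup>2 \<le> (real R * (1 / 2)) / k\<^sup>2"
    using quarter[of a] quarter[of b] R0 by (intro divide_right_mono mult_left_mono) auto
  also have "\<dots> \<le> (real R * (1 / 2)) / (real R * \<theta>)\<^sup>2"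
    using kpos R0 \<theta> by (intro divide_left_mono power_mono mult_pos_pos) auto
  also have "\<dots> = 1 / (2 * (real R * \<theta>\<^sup>2))" using R0 \<theta> by (simp add: power2_eq_square)
  also have "\<dots> \<le> 1 / (2 * (5 * real L))" using R L R0 \<theta> by (intro divide_left_mono mult_pos_pos) auto
  finally have "measure_pmf.prob D {..0} \<le> 1 / (10 * real L)" by simp
  moreover have "measure_pmf.prob D {0<..} = 1 - measure_pmf.prob D {..0}"
    using measure_pmf.prob_compl[of "{..0}" D] by (simp add: Compl_eq_Diff_UNIV[symmetric] not_le)
  ultimately have pos: "measure_pmf.prob D {0<..} \<ge> 1 - 1 / (10 * real L)" by simp
  have "9 / 10 = 1 + real L * (- (1 / (10 * real L)))" using L by simp
  also have "\<dots> \<le> (1 + (- (1 / (10 * real L)))) ^ L"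
    using L by (intro Bernoulli_inequality) (simp add: field_simps)
  also have "\<dots> \<le> measure_pmf.prob D {0<..} ^ L"
    using pos L by (intro power_mono) (auto simp: field_simps)
  finally show ?thesis unfolding exceeds_def accept_all_positive D_def .
qed

section \<open>Probing a point against random subsets\<close>

definition probe :: "source \<Rightarrow> nat set \<Rightarrow> nat \<Rightarrow> real \<Rightarrow> bool prog" where
  "probe s A x r = pbind (draw_subset A r) (\<lambda>S. pbind (query s (insert x S)) (\<lambda>y. Ret (y \<noteq> x)))"

text \<open>
  If a draw from \<open>insert x S\<close> differs from \<open>x\<close> with probability \<open>p = X / (1 + X)\<close>, where \<open>X\<close> is the mass of
  \<open>S\<close> relative to \<open>x\<close>, then \<open>p * tie_weight p = min 1 X / 2\<close>. The weight is Lipschitz, so the empirical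
  frequency of such draws can be substituted for \<open>p\<close>.
\<close>

definition tie_weight :: "real \<Rightarrow> real" where
  "tie_weight p = 1 / (2 * max p (1 - p))"

definition comparison :: "source \<Rightarrow> nat set \<Rightarrow> nat \<Rightarrow> nat \<Rightarrow> bool prog" where
  "comparison s B x m =
     pbind (sum_of (pbind (query s B) (\<lambda>y. Ret (of_bool (y \<noteq> x)))) m) (\<lambda>c. flip (tie_weight (c / real m)))"

text \<open>The expensive comparison is made once, on the first set from which a draw escapes. A run
  thus costs at most \<open>n + m\<close> samples and yet, while escapes are rare, accepts about
  \<open>n\<close> times as often as a single round.\<close>

primrec fine_probe :: "source \<Rightarrow> nat set \<Rightarrow> nat \<Rightarrow> real \<Rightarrow> nat \<Rightarrow> nat \<Rightarrow> bool prog" where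
  "fine_probe s A x r m 0 = Ret False"
| "fine_probe s A x r m (Suc n) =
     pbind (draw_subset A r) (\<lambda>S. pbind (query s (insert x S)) (\<lambda>y.
       if y \<noteq> x then comparison s (insert x S) x m else fine_probe s A x r m n))"

text \<open>The exponent is found bit by bit; with \<open>h\<close> bits left the result lies in
  \<open>{lo..<lo + 2 ^ h}\<close>. An escape at the midpoint suggests that the rate there is still
  high, so the exponent goes up.\<close>

primrec search :: "source \<Rightarrow> nat set \<Rightarrow> nat \<Rightarrow> nat \<Rightarrow> nat \<Rightarrow> nat prog" where
  "search s A x 0 lo = Ret lo"
| "search s A x (Suc h) lo =
     pbind (probe s A x (1 / 2 ^ (lo + 2 ^ h))) (\<lambda>b. search s A x h (if b then lo + 2 ^ h else lo))"

lemma samples_le_probe: "samples_le (probe s A x r) 1"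
proof -
  have "samples_le (probe s A x r) (0 + (1 + 0))"
    unfolding probe_def by (intro samples_le_pbind samples_le_draw_subset samples_le_query) auto
  then show ?thesis by simp
qed

lemma samples_le_comparison: "samples_le (comparison s B x m) m"
proof -
  have "samples_le (pbind (query s B) (\<lambda>y. Ret (of_bool (y \<noteq> x)) :: real prog)) (1 + 0)"
    by (intro samples_le_pbind samples_le_query) auto
  then have "samples_le (comparison s B x m) (m * 1 + 0)"
    unfolding comparison_def by (intro samples_le_pbind samples_le_sum_of samples_le_flip) simp
  then show ?thesis by simp
qed

lemma samples_le_fine_probe: "samples_le (fine_probe s A x r m n) (n + m)"
proof (induction n)
  case (Suc n)
  have "samples_le (if y \<noteq> x then comparison s B x m else fine_probe s A x r m n) (n + m)" for y B
    using Suc samples_le_comparison[THEN samples_le_mono] by simp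
  then have "samples_le (fine_probe s A x r m (Suc n)) (0 + (1 + (n + m)))"
    unfolding fine_probe.simps by (intro samples_le_pbind samples_le_draw_subset samples_le_query)
  then show ?case by simp
qed simp

lemma samples_le_search: "samples_le (search s A x h lo) h"
proof (induction h arbitrary: lo)
  case (Suc h)
  have "samples_le (search s A x (Suc h) lo) (1 + h)"
    unfolding search.simps by (intro samples_le_pbind samples_le_probe Suc)
  then show ?case by simp
qed simp

text \<open>Agreement is demanded only on sets through \<open>x\<close>: two oracles for the same
  distribution may differ on null sets, but a set that contains a point of the support is not
  null.\<close>

lemma sem_probe_cong:
  assumes "finite A" "\<And>S. S \<subseteq> A \<Longrightarrow> orc s (insert x S) = orc s' (insert x S)"
  shows "sem orc (probe s A x r) = sem orc (probe s' A x r)"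
  using assms set_random_subset[of A r] by (auto simp: probe_def intro!: bind_pmf_cong)

lemma sem_fine_probe_cong:
  assumes "finite A" "\<And>S. S \<subseteq> A \<Longrightarrow> orc s (insert x S) = orc s' (insert x S)"
  shows "sem orc (fine_probe s A x r m n) = sem orc (fine_probe s' A x r m n)"
proof (induction n)
  case (Suc n)
  have "sem orc (comparison s (insert x S) x m) = sem orc (comparison s' (insert x S) x m)"
    if "S \<subseteq> A" for S
  proof -
    have "sem orc (sum_of (pbind (query s (insert x S)) (\<lambda>y. Ret (of_bool (y \<noteq> x)))) m) =
          sem orc (sum_of (pbind (query s' (insert x S)) (\<lambda>y. Ret (of_bool (y \<noteq> x)))) m)"
      using assms(2)[OF that] by (intro sum_of_sem_cong) simp
    then show ?thesis by (simp add: comparison_def)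
  qed
  then show ?case
    using assms set_random_subset[of A r] Suc by (auto intro!: bind_pmf_cong)
qed simp

lemma pmf_map_neq: "pmf (bind_pmf P (\<lambda>y. return_pmf (y \<noteq> x))) True = 1 - pmf P x"
proof -
  have "pmf (bind_pmf P (\<lambda>y. return_pmf (y \<noteq> x))) True = measure_pmf.prob P (- {x})"
    by (simp add: map_pmf_def[symmetric] pmf_map vimage_def Compl_eq)
  also have "\<dots> = 1 - pmf P x"
    using measure_pmf.prob_compl[of "{x}" P] by (simp add: Compl_eq_Diff_UNIV pmf.rep_eq)
  finally show ?thesis .
qed

lemma tie_weight_bounds: "0 < tie_weight p" "tie_weight p \<le> 1"
  unfolding tie_weight_def by (auto simp: max_def field_simps)

lemma tie_weight_lipschitz: "\<bar>tie_weight p - tie_weight q\<bar> \<le> 2 * \<bar>p - q\<bar>"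
proof -
  define a b where "a = max p (1 - p)" and "b = max q (1 - q)"
  have ab: "a \<ge> 1 / 2" "b \<ge> 1 / 2" by (auto simp: a_def b_def max_def)
  have "\<bar>tie_weight p - tie_weight q\<bar> = \<bar>b - a\<bar> / (2 * a * b)"
  proof -
    have "tie_weight p - tie_weight q = (b - a) / (2 * a * b)"
      using ab unfolding tie_weight_def a_def[symmetric] b_def[symmetric] by (simp add: field_simps)
    then show ?thesis using ab by (simp add: abs_mult)
  qed
  also have "\<dots> \<le> \<bar>b - a\<bar> / (1 / 2)"
  proof (intro divide_left_mono)
    have "(1 / 2) * (1 / 2) \<le> a * b" using ab by (intro mult_mono) auto
    then show "1 / 2 \<le> 2 * a * b" by simp
  qed (use ab in auto)
  also have "\<bar>b - a\<bar> \<le> \<bar>p - q\<bar>" by (auto simp: a_def b_def max_def)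
  finally show ?thesis by simp
qed

text \<open>The average of \<open>M\<^sup>2\<close> samples has standard deviation at most 1 / M,
  and the weight is Lipschitz with constant 2. In place of a root of the second moment the proof
  uses 2 |u| \<le> u^2 M + 1 / M, which is linear in it.\<close>

lemma accept_comparison:
  assumes M: "M > 0"
  shows "\<bar>accept orc (comparison s B x (M\<^sup>2)) - tie_weight (1 - pmf (orc s B) x)\<bar> \<le> 2 / real M"
proof -
  define p where "p = 1 - pmf (orc s B) x"
  define P where "P = sem orc (pbind (query s B) (\<lambda>y. Ret (of_bool (y \<noteq> x) :: real)))"
  define C where "C = sem orc (sum_of (pbind (query s B) (\<lambda>y. Ret (of_bool (y \<noteq> x) :: real))) (M\<^sup>2))"
  have p: "0 \<le> p" "p \<le> 1" by (auto simp: p_def pmf_le_1)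
  have P: "P = map_pmf of_bool (bind_pmf (orc s B) (\<lambda>y. return_pmf (y \<noteq> x)))"
    by (simp add: P_def map_bind_pmf)
  have finP: "finite (set_pmf P)" unfolding P by simp
  have E: "measure_pmf.expectation P h = p * h 1 + (1 - p) * h 0" for h :: "real \<Rightarrow> real"
    unfolding P by (simp add: expectation_bool pmf_map_neq p_def)
  have finC: "finite (set_pmf C)" using finP unfolding P_def C_def by (rule finite_sem_sum_of)
  have int: "integrable (measure_pmf C) g" for g :: "real \<Rightarrow> real"
    using finC by (rule integrable_measure_pmf_finite)
  have "accept orc (comparison s B x (M\<^sup>2)) = measure_pmf.expectation C (\<lambda>c. tie_weight (c / real (M\<^sup>2)))"
    unfolding comparison_def sem_pbind C_def[unfolded sem_pbind, symmetric] pmf_bind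
    using tie_weight_bounds by (simp add: C_def less_imp_le)
  then have "\<bar>accept orc (comparison s B x (M\<^sup>2)) - tie_weight p\<bar> =
      \<bar>measure_pmf.expectation C (\<lambda>c. tie_weight (c / real (M\<^sup>2)) - tie_weight p)\<bar>"
    using int by simp
  also have "\<dots> \<le> measure_pmf.expectation C (\<lambda>c. \<bar>tie_weight (c / real (M\<^sup>2)) - tie_weight p\<bar>)"
    by (rule integral_abs_bound)
  also have "\<dots> \<le> measure_pmf.expectation C (\<lambda>c. (c - real (M\<^sup>2) * p)\<^sup>2 / real M ^ 3 + 1 / real M)"
  proof (rule integral_mono)
    fix c
    define u where "u = c / real (M\<^sup>2) - p"
    have "\<bar>tie_weight (c / real (M\<^sup>2)) - tie_weight p\<bar> \<le> 2 * \<bar>u\<bar>"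
      unfolding u_def by (rule tie_weight_lipschitz)
    also have "\<dots> \<le> u\<^sup>2 * real M + 1 / real M"
    proof -
      have "0 \<le> (\<bar>u\<bar> * real M - 1)\<^sup>2" by simp
      then have "2 * \<bar>u\<bar> * real M \<le> u\<^sup>2 * (real M)\<^sup>2 + 1"
        by (simp add: power2_eq_square algebra_simps)
      then show ?thesis using M by (simp add: field_simps power2_eq_square)
    qed
    also have "u\<^sup>2 * real M = (c - real (M\<^sup>2) * p)\<^sup>2 / real M ^ 3"
    proof -
      have "u = (c - real (M\<^sup>2) * p) / (real M)\<^sup>2" using M by (simp add: u_def field_simps)
      then show ?thesis using M by (simp add: power_divide power2_eq_square power3_eq_cube)
    qed
    finally show "\<bar>tie_weight (c / real (M\<^sup>2)) - tie_weight p\<bar> \<le> (c - real (M\<^sup>2) * p)\<^sup>2 / real M ^ 3 + 1 / real M" .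
  qed (auto intro: int)
  also have "\<dots> = measure_pmf.expectation C (\<lambda>c. (c - real (M\<^sup>2) * p)\<^sup>2) / real M ^ 3 + 1 / real M"
    using int by simp
  also have "measure_pmf.expectation C (\<lambda>c. (c - real (M\<^sup>2) * p)\<^sup>2) = real (M\<^sup>2) * (p - p\<^sup>2)"
    using sum_of_second_moment[of orc "pbind (query s B) (\<lambda>y. Ret (of_bool (y \<noteq> x)))" "M\<^sup>2" "real (M\<^sup>2) * p", folded P_def C_def, OF finP]
    by (simp add: E)
  also have "real (M\<^sup>2) * (p - p\<^sup>2) / real M ^ 3 \<le> 1 / real M"
  proof -
    have "p - p\<^sup>2 \<le> 1" using p by (simp add: algebra_simps add_increasing2)
    then have "(p - p\<^sup>2) / real M \<le> 1 / real M" by (intro divide_right_mono) auto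
    moreover have "real (M\<^sup>2) * (p - p\<^sup>2) / real M ^ 3 = (p - p\<^sup>2) / real M"
      using M by (simp add: power2_eq_square power3_eq_cube)
    ultimately show ?thesis by simp
  qed
  finally show ?thesis by (simp add: p_def)
qed

lemma accept_bind_neq:
  "pmf (bind_pmf P (\<lambda>y. if y \<noteq> x then F else G)) z = (1 - pmf P x) * pmf F z + pmf P x * pmf G z"
proof -
  have "bind_pmf P (\<lambda>y. if y \<noteq> x then F else G) =
      bind_pmf (bind_pmf P (\<lambda>y. return_pmf (y \<noteq> x))) (\<lambda>b. if b then F else G)"
    by (simp add: bind_assoc_pmf bind_return_pmf)
  then show ?thesis by (simp add: pmf_bind_bool pmf_map_neq)
qed

definition escape :: "(source \<Rightarrow> nat set \<Rightarrow> nat pmf) \<Rightarrow> source \<Rightarrow> nat \<Rightarrow> nat set \<Rightarrow> real" where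
  "escape orc s x S = 1 - pmf (orc s (insert x S)) x"

text \<open>The probability that a single round of \<open>fine_probe\<close> escapes and
  accepts.\<close>

definition refined :: "(source \<Rightarrow> nat set \<Rightarrow> nat pmf) \<Rightarrow> source \<Rightarrow> nat set \<Rightarrow> nat \<Rightarrow> real \<Rightarrow> nat \<Rightarrow> real" where
  "refined orc s A x r m =
     subset_expectation A r (\<lambda>S. escape orc s x S * accept orc (comparison s (insert x S) x m))"

lemma escape_bounds: "0 \<le> escape orc s x S" "escape orc s x S \<le> 1"
  by (auto simp: escape_def pmf_le_1)

lemma accept_probe:
  "finite A \<Longrightarrow> accept orc (probe s A x r) = subset_expectation A r (escape orc s x)"
  by (simp add: probe_def pmf_bind pmf_map_neq escape_def[abs_def] flip: pmf_bind) 
     (simp add: pmf_bind[of "random_subset A r"] pmf_map_neq)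

text \<open>A new round, with a fresh set, starts exactly if nothing escapes, so acceptance is a
  geometric sum times the acceptance of one round. The geometric factor depends on the oracle
  through the escape probability, hence the separate test of that probability.\<close>

lemma accept_fine_probe:
  assumes A: "finite A"
  shows "accept orc (fine_probe s A x r m n) =
           (\<Sum>i<n. (1 - accept orc (probe s A x r)) ^ i) * refined orc s A x r m"
proof (induction n)
  case (Suc n)
  define p where "p = accept orc (probe s A x r)"
  define F where "F = refined orc s A x r m"
  define a where "a = accept orc (fine_probe s A x r m n)"
  have int: "integrable (measure_pmf (random_subset A r)) g" for g :: "nat set \<Rightarrow> real"
    using A by (rule integrable_random_subset)
  have "accept orc (fine_probe s A x r m (Suc n)) = subset_expectation A r (\<lambda>S.
      escape orc s x S * accept orc (comparison s (insert x S) x m) + (1 - escape orc s x S) * a)"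
  proof -
    have "sem orc (fine_probe s A x r m (Suc n)) = bind_pmf (random_subset A r) (\<lambda>S.
       bind_pmf (orc s (insert x S)) (\<lambda>y. if y \<noteq> x then sem orc (comparison s (insert x S) x m)
         else sem orc (fine_probe s A x r m n)))"
      using A by (auto intro!: bind_pmf_cong)
    then show ?thesis
      by (simp only: pmf_bind[of "random_subset A r"] accept_bind_neq) (simp add: escape_def a_def)
  qed
  also have "\<dots> = F + (1 - p) * a"
    using int accept_probe[OF A, of orc s x r] unfolding F_def refined_def p_def by simp
  also have "\<dots> = (\<Sum>i<Suc n. (1 - p) ^ i) * F"
    using Suc unfolding sum.lessThan_Suc_shift
    by (simp add: a_def p_def F_def algebra_simps sum_distrib_left)
  finally show ?case by (simp add: p_def F_def)
qed simp


text \<open>The queried sets always contain \<open>x\<close>, so their random part is drawn from the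
  other points; the full score is larger by the summand 1 of \<open>x\<close> itself.\<close>

definition rest_score :: "nat set \<Rightarrow> nat pmf \<Rightarrow> nat \<Rightarrow> real" where
  "rest_score A \<nu> x = (\<Sum>y\<in>A. min 1 (pmf \<nu> y / pmf \<nu> x))"

section \<open>Acceptance probabilities under a conditional oracle\<close>

lemma escape_cond_pmf:
  assumes A: "finite A" "x \<notin> A" and pos: "pmf \<nu> x > 0" and S: "S \<subseteq> A"
    and orc: "orc s (insert x S) = cond_pmf \<nu> (insert x S)"
  defines "X \<equiv> \<Sum>y\<in>S. pmf \<nu> y / pmf \<nu> x"
  shows "escape orc s x S = X / (1 + X)"
proof -
  have fin: "finite S" "x \<notin> S" using A S by (auto intro: finite_subset)
  have m: "measure_pmf.prob \<nu> (insert x S) = pmf \<nu> x * (1 + X)"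
    using fin pos by (simp add: measure_measure_pmf_finite X_def sum_divide_distrib[symmetric] distrib_left)
  have "X \<ge> 0" unfolding X_def by (intro sum_nonneg) auto
  have "x \<in> set_pmf \<nu>" using pos by (simp add: set_pmf_iff)
  then have "pmf (orc s (insert x S)) x = pmf \<nu> x / (pmf \<nu> x * (1 + X))"
    unfolding orc by (subst pmf_cond) (auto simp: m)
  then have "pmf (orc s (insert x S)) x = 1 / (1 + X)" using pos by simp
  then show ?thesis using \<open>X \<ge> 0\<close> by (simp add: escape_def field_simps)
qed

lemma tie_weight_fraction:
  assumes "X \<ge> 0"
  shows "X / (1 + X) * tie_weight (X / (1 + X)) = min 1 X / 2"
proof -
  have "1 - X / (1 + X) = 1 / (1 + X)" using assms by (simp add: field_simps)
  moreover have "max (X / (1 + X)) (1 / (1 + X)) = max X 1 / (1 + X)"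
    using assms by (simp add: max_def divide_right_mono divide_le_cancel)
  ultimately have "X / (1 + X) * tie_weight (X / (1 + X)) = X / (2 * max X 1)"
    using assms by (simp add: tie_weight_def)
  then show ?thesis using assms by (simp add: max_def min_def)
qed

lemma fraction_bounds:
  fixes X :: real
  assumes "X \<ge> 0"
  shows "X / (1 + X) \<le> min 1 X" "min 1 X \<le> 2 * (X / (1 + X))"
proof -
  have "X / (1 + X) \<le> X / 1" using assms by (intro divide_left_mono) auto
  moreover have "X / (1 + X) \<le> 1" using assms by simp
  ultimately show "X / (1 + X) \<le> min 1 X" by simp
  show "min 1 X \<le> 2 * (X / (1 + X))"
  proof (cases "X \<le> 1")
    case True
    then have "X * (1 + X) \<le> X * 2" using assms by (intro mult_left_mono) auto
    then show ?thesis using True assms by (simp add: pos_le_divide_eq min_def)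
  next
    case False
    then show ?thesis using assms by (simp add: pos_le_divide_eq min_def)
  qed
qed

lemma exp_minus_le_quadratic:
  fixes z :: real
  assumes "z \<ge> 0"
  shows "exp (- z) \<le> 1 - z + z\<^sup>2 / 2"
proof -
  have q: "1 + z + z\<^sup>2 / 2 \<le> exp z" using assms by (rule exp_lower_Taylor_quadratic)
  have pos: "1 + z + z\<^sup>2 / 2 > 0" using assms by (simp add: add_pos_nonneg)
  have "exp (- z) = 1 / exp z" by (simp add: exp_minus field_simps)
  also have "\<dots> \<le> 1 / (1 + z + z\<^sup>2 / 2)" using q pos by (intro divide_left_mono) auto
  also have "\<dots> \<le> 1 - z + z\<^sup>2 / 2"
  proof -
    have "(1 - z + z\<^sup>2 / 2) * (1 + z + z\<^sup>2 / 2) = 1 + (z\<^sup>2)\<^sup>2 / 4"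
      by (simp add: power2_eq_square field_simps)
    then have "1 \<le> (1 - z + z\<^sup>2 / 2) * (1 + z + z\<^sup>2 / 2)" by simp
    then show ?thesis using pos by (simp add: pos_divide_le_eq)
  qed
  finally show ?thesis .
qed

context
  fixes A :: "nat set" and x :: nat and \<nu> :: "nat pmf" and orc :: "source \<Rightarrow> nat set \<Rightarrow> nat pmf" and s :: source
    and r :: real
  assumes A: "finite A" "x \<notin> A" and pos: "pmf \<nu> x > 0" and r: "0 \<le> r" "r \<le> 1"
    and orc: "\<And>S. S \<subseteq> A \<Longrightarrow> orc s (insert x S) = cond_pmf \<nu> (insert x S)"
begin

private definition "X = (\<lambda>S. \<Sum>y\<in>S. pmf \<nu> y / pmf \<nu> x)"

private lemma X_nonneg: "X S \<ge> 0"
  unfolding X_def by (intro sum_nonneg) auto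

private lemma escape_eq: "S \<subseteq> A \<Longrightarrow> escape orc s x S = X S / (1 + X S)"
  unfolding X_def using A pos orc by (intro escape_cond_pmf) auto

private lemma int: "integrable (measure_pmf (random_subset A r)) (f :: nat set \<Rightarrow> real)"
  using A(1) by (rule integrable_random_subset)

lemma rest_score_nonneg: "rest_score A \<nu> x \<ge> 0"
  unfolding rest_score_def by (intro sum_nonneg) auto

lemma accept_probe_le_score: "accept orc (probe s A x r) \<le> r * rest_score A \<nu> x"
proof -
  have "accept orc (probe s A x r) \<le> subset_expectation A r (\<lambda>S. min 1 (X S))"
    unfolding accept_probe[OF A(1)]
  proof (rule subset_expectation_mono[OF A(1)])
    fix S assume "S \<subseteq> A"
    then show "escape orc s x S \<le> min 1 (X S)"
      using fraction_bounds[OF X_nonneg, of S] by (simp add: escape_eq)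
  qed
  also have "\<dots> \<le> r * rest_score A \<nu> x"
    unfolding X_def rest_score_def using A r by (intro expectation_min_le) auto
  finally show ?thesis .
qed

lemma accept_probe_le_sum:
  "accept orc (probe s A x r) \<le> r * (\<Sum>y\<in>A. pmf \<nu> y / (pmf \<nu> x + pmf \<nu> y))"
proof -
  have "accept orc (probe s A x r) = subset_expectation A r (\<lambda>S. X S / (1 + X S))"
    unfolding accept_probe[OF A(1)] by (intro subset_expectation_cong escape_eq)
  also have "\<dots> \<le> r * (\<Sum>y\<in>A. (pmf \<nu> y / pmf \<nu> x) / (1 + pmf \<nu> y / pmf \<nu> x))"
    unfolding X_def using A r by (intro expectation_fraction_le) auto
  also have "(\<Sum>y\<in>A. (pmf \<nu> y / pmf \<nu> x) / (1 + pmf \<nu> y / pmf \<nu> x)) =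
             (\<Sum>y\<in>A. pmf \<nu> y / (pmf \<nu> x + pmf \<nu> y))"
    using pos by (intro sum.cong) (auto simp: add_frac_eq divide_simps)
  finally show ?thesis .
qed

lemma half_min_le_accept_probe:
  "1 - exp (- (r * rest_score A \<nu> x)) \<le> 2 * accept orc (probe s A x r)"
proof -
  have "1 - exp (- (r * rest_score A \<nu> x)) \<le> subset_expectation A r (\<lambda>S. min 1 (X S))"
    unfolding X_def rest_score_def using A r by (intro expectation_min_ge) auto
  also have "\<dots> \<le> subset_expectation A r (\<lambda>S. 2 * escape orc s x S)"
  proof (rule subset_expectation_mono[OF A(1)])
    fix S assume "S \<subseteq> A"
    then show "min 1 (X S) \<le> 2 * escape orc s x S"
      using fraction_bounds[OF X_nonneg, of S] by (simp add: escape_eq)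
  qed
  finally show ?thesis by (simp add: accept_probe[OF A(1)])
qed

text \<open>A draw from \<open>insert x S\<close> fails to escape with probability
  \<open>1 / (1 + X S)\<close>. The decay in \<open>r * rest_score A \<nu> x\<close> keeps the
  search from settling at far too high a rate.\<close>

lemma reject_probe_le: "1 - accept orc (probe s A x r) \<le> 1 / (1 + r * rest_score A \<nu> x / 2)"
proof -
  have "1 - accept orc (probe s A x r) = subset_expectation A r (\<lambda>S. 1 - escape orc s x S)"
    using int by (simp add: accept_probe[OF A(1)])
  also have "\<dots> = subset_expectation A r (\<lambda>S. 1 / (1 + X S))"
  proof (rule subset_expectation_cong)
    fix S assume "S \<subseteq> A"
    then show "1 - escape orc s x S = 1 / (1 + X S)"
      using X_nonneg[of S] by (simp add: escape_eq field_simps)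
  qed
  also have "\<dots> \<le> 1 / (1 + r * rest_score A \<nu> x / 2)"
    unfolding X_def rest_score_def using A r by (intro expectation_inverse_le) auto
  finally show ?thesis .
qed

text \<open>With the exact weight a round would accept with half the expectation of
  \<open>min 1 (X S)\<close>, and this expectation is \<open>r * rest_score A \<nu> x\<close> up to
  second order. Estimating the weight adds an error of order 1 / M, but only on rounds that escape;
  for M about 1 / \<delta> and escapes of probability O(\<delta>) the total is
  O(\<delta>^2).\<close>

lemma refined_approx:
  assumes M: "M > 0"
  shows "\<bar>2 * refined orc s A x r (M\<^sup>2) - r * rest_score A \<nu> x\<bar> \<le>
           4 / real M * accept orc (probe s A x r) + (r * rest_score A \<nu> x)\<^sup>2 / 2"
proof -
  define E where "E = subset_expectation A r (\<lambda>S. min 1 (X S))"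
  have "\<bar>2 * refined orc s A x r (M\<^sup>2) - E\<bar> =
      \<bar>subset_expectation A r (\<lambda>S. 2 * (escape orc s x S * accept orc (comparison s (insert x S) x (M\<^sup>2))) - min 1 (X S))\<bar>"
    using int by (simp add: refined_def E_def)
  also have "\<dots> \<le> subset_expectation A r (\<lambda>S. \<bar>2 * (escape orc s x S * accept orc (comparison s (insert x S) x (M\<^sup>2))) - min 1 (X S)\<bar>)"
    by (rule integral_abs_bound)
  also have "\<dots> \<le> subset_expectation A r (\<lambda>S. 4 / real M * escape orc s x S)"
  proof (rule subset_expectation_mono[OF A(1)])
    fix S assume S: "S \<subseteq> A"
    define c where "c = accept orc (comparison s (insert x S) x (M\<^sup>2))"
    define e where "e = escape orc s x S"
    have e: "0 \<le> e" by (simp add: e_def escape_bounds)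
    have "min 1 (X S) = 2 * (e * tie_weight e)"
      using tie_weight_fraction[OF X_nonneg, of S] unfolding e_def escape_eq[OF S] by linarith
    then have "\<bar>2 * (e * c) - min 1 (X S)\<bar> = \<bar>2 * e * (c - tie_weight e)\<bar>"
      by (simp add: algebra_simps)
    also have "\<dots> = 2 * e * \<bar>c - tie_weight e\<bar>" using e by (simp add: abs_mult)
    also have "\<dots> \<le> 2 * e * (2 / real M)"
      using accept_comparison[OF M, of orc s "insert x S" x] e
      by (intro mult_left_mono) (auto simp: c_def e_def escape_def)
    finally show "\<bar>2 * (escape orc s x S * accept orc (comparison s (insert x S) x (M\<^sup>2))) - min 1 (X S)\<bar>
        \<le> 4 / real M * escape orc s x S" by (simp add: c_def e_def)
  qed
  also have "\<dots> = 4 / real M * accept orc (probe s A x r)" by (simp add: accept_probe[OF A(1)])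
  finally have 1: "\<bar>2 * refined orc s A x r (M\<^sup>2) - E\<bar> \<le> 4 / real M * accept orc (probe s A x r)" .
  define z where "z = r * rest_score A \<nu> x"
  have z: "z \<ge> 0" using r rest_score_nonneg by (simp add: z_def)
  have "E \<le> z" unfolding E_def X_def z_def rest_score_def using A r by (intro expectation_min_le) auto
  moreover have "1 - exp (- z) \<le> E"
    unfolding E_def X_def z_def rest_score_def using A r by (intro expectation_min_ge) auto
  moreover have "exp (- z) \<le> 1 - z + z\<^sup>2 / 2" using z by (rule exp_minus_le_quadratic)
  ultimately show ?thesis using 1 unfolding z_def[symmetric] by linarith
qed

end

section \<open>Binary search for the rate\<close>

lemma sum_small_powers_down:
  fixes K c :: real
  assumes "K \<ge> 0" "c \<ge> 0"
  shows "(\<Sum>m<n. if K / 2 ^ m < c then K / 2 ^ m else 0) \<le> 2 * c"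
proof -
  \<comment> \<open>The subtracted term reserves room for the geometric tail from
    \<open>K / 2 ^ n\<close> on, capped at 2 c.\<close>
  have "(\<Sum>m<n. if K / 2 ^ m < c then K / 2 ^ m else 0) \<le> 2 * c - 2 * min c (K / 2 ^ n)"
  proof (induction n)
    case (Suc n)
    have "K / 2 ^ Suc n \<le> K / 2 ^ n" "K / 2 ^ Suc n = K / 2 ^ n / 2" using assms by (auto simp: field_simps)
    then show ?case using Suc by (auto simp: min_def)
  qed (use assms in auto)
  moreover have "min c (K / 2 ^ n) \<ge> 0" using assms by simp
  ultimately show ?thesis by linarith
qed

lemma sum_small_powers_up:
  fixes K c :: real
  assumes "K \<ge> 0" "c \<ge> 0"
  shows "(\<Sum>m<n. if 2 ^ m / K < c then 2 ^ m / K else 0) \<le> 2 * c"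
proof -
  \<comment> \<open>The terms double, so their sum stays below the next one. For
    \<open>K = 0\<close> division by zero makes all of them 0.\<close>
  have "(\<Sum>m<n. if 2 ^ m / K < c then 2 ^ m / K else 0) \<le> min (2 * c) (2 ^ n / K)"
  proof (induction n)
    case (Suc n)
    have "2 ^ Suc n / K \<ge> 2 ^ n / K" "2 ^ Suc n / K = 2 * (2 ^ n / K)" using assms by (auto simp: divide_right_mono)
    then show ?case using Suc by auto
  qed (use assms in auto)
  then show ?thesis by simp
qed


text \<open>
  The midpoints of a binary search are distinct, so the error probabilities \<open>e m\<close>, which decay
  geometrically on both sides of the scale \<open>2 ^ m \<approx> K\<close>, may be summed over all \<open>m\<close>.
\<close>

lemma search_accuracy_aux:
  fixes \<nu> :: "nat pmf"
  assumes A: "finite A" "x \<notin> A" and pos: "pmf \<nu> x > 0"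
    and orc: "\<And>S. S \<subseteq> A \<Longrightarrow> orc s (insert x S) = cond_pmf \<nu> (insert x S)"
  defines "K \<equiv> rest_score A \<nu> x"
  defines "e \<equiv> (\<lambda>m::nat. (if K / 2 ^ m < 1 / 60 then K / 2 ^ m else 0) +
                   2 * (if 2 ^ m / K < 1 / 60 then 2 ^ m / K else 0))"
  assumes lo: "lo = 0 \<or> K / 2 ^ lo \<ge> 1 / 60" and hi: "K / 2 ^ (lo + 2 ^ h) \<le> 60"
  shows "accept orc (pbind (search s A x h lo) (\<lambda>j. Ret (K / 2 ^ j \<le> 120 \<and> (j = 0 \<or> K / 2 ^ j \<ge> 1 / 60))))
           \<ge> 1 - (\<Sum>m\<in>{Suc lo..<lo + 2 ^ h}. e m)"
  using lo hi
proof (induction h arbitrary: lo)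
  case 0
  \<comment> \<open>With no bits left the upper condition is the one at \<open>lo + 1\<close>; at
    \<open>lo\<close> the quotient doubles, which turns 60 into 120.\<close>
  then show ?case by simp
next
  case (Suc h)
  define mid where "mid = lo + 2 ^ h"
  define p where "p = accept orc (probe s A x (1 / 2 ^ mid))"
  define acc where "acc = (\<lambda>h lo. accept orc (pbind (search s A x h lo)
      (\<lambda>j. Ret (K / 2 ^ j \<le> 120 \<and> (j = 0 \<or> K / 2 ^ j \<ge> 1 / 60)))))"
  have K: "K \<ge> 0" unfolding K_def rest_score_def by (intro sum_nonneg) auto
  have e: "e m \<ge> 0" for m using K by (auto simp: e_def)
  have E: "(\<Sum>m\<in>I. e m) \<ge> 0" for I by (intro sum_nonneg e)
  have p: "0 \<le> p" "p \<le> 1" by (auto simp: p_def pmf_le_1)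
  have split: "acc (Suc h) lo = p * acc h mid + (1 - p) * acc h lo"
    by (simp add: acc_def p_def mid_def bind_assoc_pmf pmf_bind_bool)
  have hi': "mid + 2 ^ h = lo + 2 ^ Suc h" by (simp add: mid_def)
  have "{Suc lo..<lo + 2 ^ Suc h} = {Suc lo..<mid} \<union> ({mid} \<union> {Suc mid..<mid + 2 ^ h})"
    by (auto simp: mid_def)
  then have sum_split: "(\<Sum>m\<in>{Suc lo..<lo + 2 ^ Suc h}. e m) =
      (\<Sum>m\<in>{Suc lo..<mid}. e m) + e mid + (\<Sum>m\<in>{Suc mid..<mid + 2 ^ h}. e m)"
    by (simp add: sum.union_disjoint ivl_disj_int)
  have up: "acc h mid \<ge> 1 - (\<Sum>m\<in>{Suc mid..<mid + 2 ^ h}. e m)" if "K / 2 ^ mid \<ge> 1 / 60"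
    unfolding acc_def
  proof (rule Suc.IH)
    show "K / 2 ^ (mid + 2 ^ h) \<le> 60" unfolding hi' by (rule Suc.prems(2))
  qed (use that in blast)
  have down: "acc h lo \<ge> 1 - (\<Sum>m\<in>{Suc lo..<mid}. e m)" if "K / 2 ^ mid \<le> 60"
    unfolding acc_def mid_def using that Suc.prems(1) by (intro Suc.IH) (auto simp: mid_def)
  have acc0: "acc h' lo' \<ge> 0" for h' lo' by (simp add: acc_def)
  have p_le: "p \<le> K / 2 ^ mid"
    using accept_probe_le_score[where orc = orc and s = s and r = "1 / 2 ^ mid", OF A pos _ _ orc]
    by (simp add: p_def K_def)
  have q_le: "1 - p \<le> 1 / (1 + K / 2 ^ mid / 2)"
    using reject_probe_le[where orc = orc and s = s and r = "1 / 2 ^ mid", OF A pos _ _ orc]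
    by (simp add: p_def K_def)
  \<comment> \<open>Between 1/60 and 60 both branches keep the invariant. Outside, only one of them
    may break it, and that branch is entered with probability at most \<open>e mid\<close>, the
    \<open>d\<close> of this step.\<close>
  have mix: "p * a + (1 - p) * b \<ge> 1 - (u + d + w)"
    if "a \<ge> 1 - u \<or> p \<le> d" "b \<ge> 1 - w \<or> 1 - p \<le> d" "a \<ge> 1 - u \<or> b \<ge> 1 - w" 
      "a \<ge> 0" "b \<ge> 0" "u \<ge> 0" "w \<ge> 0" "d \<ge> 0" for a b u w d :: real
  proof -
    have pa: "p * a \<ge> p - u - (if a \<ge> 1 - u then 0 else d)"
    proof (cases "a \<ge> 1 - u")
      case True
      then have "p * a \<ge> p * (1 - u)" using p by (intro mult_left_mono) auto
      moreover have "p * u \<le> 1 * u" using p that by (intro mult_right_mono) auto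
      ultimately show ?thesis using True by (simp add: algebra_simps)
    next
      case False
      have "p * a \<ge> 0" using p that by simp
      then show ?thesis using False that by auto
    qed
    have pb: "(1 - p) * b \<ge> (1 - p) - w - (if b \<ge> 1 - w then 0 else d)"
    proof (cases "b \<ge> 1 - w")
      case True
      then have "(1 - p) * b \<ge> (1 - p) * (1 - w)" using p by (intro mult_left_mono) auto
      moreover have "(1 - p) * w \<le> 1 * w" using p that by (intro mult_right_mono) auto
      ultimately show ?thesis using True by (simp add: algebra_simps)
    next
      case False
      have "(1 - p) * b \<ge> 0" using p that by simp
      then show ?thesis using False that by auto
    qed
    show ?thesis using pa pb that by (auto split: if_splits)
  qed
  have "acc (Suc h) lo \<ge> 1 - ((\<Sum>m\<in>{Suc mid..<mid + 2 ^ h}. e m) + e mid + (\<Sum>m\<in>{Suc lo..<mid}. e m))"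
    unfolding split
  proof (rule mix)
    show "acc h mid \<ge> 1 - (\<Sum>m\<in>{Suc mid..<mid + 2 ^ h}. e m) \<or> p \<le> e mid"
    proof (cases "K / 2 ^ mid \<ge> 1 / 60")
      case True
      then show ?thesis using up by simp
    next
      case False
      then have "K / 2 ^ mid \<le> e mid" using K by (simp add: e_def)
      then show ?thesis using p_le by linarith
    qed
    show "acc h lo \<ge> 1 - (\<Sum>m\<in>{Suc lo..<mid}. e m) \<or> 1 - p \<le> e mid"
    proof (cases "K / 2 ^ mid \<le> 60")
      case True
      then show ?thesis using down by simp
    next
      case False
      then have Kp: "K > 0" using K by (cases "K = 0") auto
      have "2 ^ mid / K < 1 / 60" using False Kp by (simp add: field_simps)
      \<comment> \<open>The 1/2 in the bound on failed escapes is the reason for the factor 2 in the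
        second part of \<open>e\<close>.\<close>
      moreover have "1 / (1 + K / 2 ^ mid / 2) \<le> 1 / (K / 2 ^ mid / 2)"
        using Kp by (intro divide_left_mono mult_pos_pos) (auto simp: add_pos_pos)
      moreover have "1 / (K / 2 ^ mid / 2) = 2 * (2 ^ mid / K)" by simp
      moreover have "e mid \<ge> 2 * (2 ^ mid / K)"
        using \<open>2 ^ mid / K < 1 / 60\<close> K by (simp only: e_def if_True) simp
      ultimately have "1 - p \<le> e mid" using q_le by linarith
      then show ?thesis ..
    qed
    show "acc h mid \<ge> 1 - (\<Sum>m\<in>{Suc mid..<mid + 2 ^ h}. e m) \<or> acc h lo \<ge> 1 - (\<Sum>m\<in>{Suc lo..<mid}. e m)"
      using up down by linarith
  qed (use acc0 E e in auto)
  then show ?case using sum_split by (simp add: acc_def)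
qed

lemma search_accuracy:
  fixes \<nu> :: "nat pmf"
  assumes A: "finite A" "x \<notin> A" and pos: "pmf \<nu> x > 0"
    and orc: "\<And>S. S \<subseteq> A \<Longrightarrow> orc s (insert x S) = cond_pmf \<nu> (insert x S)"
    and h: "rest_score A \<nu> x \<le> 60 * 2 ^ (2 ^ h)"
  shows "accept orc (pbind (search s A x h 0)
           (\<lambda>j. Ret (rest_score A \<nu> x / 2 ^ j \<le> 120 \<and> (j = 0 \<or> rest_score A \<nu> x / 2 ^ j \<ge> 1 / 60)))) \<ge> 9 / 10"
proof -
  define K where "K = rest_score A \<nu> x"
  have K: "K \<ge> 0" unfolding K_def rest_score_def by (intro sum_nonneg) auto
  define e1 where "e1 = (\<lambda>m::nat. if K / 2 ^ m < 1 / 60 then K / 2 ^ m else 0)"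
  define e2 where "e2 = (\<lambda>m::nat. if 2 ^ m / K < 1 / 60 then 2 ^ m / K else 0)"
  have nn: "e1 m \<ge> 0" "e2 m \<ge> 0" for m using K by (auto simp: e1_def e2_def)
  have "sum e1 {Suc 0..<0 + 2 ^ h} \<le> sum e1 {..<2 ^ h}" "sum e2 {Suc 0..<0 + 2 ^ h} \<le> sum e2 {..<2 ^ h}"
    using nn by (auto intro!: sum_mono2)
  moreover have "sum e1 {..<2 ^ h} \<le> 2 * (1 / 60)" "sum e2 {..<2 ^ h} \<le> 2 * (1 / 60)"
    unfolding e1_def e2_def using K by (intro sum_small_powers_down sum_small_powers_up; simp)+
  \<comment> \<open>This fixes the threshold 60: the two one-sided errors sum to 2/60 + 2 * 2/60 =
    1/10.\<close>
  ultimately have "(\<Sum>m\<in>{Suc 0..<0 + 2 ^ h}. e1 m + 2 * e2 m) \<le> 1 / 10"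
    by (simp add: sum.distrib sum_distrib_left[symmetric])
  note bound = this[unfolded e1_def e2_def]
  have hi: "K / 2 ^ (0 + 2 ^ h) \<le> 60" using h by (simp add: K_def field_simps)
  have "accept orc (pbind (search s A x h 0) (\<lambda>j. Ret (K / 2 ^ j \<le> 120 \<and> (j = 0 \<or> K / 2 ^ j \<ge> 1 / 60))))
      \<ge> 1 - 1 / 10"
    by (rule order_trans[OF diff_left_mono[OF bound]], unfold K_def,
        rule search_accuracy_aux[where orc = orc and s = s, OF A pos orc])
      (use hi in \<open>simp_all add: K_def\<close>)
  then show ?thesis unfolding K_def by simp
qed

section \<open>Points on which the tests agree\<close>

lemma geometric_weight_ge:
  fixes p :: real
  assumes "0 \<le> p" "p \<le> 1" "real T * p \<le> 1 / 2"
  shows "(\<Sum>i<T. (1 - p) ^ i) \<ge> real T / 2"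
proof -
  have "(\<Sum>i<T. 1 / 2) \<le> (\<Sum>i<T. (1 - p) ^ i)"
  proof (rule sum_mono)
    fix i assume "i \<in> {..<T}"
    then have "real i * p \<le> real T * p" using assms by (intro mult_right_mono) auto
    then have "1 / 2 \<le> 1 + real i * (- p)" using assms by simp
    also have "\<dots> \<le> (1 + (- p)) ^ i" using assms by (intro Bernoulli_inequality) auto
    finally show "1 / 2 \<le> (1 - p) ^ i" by simp
  qed
  then show ?thesis by simp
qed

lemma geometric_weight_diff:
  fixes p q :: real
  assumes "0 \<le> p" "p \<le> 1" "0 \<le> q" "q \<le> 1"
  shows "\<bar>(\<Sum>i<T. (1 - p) ^ i) - (\<Sum>i<T. (1 - q) ^ i)\<bar> \<le> (real T)\<^sup>2 * \<bar>p - q\<bar>"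
proof -
  have "\<bar>(\<Sum>i<T. (1 - p) ^ i) - (\<Sum>i<T. (1 - q) ^ i)\<bar> \<le> (\<Sum>i<T. \<bar>(1 - p) ^ i - (1 - q) ^ i\<bar>)"
    by (simp flip: sum_subtractf)
  also have "\<dots> \<le> (\<Sum>i<T. real T * \<bar>p - q\<bar>)"
  proof (rule sum_mono)
    fix i assume i: "i \<in> {..<T}"
    have "\<bar>(1 - p) ^ i - (1 - q) ^ i\<bar> \<le> real i * \<bar>(1 - p) - (1 - q)\<bar>"
      using norm_power_diff[of "1 - p" "1 - q" i] assms by simp
    also have "\<dots> = real i * \<bar>p - q\<bar>" by (simp add: abs_minus_commute)
    also have "\<dots> \<le> real T * \<bar>p - q\<bar>" using i by (intro mult_right_mono) auto
    finally show "\<bar>(1 - p) ^ i - (1 - q) ^ i\<bar> \<le> real T * \<bar>p - q\<bar>" .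
  qed
  finally show ?thesis by (simp add: power2_eq_square mult.assoc)
qed

lemma le_twice_of_exp_bound:
  fixes z c :: real
  assumes "1 - exp (- z) \<le> c" "0 \<le> c" "c \<le> 1 / 4"
  shows "z \<le> 2 * c"
proof (rule ccontr)
  assume "\<not> z \<le> 2 * c"
  then have "exp (- z) < exp (- (2 * c))" by simp
  also have "\<dots> \<le> 1 - 2 * c + (2 * c)\<^sup>2 / 2" using assms by (intro exp_minus_le_quadratic) auto
  finally have "2 * c - 2 * c * c < c" using assms(1) by (simp add: power2_eq_square)
  moreover have "c * c \<le> c * (1 / 4)" using assms by (intro mult_left_mono) auto
  ultimately show False using assms(2) by simp
qed

text \<open>Only the first score is known to be at the right scale; the coarse test carries the
  scale over to the second, with a worse constant. It also makes the geometric factors agree up to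
  1/16. As the first of them is at least T / 2, the fine test bounds the difference of the refined
  acceptances by O(\<delta> / T) = O(\<delta>^2).\<close>

lemma scaled_scores_close:
  assumes A: "finite A" "x \<notin> A" and pos: "pmf \<nu> x > 0" "pmf \<nu>' x > 0"
    and orc: "\<And>S. S \<subseteq> A \<Longrightarrow> orc s (insert x S) = cond_pmf \<nu> (insert x S)"
             "\<And>S. S \<subseteq> A \<Longrightarrow> orc s' (insert x S) = cond_pmf \<nu>' (insert x S)"
    and T: "\<delta> = 1 / (4 * real T)" "\<delta> \<le> 1 / 16"
    and r: "0 \<le> r" "r \<le> 1" "r * rest_score A \<nu> x \<le> \<delta>"
    and probe: "\<bar>accept orc (probe s A x r) - accept orc (probe s' A x r)\<bar> \<le> \<delta>\<^sup>2"
    and fine: "\<bar>accept orc (fine_probe s A x r ((4 * T)\<^sup>2) T) - accept orc (fine_probe s' A x r ((4 * T)\<^sup>2) T)\<bar> \<le> \<delta>"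
    and T0: "T > 0"
  shows "\<bar>r * rest_score A \<nu> x - r * rest_score A \<nu>' x\<bar> \<le> 63 * \<delta>\<^sup>2"
proof -
  define K K' where "K = r * rest_score A \<nu> x" and "K' = r * rest_score A \<nu>' x"
  define p p' where "p = accept orc (probe s A x r)" and "p' = accept orc (probe s' A x r)"
  define F F' where "F = refined orc s A x r ((4 * T)\<^sup>2)" and "F' = refined orc s' A x r ((4 * T)\<^sup>2)"
  define w where "w = (\<lambda>p::real. \<Sum>i<T. (1 - p) ^ i)"
  have \<delta>: "\<delta> > 0" using T T0 by simp
  have T\<delta>: "real T * \<delta> = 1 / 4" "4 / real (4 * T) = 4 * \<delta>" unfolding T(1) using T0 by auto
  have K: "0 \<le> K" "0 \<le> K'" using r by (auto simp: K_def K'_def rest_score_def intro!: mult_nonneg_nonneg sum_nonneg)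
  have p: "0 \<le> p" "p \<le> 1" "0 \<le> p'" "p' \<le> 1" by (auto simp: p_def p'_def pmf_le_1)
  have "p \<le> K" unfolding p_def K_def
    by (rule accept_probe_le_score[where orc = orc and s = s, OF A pos(1) r(1,2) orc(1)])
  then have p\<delta>: "p \<le> \<delta>" using r(3) by (simp add: K_def)
  have \<delta>2: "\<delta>\<^sup>2 \<le> \<delta> / 16" using T(2) \<delta> by (simp add: power2_eq_square)
  have p'\<delta>: "p' \<le> 2 * \<delta>" using probe p\<delta> \<delta>2 \<delta> unfolding p_def[symmetric] p'_def[symmetric] by linarith
  have "1 - exp (- K') \<le> 2 * p'" unfolding p'_def K'_def
    by (rule half_min_le_accept_probe[where orc = orc and s = s', OF A pos(2) r(1,2) orc(2)])
  then have "1 - exp (- K') \<le> 4 * \<delta>" using p'\<delta> by linarith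
  then have "K' \<le> 2 * (4 * \<delta>)" by (rule le_twice_of_exp_bound) (use T(2) \<delta> in auto)
  then have K'\<delta>: "K' \<le> 8 * \<delta>" by simp
  have F_approx: "\<bar>2 * F - K\<bar> \<le> 4 * \<delta> * p + K\<^sup>2 / 2"
    using refined_approx[where M = "4 * T" and orc = orc and s = s, OF A pos(1) r(1,2) orc(1)] T0
    unfolding F_def p_def K_def T\<delta>(2) by simp
  have F'_approx: "\<bar>2 * F' - K'\<bar> \<le> 4 * \<delta> * p' + K'\<^sup>2 / 2"
    using refined_approx[where M = "4 * T" and orc = orc and s = s', OF A pos(2) r(1,2) orc(2)] T0
    unfolding F'_def p'_def K'_def T\<delta>(2) by simp
  have F': "0 \<le> F'" "F' \<le> p'"
  proof -
    show "0 \<le> F'" unfolding F'_def refined_def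
      by (intro integral_nonneg_AE) (auto simp: escape_bounds)
    have "escape orc s' x S * accept orc (comparison s' (insert x S) x ((4 * T)\<^sup>2)) \<le> escape orc s' x S" for S
      using escape_bounds[of orc s' x S] by (intro mult_left_le) (auto simp: pmf_le_1)
    then show "F' \<le> p'" unfolding F'_def refined_def p'_def accept_probe[OF A(1)]
      by (rule subset_expectation_mono[OF A(1)])
  qed
  have wT: "w p \<ge> real T / 2"
  proof -
    have "real T * p \<le> real T * \<delta>" using p\<delta> by (intro mult_left_mono) auto
    then have "real T * p \<le> 1 / 2" using T\<delta>(1) by linarith
    then show ?thesis unfolding w_def by (rule geometric_weight_ge[OF p(1,2)])
  qed
  have "\<bar>w p - w p'\<bar> \<le> (real T)\<^sup>2 * \<bar>p - p'\<bar>"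
    unfolding w_def by (rule geometric_weight_diff[OF p])
  also have "\<dots> \<le> (real T)\<^sup>2 * \<delta>\<^sup>2" using probe by (intro mult_left_mono) (auto simp: p_def p'_def)
  also have "\<dots> = (real T * \<delta>)\<^sup>2" by (simp add: power_mult_distrib)
  also have "\<dots> = 1 / 16" unfolding T\<delta>(1) by (simp add: power2_eq_square)
  finally have w_diff: "\<bar>w p - w p'\<bar> \<le> 1 / 16" .
  have "\<bar>w p * F - w p' * F'\<bar> \<le> \<delta>"
    using fine unfolding accept_fine_probe[OF A(1)] w_def p_def p'_def F_def F'_def .
  moreover have "w p * (F - F') = (w p * F - w p' * F') - (w p - w p') * F'" by (simp add: algebra_simps)
  moreover have "\<bar>(w p - w p') * F'\<bar> \<le> 1 / 16 * (2 * \<delta>)"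
    unfolding abs_mult using w_diff F' p'\<delta> by (intro mult_mono) auto
  ultimately have "\<bar>w p * (F - F')\<bar> \<le> \<delta> + 1 / 16 * (2 * \<delta>)" by linarith
  then have "w p * \<bar>F - F'\<bar> \<le> 9 / 8 * \<delta>" using wT by (simp add: abs_mult)
  moreover have "real T / 2 * \<bar>F - F'\<bar> \<le> w p * \<bar>F - F'\<bar>" using wT by (intro mult_right_mono) auto
  ultimately have "real T * \<bar>F - F'\<bar> \<le> 9 / 4 * \<delta>" by simp
  then have "\<delta> * (real T * \<bar>F - F'\<bar>) \<le> \<delta> * (9 / 4 * \<delta>)" using \<delta> by (intro mult_left_mono) auto
  moreover have "\<delta> * (real T * \<bar>F - F'\<bar>) = (real T * \<delta>) * \<bar>F - F'\<bar>" by simp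
  ultimately have FF: "\<bar>F - F'\<bar> \<le> 9 * \<delta>\<^sup>2" unfolding T\<delta>(1) by (simp add: power2_eq_square)
  have "4 * \<delta> * p \<le> 4 * \<delta> * \<delta>" "4 * \<delta> * p' \<le> 4 * \<delta> * (2 * \<delta>)"
    using p\<delta> p'\<delta> \<delta> by (intro mult_left_mono; simp)+
  moreover have "K\<^sup>2 \<le> \<delta>\<^sup>2" using K r(3) by (intro power_mono) (auto simp: K_def)
  moreover have "K'\<^sup>2 \<le> (8 * \<delta>)\<^sup>2" using K K'\<delta> by (intro power_mono) auto
  ultimately have "\<bar>2 * F - K\<bar> \<le> 4 * \<delta>\<^sup>2 + \<delta>\<^sup>2 / 2" "\<bar>2 * F' - K'\<bar> \<le> 8 * \<delta>\<^sup>2 + 32 * \<delta>\<^sup>2"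
    using F_approx F'_approx by (simp_all add: power2_eq_square)
  \<comment> \<open>The coefficients are 2 * 9 + 9/2 + 40 \<le> 63.\<close>
  then have "\<bar>K - K'\<bar> \<le> 63 * \<delta>\<^sup>2" using FF zero_le_power2[of \<delta>] by linarith
  then show ?thesis by (simp add: K_def K'_def)
qed

text \<open>
  If \<open>insert x S\<close> has mass zero, the oracle may answer \<open>x\<close> or anything else; this bound only uses the
  sets \<open>S\<close> of positive mass, from which a point \<open>x\<close> of mass zero is always escaped.
\<close>

lemma accept_probe_ge_hits:
  assumes A: "finite A" "x \<notin> A" and null: "pmf \<nu> x = 0" and r: "0 \<le> r" "r \<le> 1"
    and orc: "\<And>S. S \<subseteq> A \<Longrightarrow> measure_pmf.prob \<nu> (insert x S) > 0 \<Longrightarrow> orc s (insert x S) = cond_pmf \<nu> (insert x S)"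
  shows "accept orc (probe s A x r) \<ge> 1 - exp (- (r * real (card {y \<in> A. pmf \<nu> y > 0})))"
proof -
  define B where "B = {y \<in> A. pmf \<nu> y > 0}"
  have "1 - exp (- (r * real (card B))) \<le> 1 - (1 - r) ^ card B"
  proof -
    have "(1 - r) ^ card B \<le> exp (- r) ^ card B"
      using r exp_ge_add_one_self[of "- r"] by (intro power_mono) auto
    also have "\<dots> = exp (- (r * real (card B)))" by (simp add: exp_of_nat_mult[symmetric] mult.commute)
    finally show ?thesis by simp
  qed
  also have "\<dots> = subset_expectation A r (\<lambda>S. if S \<inter> B = {} then 0 else 1)"
    using A r by (subst expectation_hits) (auto simp: B_def)
  also have "\<dots> \<le> subset_expectation A r (escape orc s x)"
  proof (rule subset_expectation_mono[OF A(1)])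
    fix S assume S: "S \<subseteq> A"
    show "(if S \<inter> B = {} then 0 else 1) \<le> escape orc s x S"
    proof (cases "S \<inter> B = {}")
      case False
      then obtain y where "y \<in> S" "pmf \<nu> y > 0" by (auto simp: B_def)
      then have y: "y \<in> S" "y \<in> set_pmf \<nu>" by (auto simp: set_pmf_iff)
      then have "measure_pmf.prob \<nu> (insert x S) > 0"
        by (intro measure_pmf_posI[of y]) auto
      then have "orc s (insert x S) = cond_pmf \<nu> (insert x S)" using orc S by simp
      moreover have "pmf (cond_pmf \<nu> (insert x S)) x = 0"
        using y null by (subst pmf_cond) auto
      ultimately show ?thesis using False by (simp add: escape_def)
    qed (simp add: escape_bounds)
  qed
  finally show ?thesis by (simp add: accept_probe[OF A(1)] B_def)
qed

text \<open>\<open>z\<close> will be \<open>r\<close> times a number of support points of the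
  distribution that vanishes at \<open>x\<close>. Under that distribution a probe escapes as soon as
  the random set meets the support, so \<open>p'\<close>, and with it \<open>p\<close>, is nearly as
  large as \<open>z\<close>.\<close>

lemma null_counts:
  fixes z p p' :: real
  assumes p': "1 - exp (- z) \<le> p'" and z: "z \<ge> 0" and close: "\<bar>p - p'\<bar> \<le> \<delta>\<^sup>2"
    and p: "p \<le> \<delta>" and \<delta>: "0 < \<delta>" "\<delta> \<le> 1 / 16"
  shows "z \<le> 4 * \<delta>" "z * (1 - 2 * \<delta>) \<le> p + \<delta>\<^sup>2"
proof -
  have \<delta>2: "\<delta>\<^sup>2 \<le> \<delta> / 16" using \<delta> by (simp add: power2_eq_square)
  have "1 - exp (- z) \<le> 2 * \<delta>" using assms \<delta>2 by linarith
  then have "z \<le> 2 * (2 * \<delta>)" by (rule le_twice_of_exp_bound) (use \<delta> in auto)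
  then show z4: "z \<le> 4 * \<delta>" by simp
  have "z * (z / 2) \<le> z * (2 * \<delta>)" using z4 z by (intro mult_left_mono) auto
  moreover have "exp (- z) \<le> 1 - z + z\<^sup>2 / 2" using z by (rule exp_minus_le_quadratic)
  ultimately show "z * (1 - 2 * \<delta>) \<le> p + \<delta>\<^sup>2"
    using p' close by (simp add: algebra_simps power2_eq_square)
qed

section \<open>The tester\<close>

definition por :: "bool prog \<Rightarrow> bool prog \<Rightarrow> bool prog" where
  "por p q = pbind p (\<lambda>b. if b then Ret True else q)"

lemma accept_por: "accept orc (por p q) = 1 - (1 - accept orc p) * (1 - accept orc q)"
  by (simp add: por_def pmf_bind_bool algebra_simps)

lemma accept_por_ge: "accept orc p \<le> accept orc (por p q)" "accept orc q \<le> accept orc (por p q)"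
proof -
  define a b where "a = accept orc p" and "b = accept orc q"
  have "0 \<le> a" "a \<le> 1" "0 \<le> b" "b \<le> 1" by (auto simp: a_def b_def pmf_le_1)
  then have "(1 - a) * (1 - b) \<le> (1 - a) * 1" "(1 - a) * (1 - b) \<le> 1 * (1 - b)"
    by (intro mult_left_mono mult_right_mono; simp)+
  then show "accept orc p \<le> accept orc (por p q)" "accept orc q \<le> accept orc (por p q)"
    by (simp_all add: accept_por a_def b_def)
qed

lemma accept_por_le: "accept orc (por p q) \<le> accept orc p + accept orc q"
  by (simp add: accept_por algebra_simps)

lemma samples_le_por: "samples_le p m \<Longrightarrow> samples_le q n \<Longrightarrow> samples_le (por p q) (m + n)"
  unfolding por_def by (intro samples_le_pbind) auto

text \<open>Both probes are compared in both directions, since \<open>exceeds\<close> is one-sided.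
  With \<delta> = 1 / (4 T) the run lengths are 5 L / \<theta>^2 for the gaps \<theta> = \<delta>^2
  (coarse) and \<theta> = \<delta> (fine), and \<open>(4 * T)\<^sup>2\<close> samples determine a
  tie weight up to O(\<delta>).\<close>

definition detect :: "nat \<Rightarrow> nat \<Rightarrow> nat set \<Rightarrow> nat \<Rightarrow> real \<Rightarrow> bool prog" where
  "detect T L A x r =
     (let E = exceeds L (5 * L * (4 * T) ^ 4); F = exceeds L (5 * L * (4 * T)\<^sup>2);
          p = (\<lambda>s. probe s A x r); q = (\<lambda>s. fine_probe s A x r ((4 * T)\<^sup>2) T)
      in por (por (E (p Mu) (p Tau)) (E (p Tau) (p Mu))) (por (F (q Mu) (q Tau)) (F (q Tau) (q Mu))))"

lemma samples_le_detect:
  assumes "T > 0"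
  shows "samples_le (detect T L A x r) (11000 * L\<^sup>2 * T ^ 4)"
proof -
  define m where "m = L * (5 * L * (4 * T) ^ 4 * (2 * 1))"
  define n where "n = L * (5 * L * (4 * T)\<^sup>2 * (2 * (T + (4 * T)\<^sup>2)))"
  have "samples_le (detect T L A x r) ((m + m) + (n + n))"
    unfolding detect_def Let_def m_def n_def
    by (intro samples_le_por samples_le_exceeds samples_le_probe samples_le_fine_probe)
  moreover have "(m + m) + (n + n) \<le> 11000 * L\<^sup>2 * T ^ 4"
  proof -
    have "T + (4 * T)\<^sup>2 \<le> 17 * T\<^sup>2" using assms by (simp add: power2_eq_square)
    then have "n \<le> L * (5 * L * (4 * T)\<^sup>2 * (2 * (17 * T\<^sup>2)))"
      unfolding n_def by (intro mult_le_mono le_refl)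
    also have "\<dots> = 2720 * L\<^sup>2 * T ^ 4" by (simp add: power2_eq_square power4_eq_xxxx)
    finally have "n \<le> 2720 * L\<^sup>2 * T ^ 4" .
    moreover have "m = 2560 * L\<^sup>2 * T ^ 4" by (simp add: m_def power2_eq_square power4_eq_xxxx)
    ultimately have "(m + m) + (n + n) \<le> 2 * (2560 * (L\<^sup>2 * T ^ 4)) + 2 * (2720 * (L\<^sup>2 * T ^ 4))"
      by (simp add: mult.assoc)
    then show ?thesis by (simp add: mult.assoc)
  qed
  ultimately show ?thesis by (rule samples_le_mono)
qed

lemma accept_detect_equal_le:
  assumes "finite A" "\<And>S. S \<subseteq> A \<Longrightarrow> orc Mu (insert x S) = orc Tau (insert x S)"
  shows "accept orc (detect T L A x r) \<le> 4 * (1 / 2) ^ L"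
proof -
  note eq = sem_probe_cong[where orc = orc and s = Mu and s' = Tau, OF assms(1) assms(2)]
    sem_fine_probe_cong[where orc = orc and s = Mu and s' = Tau, OF assms(1) assms(2)]
  have "accept orc (exceeds L R (probe Mu A x r) (probe Tau A x r)) \<le> (1 / 2) ^ L"
    "accept orc (exceeds L R (probe Tau A x r) (probe Mu A x r)) \<le> (1 / 2) ^ L"
    "accept orc (exceeds L R (fine_probe Mu A x r m T) (fine_probe Tau A x r m T)) \<le> (1 / 2) ^ L"
    "accept orc (exceeds L R (fine_probe Tau A x r m T) (fine_probe Mu A x r m T)) \<le> (1 / 2) ^ L" for R m
    using eq by (auto intro!: accept_exceeds_equal_le)
  note bounds = this
  have four: "4 * (1 / 2) ^ L = ((1 / 2) ^ L + (1 / 2) ^ L) + ((1 / 2) ^ L + (1 / 2 :: real) ^ L)" by simp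
  have "accept orc (por (por a b) (por c d)) \<le> (accept orc a + accept orc b) + (accept orc c + accept orc d)" for a b c d
    using accept_por_le[of orc "por a b" "por c d"] accept_por_le[of orc a b] accept_por_le[of orc c d] by linarith
  then show ?thesis
    unfolding detect_def Let_def four by (rule order_trans) (intro add_mono bounds)
qed

lemma accept_detect_ge:
  assumes "s \<noteq> s'" "L > 0" "T > 0" and \<delta>: "\<delta> = 1 / (4 * real T)"
    and sep: "\<bar>accept orc (probe s A x r) - accept orc (probe s' A x r)\<bar> > \<delta>\<^sup>2 \<or>
     \<bar>accept orc (fine_probe s A x r ((4 * T)\<^sup>2) T) - accept orc (fine_probe s' A x r ((4 * T)\<^sup>2) T)\<bar> > \<delta>"
  shows "accept orc (detect T L A x r) \<ge> 9 / 10"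
proof -
  have \<delta>0: "\<delta> > 0" using assms by simp
  have R1: "real (5 * L * (4 * T) ^ 4) * (\<delta>\<^sup>2)\<^sup>2 \<ge> 5 * real L"
    using assms by (simp add: \<delta> power_divide field_simps)
  have R2: "real (5 * L * (4 * T)\<^sup>2) * \<delta>\<^sup>2 \<ge> 5 * real L"
    using assms by (simp add: \<delta> power_divide field_simps)
  define E where "E = exceeds L (5 * L * (4 * T) ^ 4)"
  define F where "F = exceeds L (5 * L * (4 * T)\<^sup>2)"
  define p where "p = (\<lambda>s. probe s A x r)"
  define q where "q = (\<lambda>s. fine_probe s A x r ((4 * T)\<^sup>2) T)"
  have E: "accept orc (E (p s) (p s')) \<ge> 9 / 10" if "accept orc (p s) - accept orc (p s') \<ge> \<delta>\<^sup>2" for s s'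
    unfolding E_def using that R1 \<delta>0 assms by (intro accept_exceeds_separated_ge[of "\<delta>\<^sup>2"]) auto
  have F: "accept orc (F (q s) (q s')) \<ge> 9 / 10" if "accept orc (q s) - accept orc (q s') \<ge> \<delta>" for s s'
    unfolding F_def using that R2 \<delta>0 assms by (intro accept_exceeds_separated_ge[of "\<delta>"]) auto
  have d: "detect T L A x r = por (por (E (p Mu) (p Tau)) (E (p Tau) (p Mu))) (por (F (q Mu) (q Tau)) (F (q Tau) (q Mu)))"
    by (simp add: detect_def E_def F_def p_def q_def Let_def)
  have le: "accept orc (E (p Mu) (p Tau)) \<le> accept orc (detect T L A x r)"
    "accept orc (E (p Tau) (p Mu)) \<le> accept orc (detect T L A x r)"
    "accept orc (F (q Mu) (q Tau)) \<le> accept orc (detect T L A x r)"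
    "accept orc (F (q Tau) (q Mu)) \<le> accept orc (detect T L A x r)"
    unfolding d by (meson accept_por_ge order_trans)+
  have Ele: "accept orc (E (p s) (p s')) \<le> accept orc (detect T L A x r)"
    "accept orc (E (p s') (p s)) \<le> accept orc (detect T L A x r)"
    "accept orc (F (q s) (q s')) \<le> accept orc (detect T L A x r)"
    "accept orc (F (q s') (q s)) \<le> accept orc (detect T L A x r)"
    using le assms(1) by (cases s; cases s'; simp)+
  from sep consider "accept orc (p s) - accept orc (p s') \<ge> \<delta>\<^sup>2" | "accept orc (p s') - accept orc (p s) \<ge> \<delta>\<^sup>2"
    | "accept orc (q s) - accept orc (q s') \<ge> \<delta>" | "accept orc (q s') - accept orc (q s) \<ge> \<delta>"
    unfolding p_def q_def by linarith
  then show ?thesis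
    by cases (use E F Ele in \<open>blast intro: order_trans\<close>)+
qed

text \<open>With \<open>\<delta> = 1 / (4 T)\<close>, the rate below satisfies \<open>r K \<le> \<delta>\<close> whenever the search ends with \<open>K / 2 ^ j \<le> 120\<close>.\<close>

definition inspect :: "nat \<Rightarrow> nat \<Rightarrow> nat \<Rightarrow> nat set \<Rightarrow> source \<Rightarrow> nat \<Rightarrow> bool prog" where
  "inspect T L h \<Omega> s x =
     pbind (search s (\<Omega> - {x}) x h 0) (\<lambda>j. detect T L (\<Omega> - {x}) x (1 / (4 * real T) / (120 * 2 ^ j)))"

lemma accept_pbind_ge:
  assumes "\<And>r. Z r \<Longrightarrow> accept orc (f r) \<ge> a" "a \<ge> 0"
  shows "accept orc (pbind p f) \<ge> a * accept orc (pbind p (\<lambda>r. Ret (Z r)))"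
proof -
  have "a * accept orc (pbind p (\<lambda>r. Ret (Z r))) =
      measure_pmf.expectation (sem orc p) (\<lambda>r. a * pmf (return_pmf (Z r)) True)"
    by (simp add: pmf_bind)
  also have "\<dots> \<le> measure_pmf.expectation (sem orc p) (\<lambda>r. accept orc (f r))"
  proof (rule integral_mono)
    show "integrable (measure_pmf (sem orc p)) (\<lambda>r. a * pmf (return_pmf (Z r)) True)"
      by (intro measure_pmf.integrable_const_bound[where B = "\<bar>a\<bar>"]) (auto simp: abs_mult mult_left_le pmf_le_1)
    show "integrable (measure_pmf (sem orc p)) (\<lambda>r. accept orc (f r))"
      by (intro measure_pmf.integrable_const_bound[where B = 1]) (auto simp: pmf_le_1)
    show "a * pmf (return_pmf (Z r)) True \<le> accept orc (f r)" for r
      using assms by (cases "Z r") auto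
  qed
  also have "\<dots> = accept orc (pbind p f)" by (simp add: pmf_bind)
  finally show ?thesis .
qed

lemma accept_pbind_le:
  assumes "\<And>r. r \<in> set_pmf (sem orc p) \<Longrightarrow> accept orc (f r) \<le> c"
  shows "accept orc (pbind p f) \<le> c"
proof -
  have "accept orc (pbind p f) = measure_pmf.expectation (sem orc p) (\<lambda>r. accept orc (f r))"
    by (simp add: pmf_bind)
  also have "\<dots> \<le> measure_pmf.expectation (sem orc p) (\<lambda>r. c)"
  proof (rule integral_mono_AE)
    show "integrable (measure_pmf (sem orc p)) (\<lambda>r. accept orc (f r))"
      by (intro measure_pmf.integrable_const_bound[where B = 1]) (auto simp: pmf_le_1)
  qed (use assms in \<open>auto simp: AE_measure_pmf_iff\<close>)
  finally show ?thesis by simp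
qed

lemma cond_oracle_eq:
  assumes "cond_oracle \<Omega> \<nu> (orc s)" "x \<in> \<Omega>" "S \<subseteq> \<Omega> - {x}" "measure_pmf.prob \<nu> (insert x S) > 0"
  shows "orc s (insert x S) = cond_pmf \<nu> (insert x S)"
proof -
  have "insert x S \<subseteq> \<Omega> \<and> insert x S \<noteq> {}" using assms by auto
  then show ?thesis using assms(1,4) unfolding cond_oracle_def by blast
qed

lemma cond_oracle_eq_pos:
  assumes "cond_oracle \<Omega> \<nu> (orc s)" "x \<in> \<Omega>" "pmf \<nu> x > 0" "S \<subseteq> \<Omega> - {x}"
  shows "orc s (insert x S) = cond_pmf \<nu> (insert x S)"
proof (rule cond_oracle_eq[where orc = orc, OF assms(1,2,4)])
  show "measure_pmf.prob \<nu> (insert x S) > 0"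
    using assms(3) by (intro measure_pmf_posI[of x]) (auto simp: set_pmf_iff)
qed

section \<open>Consequences of a point going undetected\<close>

context
  fixes \<Omega> :: "nat set" and T L h :: nat and \<delta> :: real and orc :: "source \<Rightarrow> nat set \<Rightarrow> nat pmf"
  assumes fin: "finite \<Omega>" and L: "L > 0" and T: "T > 0"
    and \<delta>_def: "\<delta> = 1 / (4 * real T)" and \<delta>: "\<delta> \<le> 1 / 16" and h: "real (card \<Omega>) \<le> 2 ^ (2 ^ h)"
begin

text \<open>Averaging: the search ends at a good exponent with probability 9/10, and if every good
  exponent led to detection with probability 9/10, \<open>inspect\<close> would accept with
  probability 81/100. So some fixed rate of the right order passes both tests.\<close>

lemma undetected_level:
  assumes or: "cond_oracle \<Omega> \<nu> (orc s)" and ss: "s \<noteq> s'" and x: "x \<in> \<Omega>" "pmf \<nu> x > 0"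
    and low: "accept orc (inspect T L h \<Omega> s x) < 1 / 2"
  obtains r where "0 < r" "r \<le> 1" "r * rest_score (\<Omega> - {x}) \<nu> x \<le> \<delta>"
    "\<delta> \<le> r * (7200 * (1 + rest_score (\<Omega> - {x}) \<nu> x))"
    "\<bar>accept orc (probe s (\<Omega> - {x}) x r) - accept orc (probe s' (\<Omega> - {x}) x r)\<bar> \<le> \<delta>\<^sup>2"
    "\<bar>accept orc (fine_probe s (\<Omega> - {x}) x r ((4 * T)\<^sup>2) T) -
      accept orc (fine_probe s' (\<Omega> - {x}) x r ((4 * T)\<^sup>2) T)\<bar> \<le> \<delta>"
proof -
  define A where "A = \<Omega> - {x}"
  have A: "finite A" "x \<notin> A" using fin by (auto simp: A_def)
  define K where "K = rest_score A \<nu> x"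
  have \<delta>0: "\<delta> > 0" using T by (simp add: \<delta>_def)
  have K: "0 \<le> K" unfolding K_def rest_score_def by (intro sum_nonneg) auto
  have "K \<le> (\<Sum>y\<in>A. 1)" unfolding K_def rest_score_def by (intro sum_mono) auto
  also have "\<dots> \<le> real (card \<Omega>)" using fin by (auto simp: A_def intro!: card_mono)
  finally have Kh: "K \<le> 60 * 2 ^ (2 ^ h)" using h by linarith
  define Z where "Z = (\<lambda>j::nat. K / 2 ^ j \<le> 120 \<and> (j = 0 \<or> K / 2 ^ j \<ge> 1 / 60))"
  have or': "orc s (insert x S) = cond_pmf \<nu> (insert x S)" if "S \<subseteq> A" for S
    using cond_oracle_eq_pos[where orc = orc, OF or x] that by (simp add: A_def)
  have sr: "accept orc (pbind (search s A x h 0) (\<lambda>j. Ret (Z j))) \<ge> 9 / 10"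
    unfolding Z_def K_def
    by (rule search_accuracy[where orc = orc and s = s, OF A x(2) or']) (use Kh in \<open>auto simp: K_def\<close>)
  have "\<exists>j. Z j \<and> accept orc (detect T L A x (\<delta> / (120 * 2 ^ j))) < 9 / 10"
  proof (rule ccontr)
    assume *: "\<not> ?thesis"
    have "accept orc (inspect T L h \<Omega> s x) \<ge> 9 / 10 * accept orc (pbind (search s A x h 0) (\<lambda>j. Ret (Z j)))"
      unfolding inspect_def A_def[symmetric] \<delta>_def[symmetric]
      using * by (intro accept_pbind_ge) (auto simp: not_less)
    then show False using sr low by linarith
  qed
  then obtain j where j: "Z j" "accept orc (detect T L A x (\<delta> / (120 * 2 ^ j))) < 9 / 10" by blast
  define r where "r = \<delta> / (120 * 2 ^ j)"
  have pow: "(1::real) \<le> 2 ^ j" by simp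
  have "r \<le> \<delta> / 120" unfolding r_def using \<delta>0 pow by (intro divide_left_mono) auto
  then have "r \<le> 1" using \<delta> by linarith
  moreover have "0 < r" using \<delta>0 by (simp add: r_def)
  moreover have "r * K \<le> \<delta>"
  proof -
    have "r * K = \<delta> / 120 * (K / 2 ^ j)" by (simp add: r_def)
    also have "\<dots> \<le> \<delta> / 120 * 120" using j(1) \<delta>0 by (intro mult_left_mono) (auto simp: Z_def)
    finally show ?thesis by simp
  qed
  moreover have "\<delta> \<le> r * (7200 * (1 + K))"
  proof -
    \<comment> \<open>For \<open>j = 0\<close> the summand 1 gives the bound, otherwise
      \<open>2 ^ j \<le> 60 * K\<close>. With the 120 in the rate this makes 7200.\<close>
    have "2 ^ j \<le> 60 * (1 + K)" using j(1) K by (auto simp: Z_def field_simps)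
    then have "\<delta> * 2 ^ j \<le> \<delta> * (60 * (1 + K))" using \<delta>0 by (intro mult_left_mono) auto
    then show ?thesis by (simp add: r_def field_simps)
  qed
  moreover have "\<not> (\<bar>accept orc (probe s A x r) - accept orc (probe s' A x r)\<bar> > \<delta>\<^sup>2 \<or>
     \<bar>accept orc (fine_probe s A x r ((4 * T)\<^sup>2) T) - accept orc (fine_probe s' A x r ((4 * T)\<^sup>2) T)\<bar> > \<delta>)"
    using accept_detect_ge[where orc = orc and A = A and x = x and r = r, OF ss L T \<delta>_def] j(2)
    unfolding r_def[symmetric] by linarith
  ultimately show ?thesis using that unfolding A_def K_def not_less de_Morgan_disj by blast
qed

text \<open>Dividing the error \<open>63 * \<delta>\<^sup>2\<close> by \<open>r\<close> makes it
  relative, since the rate is at least \<delta> / (7200 (1 + K)); 453600 = 63 * 7200.\<close>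

lemma undetected_scores_close:
  assumes or: "cond_oracle \<Omega> \<nu> (orc s)" "cond_oracle \<Omega> \<nu>' (orc s')" and ss: "s \<noteq> s'"
    and x: "x \<in> \<Omega>" "pmf \<nu> x > 0" "pmf \<nu>' x > 0"
    and low: "accept orc (inspect T L h \<Omega> s x) < 1 / 2"
  defines "K \<equiv> rest_score (\<Omega> - {x}) \<nu> x" and "K' \<equiv> rest_score (\<Omega> - {x}) \<nu>' x"
  shows "\<bar>K - K'\<bar> \<le> 453600 * \<delta> * (1 + K)"
proof -
  obtain r where r: "0 < r" "r \<le> 1" "r * K \<le> \<delta>" "\<delta> \<le> r * (7200 * (1 + K))"
    "\<bar>accept orc (probe s (\<Omega> - {x}) x r) - accept orc (probe s' (\<Omega> - {x}) x r)\<bar> \<le> \<delta>\<^sup>2"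
    "\<bar>accept orc (fine_probe s (\<Omega> - {x}) x r ((4 * T)\<^sup>2) T) -
      accept orc (fine_probe s' (\<Omega> - {x}) x r ((4 * T)\<^sup>2) T)\<bar> \<le> \<delta>"
    using undetected_level[OF or(1) ss x(1,2) low] unfolding K_def by blast
  have \<delta>0: "\<delta> > 0" using T by (simp add: \<delta>_def)
  have "\<bar>r * K - r * K'\<bar> \<le> 63 * \<delta>\<^sup>2"
    unfolding K_def K'_def
  proof (rule scaled_scores_close[where orc = orc and s = s and s' = s' and T = T])
    show "orc s (insert x S) = cond_pmf \<nu> (insert x S)" if "S \<subseteq> \<Omega> - {x}" for S
      using cond_oracle_eq_pos[where orc = orc, OF or(1) x(1,2) that] .
    show "orc s' (insert x S) = cond_pmf \<nu>' (insert x S)" if "S \<subseteq> \<Omega> - {x}" for S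
      using cond_oracle_eq_pos[where orc = orc, OF or(2) x(1,3) that] .
  qed (use fin x r \<delta> \<delta>_def T in \<open>auto simp: K_def\<close>)
  moreover have "63 * \<delta>\<^sup>2 \<le> 63 * \<delta> * (r * (7200 * (1 + K)))"
    using r(4) \<delta>0 by (simp add: power2_eq_square mult_left_mono)
  moreover have "\<bar>r * K - r * K'\<bar> = r * \<bar>K - K'\<bar>"
    using r(1) by (simp add: abs_mult flip: right_diff_distrib)
  moreover have "63 * \<delta> * (r * (7200 * (1 + K))) = r * (453600 * \<delta> * (1 + K))" by simp
  ultimately have "r * \<bar>K - K'\<bar> \<le> r * (453600 * \<delta> * (1 + K))" by linarith
  then show ?thesis using r(1) by simp
qed

text \<open>Under \<nu>' every random set that meets \<open>B'\<close> lets the draw escape from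
  \<open>x\<close>, so agreement of the probes forces \<open>K\<close> to be nearly as large as
  \<open>card B'\<close>, or larger. If moreover \<open>B\<close> is not larger than
  \<open>B'\<close>, the probe of \<nu> must escape almost as often as if each point of
  \<open>B\<close> counted fully. The left-hand side of the second claim is the deficit from that,
  so it is an O(\<delta>) fraction of \<open>card B\<close>.\<close>

lemma undetected_null:
  assumes or: "cond_oracle \<Omega> \<nu> (orc s)" "cond_oracle \<Omega> \<nu>' (orc s')" and ss: "s \<noteq> s'"
    and x: "x \<in> \<Omega>" "pmf \<nu> x > 0" "pmf \<nu>' x = 0"
    and low: "accept orc (inspect T L h \<Omega> s x) < 1 / 2"
  defines "K \<equiv> rest_score (\<Omega> - {x}) \<nu> x" and "B \<equiv> {y \<in> \<Omega>. pmf \<nu> y > 0}" and "B' \<equiv> {y \<in> \<Omega>. pmf \<nu>' y > 0}"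
  shows "real (card B') \<le> (1 + 907200 * \<delta>) * (1 + K)"
    and "card B \<le> card B' \<Longrightarrow>
      1 + (\<Sum>y\<in>B - {x}. pmf \<nu> x / (pmf \<nu> x + pmf \<nu> y)) \<le> 7202 * \<delta> * real (card B)"
proof -
  obtain r where r: "0 < r" "r \<le> 1" "r * K \<le> \<delta>" "\<delta> \<le> r * (7200 * (1 + K))"
    "\<bar>accept orc (probe s (\<Omega> - {x}) x r) - accept orc (probe s' (\<Omega> - {x}) x r)\<bar> \<le> \<delta>\<^sup>2"
    using undetected_level[OF or(1) ss x(1,2) low] unfolding K_def by blast
  have \<delta>0: "\<delta> > 0" using T by (simp add: \<delta>_def)
  define A where "A = \<Omega> - {x}"
  have A: "finite A" "x \<notin> A" using fin by (auto simp: A_def)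
  have K: "0 \<le> K" unfolding K_def rest_score_def by (intro sum_nonneg) auto
  define p where "p = accept orc (probe s A x r)"
  define p' where "p' = accept orc (probe s' A x r)"
  have or1: "orc s (insert x S) = cond_pmf \<nu> (insert x S)" if "S \<subseteq> A" for S
    using cond_oracle_eq_pos[where orc = orc, OF or(1) x(1,2)] that by (simp add: A_def)
  have or2: "orc s' (insert x S) = cond_pmf \<nu>' (insert x S)"
    if "S \<subseteq> A" "measure_pmf.prob \<nu>' (insert x S) > 0" for S
    using cond_oracle_eq[where orc = orc, OF or(2) x(1)] that by (simp add: A_def)
  have B': "{y \<in> A. pmf \<nu>' y > 0} = B'" using x by (auto simp: A_def B'_def)
  have p': "1 - exp (- (r * real (card B'))) \<le> p'"
    unfolding p'_def B'[symmetric] using r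
    by (intro accept_probe_ge_hits A x(3) or2) auto
  have pK: "p \<le> r * K"
    unfolding p_def K_def A_def[symmetric]
    by (rule accept_probe_le_score[where orc = orc and s = s, OF A x(2) _ _ or1]) (use r in auto)
  have p\<delta>: "p \<le> \<delta>" using pK r(3) by linarith
  have close: "\<bar>p - p'\<bar> \<le> \<delta>\<^sup>2" using r(5) by (simp add: p_def p'_def A_def)
  have \<delta>2: "\<delta>\<^sup>2 \<le> r * (7200 * \<delta> * (1 + K))"
    using mult_left_mono[OF r(4), of \<delta>] \<delta>0 by (simp add: power2_eq_square algebra_simps)
  show "real (card B') \<le> (1 + 907200 * \<delta>) * (1 + K)"
  proof -
    have "r * real (card B') * (1 - 2 * \<delta>) \<le> p + \<delta>\<^sup>2"
      by (rule null_counts(2)[OF p' _ close p\<delta> \<delta>0 \<delta>]) (use r in auto)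
    then have "r * (real (card B') * (1 - 2 * \<delta>)) \<le> r * (K + 7200 * \<delta> * (1 + K))"
      using pK \<delta>2 by (simp add: algebra_simps)
    then have "real (card B') * (1 - 2 * \<delta>) \<le> K + 7200 * \<delta> * (1 + K)" using r(1) by simp
    also have "\<dots> \<le> (1 + 7200 * \<delta>) * (1 + K)" by (simp add: algebra_simps)
    \<comment> \<open>907200 = 2 * 453600 is the tolerance used for points that both distributions
      take; it leaves ample room for dividing by 1 - 2 \<delta>.\<close>
    also have "\<dots> \<le> ((1 + 907200 * \<delta>) * (1 - 2 * \<delta>)) * (1 + K)"
    proof (intro mult_right_mono)
      have "\<delta> * \<delta> \<le> \<delta> * (1 / 16)" using \<delta> \<delta>0 by (intro mult_left_mono) auto
      then show "1 + 7200 * \<delta> \<le> (1 + 907200 * \<delta>) * (1 - 2 * \<delta>)" using \<delta>0 by (simp add: algebra_simps)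
    qed (use K in auto)
    finally have "real (card B') * (1 - 2 * \<delta>) \<le> ((1 + 907200 * \<delta>) * (1 + K)) * (1 - 2 * \<delta>)"
      by (simp add: algebra_simps)
    then show ?thesis using \<delta> by (simp add: mult_le_cancel_right)
  qed
  show "1 + (\<Sum>y\<in>B - {x}. pmf \<nu> x / (pmf \<nu> x + pmf \<nu> y)) \<le> 7202 * \<delta> * real (card B)" if BB: "card B \<le> card B'"
  proof -
    define n where "n = real (card B)"
    define Q where "Q = (\<Sum>y\<in>B - {x}. pmf \<nu> x / (pmf \<nu> x + pmf \<nu> y))"
    have finB: "finite B" "x \<in> B" using fin x by (auto simp: B_def)
    have n0: "n \<ge> 0" by (simp add: n_def)
    have zero: "pmf \<nu> y = 0" if "y \<in> \<Omega>" "y \<notin> B" for y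
      using that pmf_nonneg[of \<nu> y] by (simp add: B_def)
    have Bsub: "B \<subseteq> \<Omega>" by (auto simp: B_def)
    have "1 - exp (- (r * n)) \<le> p'"
    proof -
      have "r * n \<le> r * real (card B')" using BB r by (simp add: n_def mult_left_mono)
      then have "exp (- (r * real (card B'))) \<le> exp (- (r * n))" by simp
      then show ?thesis using p' by linarith
    qed
    note nc = null_counts[OF this _ close p\<delta> \<delta>0 \<delta>]
    have z: "r * n \<ge> 0" using r n0 by simp
    have "p \<le> r * (\<Sum>y\<in>A. pmf \<nu> y / (pmf \<nu> x + pmf \<nu> y))"
      unfolding p_def
      by (rule accept_probe_le_sum[where orc = orc and s = s, OF A x(2) _ _ or1]) (use r in auto)
    also have "(\<Sum>y\<in>A. pmf \<nu> y / (pmf \<nu> x + pmf \<nu> y)) = (\<Sum>y\<in>B - {x}. pmf \<nu> y / (pmf \<nu> x + pmf \<nu> y))"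
      using A(1) Bsub zero by (intro sum.mono_neutral_right) (auto simp: A_def)
    also have "\<dots> = (\<Sum>y\<in>B - {x}. 1 - pmf \<nu> x / (pmf \<nu> x + pmf \<nu> y))"
    proof (rule sum.cong)
      fix y
      have "pmf \<nu> x + pmf \<nu> y > 0" using x(2) by (simp add: add_pos_nonneg)
      then show "pmf \<nu> y / (pmf \<nu> x + pmf \<nu> y) = 1 - pmf \<nu> x / (pmf \<nu> x + pmf \<nu> y)"
        by (simp add: field_simps)
    qed simp
    also have "\<dots> = n - 1 - Q"
    proof -
      have "card B \<ge> 1" using finB by (simp add: Suc_le_eq card_gt_0_iff) auto
      then show ?thesis using finB by (simp add: sum_subtractf Q_def n_def of_nat_diff)
    qed
    finally have "p \<le> r * (n - 1 - Q)" .
    moreover have "r * n * (1 - 2 * \<delta>) \<le> p + \<delta>\<^sup>2" using nc(2) z by simp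
    ultimately have "r * (1 + Q) \<le> r * (7200 * \<delta> * (1 + K) + 2 * \<delta> * n)" using \<delta>2 by (simp add: algebra_simps)
    then have "1 + Q \<le> 7200 * \<delta> * (1 + K) + 2 * \<delta> * n" using r(1) by simp
    also have "1 + K \<le> n"
    proof -
      have "K = (\<Sum>y\<in>B - {x}. min 1 (pmf \<nu> y / pmf \<nu> x))"
        unfolding K_def rest_score_def
      proof (intro sum.mono_neutral_right ballI)
        fix y assume "y \<in> \<Omega> - {x} - (B - {x})"
        then have "pmf \<nu> y = 0" using zero by blast
        then show "min 1 (pmf \<nu> y / pmf \<nu> x) = 0" by simp
      qed (use fin Bsub in auto)
      also have "\<dots> \<le> (\<Sum>y\<in>B - {x}. 1)" by (intro sum_mono) auto
      also have "\<dots> = n - 1"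
      proof -
        have "card B \<ge> 1" using finB by (simp add: Suc_le_eq card_gt_0_iff) auto
        then show ?thesis using finB by (simp add: n_def of_nat_diff)
      qed
      finally show ?thesis by simp
    qed
    then have "7200 * \<delta> * (1 + K) \<le> 7200 * \<delta> * n" using \<delta>0 by (intro mult_left_mono) auto
    finally show ?thesis by (simp add: Q_def n_def algebra_simps)
  qed
qed


lemma score_eq_rest_score:
  assumes "x \<in> \<Omega>" "pmf \<nu> x > 0"
  shows "score \<Omega> (pmf \<nu>) x = 1 + rest_score (\<Omega> - {x}) \<nu> x"
  unfolding score_def rest_score_def using assms fin by (subst sum.remove[of _ x]) auto

lemma tv_dist_eq_overlap:
  assumes "sum (pmf \<nu>) \<Omega> = 1" "sum (pmf \<nu>') \<Omega> = 1"
  shows "tv_dist \<Omega> \<nu> \<nu>' = 1 - (\<Sum>x\<in>\<Omega>. min (pmf \<nu> x) (pmf \<nu>' x))"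
proof -
  have "(\<Sum>x\<in>\<Omega>. \<bar>pmf \<nu> x - pmf \<nu>' x\<bar>) = (\<Sum>x\<in>\<Omega>. pmf \<nu> x + pmf \<nu>' x - 2 * min (pmf \<nu> x) (pmf \<nu>' x))"
    by (intro sum.cong) auto
  also have "\<dots> = 2 - 2 * (\<Sum>x\<in>\<Omega>. min (pmf \<nu> x) (pmf \<nu>' x))"
    by (simp add: sum_subtractf sum.distrib assms sum_distrib_left)
  finally show ?thesis by (simp add: tv_dist_def)
qed

text \<open>
  The assumption on the supports is harmless by symmetry. It makes the points outside the support of
  \<open>\<nu>'\<close> light: an oracle can only hide such a point if its score is about the size of the support of \<open>\<nu>'\<close>.
\<close>

lemma undetected_tv_dist:
  fixes \<nu> \<nu>' s s'
  defines "V \<equiv> {x \<in> \<Omega>. accept orc (inspect T L h \<Omega> s x) \<ge> 1 / 2}"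
    and "V' \<equiv> {x \<in> \<Omega>. accept orc (inspect T L h \<Omega> s' x) \<ge> 1 / 2}"
  assumes or: "cond_oracle \<Omega> \<nu> (orc s)" "cond_oracle \<Omega> \<nu>' (orc s')" and ss: "s \<noteq> s'"
    and supp: "set_pmf \<nu> \<subseteq> \<Omega>" "set_pmf \<nu>' \<subseteq> \<Omega>"
    and cards: "card {y \<in> \<Omega>. pmf \<nu> y > 0} \<le> card {y \<in> \<Omega>. pmf \<nu>' y > 0}"
    and V: "sum (pmf \<nu>) V \<le> \<delta>" "sum (pmf \<nu>') V' \<le> \<delta>" and small: "10 ^ 6 * \<delta> \<le> 1 / 2"
  shows "tv_dist \<Omega> \<nu> \<nu>' \<le> 10 ^ 6 * \<delta> * (31 + 16 * ln (1 / (10 ^ 6 * \<delta>)))"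
proof -
  \<comment> \<open>A point is good if some distribution that can draw it detects it with
    probability below 1/2. One side is enough, because closeness of scores is symmetric up to
    constants.\<close>
  define G where "G = {x. (pmf \<nu> x > 0 \<and> accept orc (inspect T L h \<Omega> s x) < 1 / 2) \<or>
                          (pmf \<nu>' x > 0 \<and> accept orc (inspect T L h \<Omega> s' x) < 1 / 2)}"
  define c where "c = 453600 * \<delta>"
  have \<delta>0: "\<delta> > 0" using T by (simp add: \<delta>_def)
  have c: "0 \<le> c" "c \<le> 1 / 2" using \<delta>0 small by (auto simp: c_def)
  have sums: "sum (pmf \<nu>) \<Omega> = 1" "sum (pmf \<nu>') \<Omega> = 1" using supp fin by (auto intro: sum_pmf_eq_1)
  \<comment> \<open>The factor 2 pays for inverting: 1 / (1 - c) \<le> 1 + 2 c for 0 \<le> c \<le>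
    1/2.\<close>
  have ratio: "a' \<le> (1 + 2 * c) * a" "a \<le> (1 + 2 * c) * a'" if "\<bar>a - a'\<bar> \<le> c * a" "a \<ge> 0" for a a' :: real
  proof -
    have ca: "c * a \<ge> 0" using c that by simp
    show "a' \<le> (1 + 2 * c) * a" using that(1) ca by (simp add: algebra_simps)
    have "a * 1 \<le> a * ((1 - c) * (1 + 2 * c))"
    proof (intro mult_left_mono)
      have "c * c \<le> c * (1 / 2)" using c by (intro mult_left_mono) auto
      then show "1 \<le> (1 - c) * (1 + 2 * c)" by (simp add: algebra_simps)
    qed (use that in auto)
    also have "\<dots> = (a - c * a) * (1 + 2 * c)" by (simp add: algebra_simps)
    also have "\<dots> \<le> a' * (1 + 2 * c)" using that(1) c by (intro mult_right_mono) auto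
    finally show "a \<le> (1 + 2 * c) * a'" by (simp add: algebra_simps)
  qed
  have close: "score \<Omega> (pmf \<nu>') x \<le> (1 + 2 * c) * score \<Omega> (pmf \<nu>) x \<and>
               score \<Omega> (pmf \<nu>) x \<le> (1 + 2 * c) * score \<Omega> (pmf \<nu>') x"
    if x: "x \<in> G" "x \<in> \<Omega>" "pmf \<nu> x > 0" "pmf \<nu>' x > 0" for x
  proof -
    define a where "a = score \<Omega> (pmf \<nu>) x"
    define a' where "a' = score \<Omega> (pmf \<nu>') x"
    have eq: "a = 1 + rest_score (\<Omega> - {x}) \<nu> x" "a' = 1 + rest_score (\<Omega> - {x}) \<nu>' x"
      using x by (auto simp: a_def a'_def intro: score_eq_rest_score)
    have nn: "a \<ge> 0" "a' \<ge> 0" by (auto simp: a_def a'_def score_def intro!: sum_nonneg)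
    consider "accept orc (inspect T L h \<Omega> s x) < 1 / 2" | "accept orc (inspect T L h \<Omega> s' x) < 1 / 2"
      using x(1) by (auto simp: G_def)
    then show ?thesis
    proof cases
      case 1
      then have "\<bar>a - a'\<bar> \<le> c * a"
        using undetected_scores_close[OF or ss x(2,3,4) 1] unfolding eq c_def by simp
      then show ?thesis using ratio[of a a'] nn by (simp add: a_def a'_def)
    next
      case 2
      then have "\<bar>a' - a\<bar> \<le> c * a'"
        using undetected_scores_close[OF or(2,1) ss[symmetric] x(2,4,3) 2] unfolding eq c_def by simp
      then show ?thesis using ratio[of a' a] nn by (simp add: a_def a'_def)
    qed
  qed
  define B where "B = {y \<in> \<Omega>. pmf \<nu> y > 0}"
  define P where "P = {x \<in> \<Omega>. x \<in> G \<and> pmf \<nu> x > 0 \<and> pmf \<nu>' x = 0}"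
  have null: "real (card B) \<le> (1 + 2 * c) * score \<Omega> (pmf \<nu>') x"
    if x: "x \<in> G" "x \<in> \<Omega>" "pmf \<nu> x = 0" "pmf \<nu>' x > 0" for x
  proof -
    have "accept orc (inspect T L h \<Omega> s' x) < 1 / 2" using x by (auto simp: G_def)
    then show ?thesis
      using undetected_null(1)[OF or(2,1) ss[symmetric] x(2,4,3)] score_eq_rest_score[OF x(2,4)]
      by (simp add: B_def c_def)
  qed
  have P_mass: "sum (pmf \<nu>) P \<le> 4 * (7202 * \<delta>)"
  proof (rule mass_of_light_points[of B])
    show "sum (pmf \<nu>) B \<le> 1" using sum_mono2[OF fin, of B "pmf \<nu>"] sums by (auto simp: B_def)
    fix x assume "x \<in> P"
    then have x: "x \<in> \<Omega>" "pmf \<nu> x > 0" "pmf \<nu>' x = 0" "accept orc (inspect T L h \<Omega> s x) < 1 / 2"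
      by (auto simp: P_def G_def)
    show "1 + (\<Sum>y\<in>B - {x}. pmf \<nu> x / (pmf \<nu> x + pmf \<nu> y)) \<le> 7202 * \<delta> * real (card B)"
      using undetected_null(2)[OF or ss x] cards by (simp add: B_def)
  qed (use fin \<delta>0 small in \<open>auto simp: B_def P_def\<close>)
  have "(\<Sum>x\<in>\<Omega>. min (pmf \<nu> x) (pmf \<nu>' x)) \<ge> 1 - 10 ^ 6 * \<delta> * (31 + 16 * ln (1 / (10 ^ 6 * \<delta>)))"
  \<comment> \<open>28809 is 1 for the detected points plus 4 * 7202 for the light points
    \<open>P\<close>, and 907200 + 28809 \<le> 10^6.\<close>
  proof (rule overlap_of_close_scores_set[where G = G and \<eta> = "2 * c" and e = "28809 * \<delta>", OF fin])
    show "real (card {y \<in> \<Omega>. 0 < pmf \<nu> y}) \<le> (1 + 2 * c) * score \<Omega> (pmf \<nu>') x"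
      if "x \<in> G" "x \<in> \<Omega>" "pmf \<nu> x = 0" "0 < pmf \<nu>' x" for x using null[OF that] by (simp add: B_def)
    show "sum (pmf \<nu>) {x \<in> \<Omega>. x \<notin> G \<or> pmf \<nu>' x = 0} \<le> 28809 * \<delta>"
    proof -
      define R where "R = {x \<in> \<Omega>. x \<notin> G \<or> pmf \<nu>' x = 0}"
      have finR: "finite R" "finite V" "finite P" using fin by (auto simp: R_def V_def P_def)
      have "sum (pmf \<nu>) R = sum (pmf \<nu>) {x \<in> R. pmf \<nu> x > 0}"
        using finR by (intro sum.mono_neutral_right) (auto simp: not_less antisym)
      also have "\<dots> \<le> sum (pmf \<nu>) (V \<union> P)"
        using finR by (intro sum_mono2) (auto simp: R_def V_def P_def G_def not_less)
      also have "\<dots> \<le> sum (pmf \<nu>) V + sum (pmf \<nu>) P"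
        using finR sum.union_inter[of V P "pmf \<nu>"] sum_nonneg[of "V \<inter> P" "pmf \<nu>"] by simp
      finally show ?thesis using V(1) P_mass by (simp add: R_def)
    qed
    show "sum (pmf \<nu>') {x \<in> \<Omega>. x \<notin> G} \<le> 28809 * \<delta>"
    proof -
      define R where "R = {x \<in> \<Omega>. x \<notin> G}"
      have finR: "finite R" "finite V'" using fin by (auto simp: R_def V'_def)
      have "sum (pmf \<nu>') R = sum (pmf \<nu>') {x \<in> R. pmf \<nu>' x > 0}"
        using finR by (intro sum.mono_neutral_right) (auto simp: not_less antisym)
      also have "\<dots> \<le> sum (pmf \<nu>') V'"
        using finR by (intro sum_mono2) (auto simp: R_def V'_def G_def not_less)
      finally show ?thesis using V(2) \<delta>0 by (simp add: R_def)
    qed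
  qed (use sums close c \<delta>0 small in \<open>auto simp: c_def\<close>)
  then show ?thesis using tv_dist_eq_overlap[OF sums] by simp
qed

end

section \<open>Repeated inspection of sampled points\<close>

definition attempt :: "nat \<Rightarrow> nat \<Rightarrow> nat \<Rightarrow> nat set \<Rightarrow> source \<Rightarrow> bool prog" where
  "attempt T L h \<Omega> s = pbind (query s \<Omega>) (inspect T L h \<Omega> s)"

primrec attempts :: "nat \<Rightarrow> nat \<Rightarrow> nat \<Rightarrow> nat set \<Rightarrow> nat \<Rightarrow> bool prog" where
  "attempts T L h \<Omega> 0 = Ret False"
| "attempts T L h \<Omega> (Suc n) = por (attempt T L h \<Omega> Mu) (por (attempt T L h \<Omega> Tau) (attempts T L h \<Omega> n))"

definition tester :: "nat \<Rightarrow> nat \<Rightarrow> nat \<Rightarrow> nat set \<Rightarrow> nat algorithm" where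
  "tester T L h \<Omega> = compile (pbind (attempts T L h \<Omega> (16 * T)) (\<lambda>b. Ret (\<not> b)))"

lemma samples_le_attempt:
  assumes "T > 0"
  shows "samples_le (attempt T L h \<Omega> s) (1 + (h + 11000 * L\<^sup>2 * T ^ 4))"
  unfolding attempt_def inspect_def
  by (intro samples_le_pbind samples_le_query samples_le_search samples_le_detect assms)

lemma samples_le_attempts:
  assumes "T > 0"
  shows "samples_le (attempts T L h \<Omega> n) (n * (2 * (1 + (h + 11000 * L\<^sup>2 * T ^ 4))))"
proof (induction n)
  case (Suc n)
  define m where "m = 1 + (h + 11000 * L\<^sup>2 * T ^ 4)"
  have "samples_le (attempts T L h \<Omega> (Suc n)) (m + (m + n * (2 * m)))"
    unfolding attempts.simps m_def by (intro samples_le_por samples_le_attempt Suc assms)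
  then show ?case unfolding m_def[symmetric] by (simp add: algebra_simps)
qed simp

lemma samples_at_most_tester:
  assumes "T > 0"
  shows "samples_at_most (tester T L h \<Omega>) (32 * T * (1 + h + 11000 * L\<^sup>2 * T ^ 4))"
proof -
  have "samples_le (pbind (attempts T L h \<Omega> (16 * T)) (\<lambda>b. Ret (\<not> b))) (16 * T * (2 * (1 + (h + 11000 * L\<^sup>2 * T ^ 4))) + 0)"
    by (intro samples_le_pbind samples_le_attempts assms) auto
  then have "samples_le (pbind (attempts T L h \<Omega> (16 * T)) (\<lambda>b. Ret (\<not> b))) (32 * T * (1 + h + 11000 * L\<^sup>2 * T ^ 4))"
    by (simp add: algebra_simps)
  then show ?thesis unfolding tester_def by (rule samples_at_most_compile)
qed

lemma run_tester:
  "pmf (run om ot (tester T L h \<Omega>)) b =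
     (if b then 1 - accept (case_source om ot) (attempts T L h \<Omega> (16 * T))
      else accept (case_source om ot) (attempts T L h \<Omega> (16 * T)))"
  by (simp add: tester_def run_compile pmf_bind_bool)

lemma oracle_on_ground_set:
  assumes "finite \<Omega>" "set_pmf \<nu> \<subseteq> \<Omega>" "cond_oracle \<Omega> \<nu> orc"
  shows "orc \<Omega> = \<nu>"
proof -
  have ne: "set_pmf \<nu> \<noteq> {}" by (rule set_pmf_not_empty)
  have 1: "measure_pmf.prob \<nu> \<Omega> = 1" using assms(2) by (simp add: measure_pmf.prob_eq_1 AE_measure_pmf_iff subset_eq)
  then have "orc \<Omega> = cond_pmf \<nu> \<Omega>" using assms(3) ne assms(2) unfolding cond_oracle_def by auto
  also have "\<dots> = \<nu>"
  proof (rule pmf_eqI)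
    fix i
    have "set_pmf \<nu> \<inter> \<Omega> \<noteq> {}" using ne assms(2) by auto
    then show "pmf (cond_pmf \<nu> \<Omega>) i = pmf \<nu> i"
      using assms(2) 1 by (auto simp: pmf_cond set_pmf_iff)
  qed
  finally show ?thesis .
qed

lemma accept_attempts_ge:
  assumes "accept orc (attempt T L h \<Omega> s) \<ge> a" "0 \<le> a"
  shows "accept orc (attempts T L h \<Omega> n) \<ge> 1 - (1 - a) ^ n"
proof (induction n)
  case (Suc n)
  have a1: "a \<le> 1" using assms(1) pmf_le_1 by (rule order_trans)
  define x where "x = accept orc (attempt T L h \<Omega> Mu)"
  define y where "y = accept orc (attempt T L h \<Omega> Tau)"
  define z where "z = accept orc (attempts T L h \<Omega> n)"
  have bounds: "0 \<le> x" "x \<le> 1" "0 \<le> y" "y \<le> 1" "0 \<le> z" "z \<le> 1" by (auto simp: x_def y_def z_def pmf_le_1)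
  have "(1 - x) * (1 - y) \<le> 1 - a"
  proof (cases s)
    case Mu
    have "(1 - x) * (1 - y) \<le> (1 - x) * 1" using bounds by (intro mult_left_mono) auto
    then show ?thesis using Mu assms by (simp add: x_def)
  next
    case Tau
    have "(1 - x) * (1 - y) \<le> 1 * (1 - y)" using bounds by (intro mult_right_mono) auto
    then show ?thesis using Tau assms by (simp add: y_def)
  qed
  moreover have "1 - z \<le> (1 - a) ^ n" using Suc by (simp add: z_def)
  moreover have "0 \<le> (1 - x) * (1 - y)" using bounds by simp
  ultimately have "((1 - x) * (1 - y)) * (1 - z) \<le> (1 - a) * (1 - a) ^ n"
    using bounds a1 by (intro mult_mono) auto
  then show ?case by (simp add: accept_por x_def y_def z_def algebra_simps)
qed simp

lemma accept_attempts_le: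
  assumes "\<And>s. accept orc (attempt T L h \<Omega> s) \<le> a"
  shows "accept orc (attempts T L h \<Omega> n) \<le> real n * (2 * a)"
proof (induction n)
  case (Suc n)
  have "accept orc (attempts T L h \<Omega> (Suc n)) \<le> a + (a + real n * (2 * a))"
    unfolding attempts.simps by (intro order_trans[OF accept_por_le] add_mono assms Suc)
  then show ?case by (simp add: algebra_simps)
qed simp

text \<open>Were the detectable points of both sources of mass at most \<delta>, the distributions
  would be \<epsilon>-close. So in the far case one source draws a detectable point with probability
  above \<delta>, and an attempt succeeds with probability at least \<delta> / 2; 16 T = 4 /
  \<delta> rounds bring the failure down to exp (- 2) \<le> 1/3.\<close>

theorem tester_distinguishes:
  assumes fin: "finite \<Omega>" and T: "T > 0" and L: "384 * T \<le> 2 ^ L" and h: "card \<Omega> \<le> 2 ^ (2 ^ h)"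
    and z: "z = 250000 / real T" "z \<le> 1 / 2" and \<epsilon>: "z * (31 + 16 * ln (1 / z)) \<le> \<epsilon>"
  shows "distinguishes \<Omega> \<epsilon> (tester T L h \<Omega>)"
  unfolding distinguishes_def
proof (intro allI impI conjI)
  fix \<mu> \<tau> om ot
  assume supp: "set_pmf \<mu> \<subseteq> \<Omega>" "set_pmf \<tau> \<subseteq> \<Omega>"
    and om: "cond_oracle \<Omega> \<mu> om" and ot: "cond_oracle \<Omega> \<tau> ot"
  define orc where "orc = case_source om ot"
  define \<delta> where "\<delta> = 1 / (4 * real T)"
  have or: "cond_oracle \<Omega> \<mu> (orc Mu)" "cond_oracle \<Omega> \<tau> (orc Tau)" using om ot by (auto simp: orc_def)
  have ground: "orc Mu \<Omega> = \<mu>" "orc Tau \<Omega> = \<tau>"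
    using oracle_on_ground_set[OF fin] supp or by auto
  have L0: "L > 0" using L T by (cases L) auto
  have Lr: "real (384 * T) \<le> 2 ^ L" using L by (metis of_nat_le_iff of_nat_numeral of_nat_power)
  have hr: "real (card \<Omega>) \<le> 2 ^ (2 ^ h)" using h by (metis of_nat_le_iff of_nat_numeral of_nat_power)
  {
    assume eq: "\<mu> = \<tau>"
    have same: "orc Mu (insert x S) = orc Tau (insert x S)" if "x \<in> set_pmf \<mu>" "S \<subseteq> \<Omega> - {x}" for x S
      using cond_oracle_eq_pos[where orc = orc, OF or(1), of x S]
        cond_oracle_eq_pos[where orc = orc, OF or(2), of x S] that supp eq
      by (auto simp: pmf_positive)
    have "accept orc (attempt T L h \<Omega> s) \<le> 4 * (1 / 2) ^ L" for s
      unfolding attempt_def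
    proof (rule accept_pbind_le)
      fix x assume "x \<in> set_pmf (sem orc (query s \<Omega>))"
      then have x: "x \<in> set_pmf \<mu>" using ground eq by (cases s) auto
      show "accept orc (inspect T L h \<Omega> s x) \<le> 4 * (1 / 2) ^ L"
        unfolding inspect_def using fin same[OF x] by (intro accept_pbind_le accept_detect_equal_le) auto
    qed
    then have "accept orc (attempts T L h \<Omega> (16 * T)) \<le> real (16 * T) * (2 * (4 * (1 / 2) ^ L))"
      by (rule accept_attempts_le)
    \<comment> \<open>16 T rounds, two sources and four sign tests give 128 T possible false alarms
      of probability at most 2^(-L) each, whence \<open>384 * T \<le> 2 ^ L\<close>.\<close>
    also have "\<dots> = 128 * real T / 2 ^ L" by (simp add: power_divide)
    also have "\<dots> \<le> 1 / 3" using Lr by (simp add: field_simps)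
    finally show "2 / 3 \<le> pmf (run om ot (tester T L h \<Omega>)) True"
      by (simp add: run_tester orc_def)
  }
  {
    assume far: "tv_dist \<Omega> \<mu> \<tau> > \<epsilon>"
    define V where "V = (\<lambda>s. {x \<in> \<Omega>. accept orc (inspect T L h \<Omega> s x) \<ge> 1 / 2})"
    have \<delta>0: "\<delta> > 0" using T by (simp add: \<delta>_def)
    have z\<delta>: "10 ^ 6 * \<delta> = z" using T by (simp add: \<delta>_def z)
    have \<delta>16: "\<delta> \<le> 1 / 16" using z\<delta> z(2) by simp
    note und = undetected_tv_dist[where orc = orc and h = h, OF fin L0 T \<delta>_def \<delta>16 hr]
    have "\<not> (sum (pmf \<mu>) (V Mu) \<le> \<delta> \<and> sum (pmf \<tau>) (V Tau) \<le> \<delta>)"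
    proof
      assume *: "sum (pmf \<mu>) (V Mu) \<le> \<delta> \<and> sum (pmf \<tau>) (V Tau) \<le> \<delta>"
      have "tv_dist \<Omega> \<mu> \<tau> \<le> z * (31 + 16 * ln (1 / z))"
      proof (cases "card {y \<in> \<Omega>. pmf \<mu> y > 0} \<le> card {y \<in> \<Omega>. pmf \<tau> y > 0}")
        case True
        then show ?thesis
          using und[where s = Mu and s' = Tau and \<nu> = \<mu> and \<nu>' = \<tau>] or supp * z unfolding z\<delta> V_def by simp
      next
        case False
        then have "tv_dist \<Omega> \<tau> \<mu> \<le> z * (31 + 16 * ln (1 / z))"
          using und[where s = Tau and s' = Mu and \<nu> = \<tau> and \<nu>' = \<mu>] or supp * z unfolding z\<delta> V_def by simp
        then show ?thesis by (simp add: tv_dist_def abs_minus_commute)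
      qed
      then show False using far \<epsilon> by linarith
    qed
    then obtain s \<nu> where s: "sum (pmf \<nu>) (V s) > \<delta>" "orc s \<Omega> = \<nu>" "set_pmf \<nu> \<subseteq> \<Omega>"
      using ground supp by (metis not_le)
    have "accept orc (attempt T L h \<Omega> s) = measure_pmf.expectation \<nu> (\<lambda>x. accept orc (inspect T L h \<Omega> s x))"
      using s(2) by (simp add: attempt_def pmf_bind)
    also have "\<dots> = (\<Sum>x\<in>\<Omega>. pmf \<nu> x * accept orc (inspect T L h \<Omega> s x))"
      using s(3) fin by (subst integral_measure_pmf[of \<Omega>]) auto
    also have "\<dots> \<ge> (\<Sum>x\<in>V s. pmf \<nu> x * accept orc (inspect T L h \<Omega> s x))"
      using fin by (intro sum_mono2) (auto simp: V_def)
    moreover have "(\<Sum>x\<in>V s. pmf \<nu> x * accept orc (inspect T L h \<Omega> s x)) \<ge> (\<Sum>x\<in>V s. pmf \<nu> x * (1 / 2))"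
      by (intro sum_mono mult_left_mono) (auto simp: V_def)
    moreover have "(\<Sum>x\<in>V s. pmf \<nu> x * (1 / 2)) \<ge> \<delta> / 2"
      using s(1) by (simp add: sum_divide_distrib[symmetric])
    ultimately have "accept orc (attempt T L h \<Omega> s) \<ge> \<delta> / 2" by linarith
    then have "accept orc (attempts T L h \<Omega> (16 * T)) \<ge> 1 - (1 - \<delta> / 2) ^ (16 * T)"
      using \<delta>0 by (intro accept_attempts_ge) auto
    moreover have "(1 - \<delta> / 2) ^ (16 * T) \<le> 1 / 3"
    proof -
      have "(1 - \<delta> / 2) ^ (16 * T) \<le> exp (- (\<delta> / 2)) ^ (16 * T)"
        using exp_ge_add_one_self[of "- (\<delta> / 2)"] \<delta>16 by (intro power_mono) auto
      also have "\<dots> = exp (- 2)" using T by (simp add: exp_of_nat_mult[symmetric] \<delta>_def)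
      also have "\<dots> \<le> 1 / 3"
      proof -
        have "3 \<le> exp (2::real)" using exp_ge_add_one_self[of "2::real"] by simp
        then show ?thesis by (simp add: exp_minus inverse_eq_divide)
      qed
      finally show ?thesis .
    qed
    ultimately show "2 / 3 \<le> pmf (run om ot (tester T L h \<Omega>)) False"
      by (simp add: run_tester orc_def)
  }
qed

section \<open>Choice of the parameters\<close>

text \<open>With u = 1 + log 2 (1 / \<epsilon>) this makes z = 250000 / T at most \<epsilon> / (256
  u), while 31 + 16 ln (1 / z) \<le> 256 u, so the distance left undetected is at most
  \<epsilon>.\<close>

definition scale_param :: "real \<Rightarrow> nat" where
  "scale_param \<epsilon> = nat \<lceil>64000000 * (1 + log 2 (1 / \<epsilon>)) / \<epsilon>\<rceil>"

definition confidence_param :: "real \<Rightarrow> nat" where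
  "confidence_param \<epsilon> = nat \<lceil>log 2 (384 * real (scale_param \<epsilon>))\<rceil>"

definition depth_param :: "nat \<Rightarrow> nat" where
  "depth_param N = nat \<lceil>log 2 (log 2 (real N))\<rceil>"

text \<open>For \<open>N = 1\<close> the outer logarithm is taken at 0, where its default value is
  0.\<close>

lemma log_log_nonneg:
  assumes "N \<ge> 1"
  shows "log 2 (log 2 (real N)) \<ge> 0"
proof (cases "N = 1")
  case True
  then show ?thesis by (simp add: log_def)
next
  case False
  then have "1 \<le> log 2 (real N)" using assms by (subst le_log_iff) auto
  then show ?thesis by simp
qed

lemma depth_param:
  assumes "N \<ge> 1"
  shows "N \<le> 2 ^ (2 ^ depth_param N)" "real (depth_param N) \<le> log 2 (log 2 (real N)) + 1"
proof -
  show "real (depth_param N) \<le> log 2 (log 2 (real N)) + 1"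
    using log_log_nonneg[OF assms] unfolding depth_param_def by linarith
  show "N \<le> 2 ^ (2 ^ depth_param N)"
  proof (cases "N = 1")
    case True
    then show ?thesis by simp
  next
    case False
    then have N: "1 \<le> log 2 (real N)" using assms by (subst le_log_iff) auto
    have "log 2 (log 2 (real N)) \<le> real (depth_param N)" unfolding depth_param_def by linarith
    then have "log 2 (real N) \<le> 2 powr real (depth_param N)" using N by (simp add: log_le_iff)
    also have "\<dots> = real (2 ^ depth_param N)" by (simp add: powr_realpow)
    finally have "real N \<le> 2 powr real (2 ^ depth_param N)" using assms by (simp add: log_le_iff)
    also have "\<dots> = real (2 ^ (2 ^ depth_param N))" by (subst powr_realpow) auto
    finally show ?thesis by (simp only: of_nat_le_iff)
  qed
qed

context
  fixes \<epsilon> :: real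
  assumes \<epsilon>: "0 < \<epsilon>" "\<epsilon> < 1"
begin

private definition "u = 1 + log 2 (1 / \<epsilon>)"

private lemma u_ge_1: "u \<ge> 1" using \<epsilon> by (simp add: u_def)

private lemma u_eps: "1 \<le> u / \<epsilon>"
  using u_ge_1 \<epsilon> by (simp add: le_divide_eq)

lemma scale_param_bounds:
  "64000000 * u / \<epsilon> \<le> real (scale_param \<epsilon>)" "real (scale_param \<epsilon>) \<le> 65000000 * u / \<epsilon>" "scale_param \<epsilon> > 0"
proof -
  have "64000000 * (u / \<epsilon>) \<le> real (scale_param \<epsilon>)" "real (scale_param \<epsilon>) \<le> 64000000 * (u / \<epsilon>) + 1"
    using u_eps unfolding scale_param_def u_def[symmetric] by (simp_all; linarith)+
  then show "64000000 * u / \<epsilon> \<le> real (scale_param \<epsilon>)" "real (scale_param \<epsilon>) \<le> 65000000 * u / \<epsilon>" "scale_param \<epsilon> > 0"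
    using u_eps by auto
qed

lemma confidence_param_bounds:
  "384 * scale_param \<epsilon> \<le> 2 ^ confidence_param \<epsilon>" "real (confidence_param \<epsilon>) \<le> 37 * u"
proof -
  define T where "T = real (scale_param \<epsilon>)"
  have T: "T \<ge> 1" using scale_param_bounds(3) by (simp add: T_def)
  have "log 2 (384 * T) \<le> real (confidence_param \<epsilon>)" unfolding confidence_param_def T_def by linarith
  then have "384 * T \<le> 2 powr real (confidence_param \<epsilon>)" using T by (simp add: log_le_iff)
  also have "\<dots> = real (2 ^ confidence_param \<epsilon>)" by (simp add: powr_realpow)
  finally have "real (384 * scale_param \<epsilon>) \<le> real (2 ^ confidence_param \<epsilon>)" by (simp add: T_def)
  then show "384 * scale_param \<epsilon> \<le> 2 ^ confidence_param \<epsilon>" by (simp only: of_nat_le_iff)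
  have "log 2 (384 * T) \<ge> 0" using T by simp
  then have "real (confidence_param \<epsilon>) \<le> log 2 (384 * T) + 1" unfolding confidence_param_def T_def by linarith
  also have "log 2 (384 * T) \<le> log 2 (2 ^ 35 * (u * (1 / \<epsilon>)))"
  proof -
    have "384 * T \<le> 384 * (65000000 * (u / \<epsilon>))" using scale_param_bounds(2) by (simp add: T_def)
    also have "\<dots> \<le> 2 ^ 35 * (u / \<epsilon>)" using u_eps by simp
    finally show ?thesis using T by simp
  qed
  also have "\<dots> = log 2 (2 ^ 35) + (log 2 u + log 2 (1 / \<epsilon>))"
    using u_ge_1 \<epsilon> by (subst log_mult_pos, simp, simp, subst log_mult_pos) auto
  also have "log 2 (2 ^ 35) = (35::real)" using log_pow_cancel[of 2 35] by (simp del: power_numeral)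
  also have "log 2 u \<le> u"
  proof -
    have "ln (u / 2) \<le> u / 2 - 1" using u_ge_1 by (intro ln_le_minus_one) auto
    then have "ln u \<le> u / 2" using u_ge_1 ln2_le_25_over_36 by (simp add: ln_div)
    also have "\<dots> \<le> u * ln 2" using mult_left_mono[of "1 / 2" "ln 2 :: real" u] u_ge_1 ln2_ge_two_thirds by simp
    finally show ?thesis by (simp add: log_def field_simps)
  qed
  \<comment> \<open>35 + u + (u - 1), plus 1 for rounding up, is at most 37 u.\<close>
  finally show "real (confidence_param \<epsilon>) \<le> 37 * u" using u_ge_1 by (simp add: u_def)
qed

lemma accuracy_bound:
  defines "z \<equiv> 250000 / real (scale_param \<epsilon>)"
  shows "z \<le> 1 / 2" "z * (31 + 16 * ln (1 / z)) \<le> \<epsilon>"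
proof -
  define T where "T = real (scale_param \<epsilon>)"
  have T: "64000000 * (u / \<epsilon>) \<le> T" "T \<le> 65000000 * (u / \<epsilon>)" "T \<ge> 1"
    using scale_param_bounds by (auto simp: T_def)
  have z: "z = 250000 / T" by (simp add: z_def T_def)
  have "z \<le> 250000 / (64000000 * (u / \<epsilon>))" unfolding z using T u_eps by (intro divide_left_mono mult_pos_pos) linarith+
  then have z_le: "z \<le> \<epsilon> / (256 * u)" by simp
  also have "\<dots> \<le> 1 / (256 * 1)" using \<epsilon> u_ge_1 by (intro frac_le) auto
  finally show "z \<le> 1 / 2" by simp
  have zpos: "z > 0" using T by (simp add: z)
  have "1 / z = T / 250000" by (simp add: z)
  also have "\<dots> \<le> 512 * (u * (1 / \<epsilon>))" using T(2) u_eps by simp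
  finally have "ln (1 / z) \<le> ln (512 * (u * (1 / \<epsilon>)))" using zpos by (intro ln_mono) auto
  also have "\<dots> = ln 512 + (ln u + ln (1 / \<epsilon>))" using u_ge_1 \<epsilon> by (subst ln_mult_pos, simp, simp, subst ln_mult_pos) auto
  also have "ln (512::real) \<le> 9"
  proof -
    have "ln (512::real) = ln (2 ^ 9)" by simp
    also have "\<dots> = 9 * ln 2" by (subst ln_realpow) auto
    finally show ?thesis using ln2_le_25_over_36 by simp
  qed
  also have "ln u \<le> u - 1" using u_ge_1 by (intro ln_le_minus_one) auto
  also have "ln (1 / \<epsilon>) \<le> u - 1"
  proof -
    have "ln (1 / \<epsilon>) = log 2 (1 / \<epsilon>) * ln 2" by (simp add: log_def)
    also have "\<dots> \<le> log 2 (1 / \<epsilon>) * 1"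
      using \<epsilon> ln2_le_25_over_36 by (intro mult_left_mono) auto
    finally show ?thesis by (simp add: u_def)
  qed
  finally have "31 + 16 * ln (1 / z) \<le> 256 * u" using u_ge_1 by simp
  then have "z * (31 + 16 * ln (1 / z)) \<le> z * (256 * u)" using zpos by (intro mult_left_mono) auto
  also have "\<dots> \<le> \<epsilon> / (256 * u) * (256 * u)" using z_le u_ge_1 by (intro mult_right_mono) auto
  finally show "z * (31 + 16 * ln (1 / z)) \<le> \<epsilon>" using u_ge_1 by simp
qed

text \<open>A point costs \<open>h\<close> samples for the search and O(L^2 T^4) for the tests, and
  O(T) points are drawn. As T = O(u / \<epsilon>) and L = O(u), the two parts are O(a u /
  \<epsilon>), up to lower order terms, and O(u^7 / \<epsilon>^5).\<close>

lemma sample_count_bound: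
  fixes a :: real and h :: nat
  assumes h: "real h \<le> a + 1" and a: "a \<ge> 0"
  shows "real (32 * scale_param \<epsilon> * (1 + h + 11000 * (confidence_param \<epsilon>)\<^sup>2 * scale_param \<epsilon> ^ 4)) \<le>
     10 ^ 50 * ((a / \<epsilon> + 1 / \<epsilon> ^ 5) * (1 + log 2 (1 / \<epsilon>)) ^ 8)"
proof -
  define T where "T = real (scale_param \<epsilon>)"
  define L where "L = real (confidence_param \<epsilon>)"
  define v where "v = u / \<epsilon>"
  have v: "1 \<le> v" using u_eps by (simp add: v_def)
  have T: "0 \<le> T" "T \<le> 65000000 * v" using scale_param_bounds by (auto simp: T_def v_def)
  have L: "0 \<le> L" "L \<le> 37 * u" using confidence_param_bounds(2) by (auto simp: L_def)
  have "real (32 * scale_param \<epsilon> * (1 + h + 11000 * (confidence_param \<epsilon>)\<^sup>2 * scale_param \<epsilon> ^ 4)) =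
      32 * T * (1 + real h + 11000 * L\<^sup>2 * T ^ 4)" by (simp only: T_def L_def of_nat_mult of_nat_add of_nat_power of_nat_numeral of_nat_1)
  also have "\<dots> \<le> 32 * (65000000 * v) * (1 + (a + 1) + 11000 * (37 * u)\<^sup>2 * (65000000 * v) ^ 4)"
    using T L h v by (intro mult_mono add_mono power_mono) auto
  also have "\<dots> = 2080000000 * (v * a) + 4160000000 * v + (2080000000 * 11000 * 1369 * 65000000 ^ 4) * (u\<^sup>2 * v ^ 5)"
    by (simp add: power_mult_distrib algebra_simps eval_nat_numeral)
  also have "\<dots> \<le> 10 ^ 50 * (v * a) + (4160000000 + 2080000000 * 11000 * 1369 * 65000000 ^ 4) * (u\<^sup>2 * v ^ 5)"
  proof -
    have "v * 1 \<le> v * v ^ 4" using v by (intro mult_left_mono) (auto simp: one_le_power)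
    then have "v \<le> v ^ 5" by (simp add: eval_nat_numeral)
    moreover have "1 * v ^ 5 \<le> u\<^sup>2 * v ^ 5" using u_ge_1 v by (intro mult_right_mono) (auto simp: one_le_power)
    ultimately have "v \<le> u\<^sup>2 * v ^ 5" by simp
    moreover have "v * a \<ge> 0" using v a by simp
    ultimately show ?thesis by (simp add: algebra_simps)
  qed
  also have "\<dots> \<le> 10 ^ 50 * (v * a) + 10 ^ 50 * (u\<^sup>2 * v ^ 5)"
    using u_ge_1 v by (intro add_left_mono mult_right_mono) auto
  also have "\<dots> \<le> 10 ^ 50 * (u ^ 8 * (a / \<epsilon>)) + 10 ^ 50 * (u ^ 8 * (1 / \<epsilon> ^ 5))"
  proof -
    have "u ^ 1 * (a / \<epsilon>) \<le> u ^ 8 * (a / \<epsilon>)"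
      using u_ge_1 a \<epsilon> by (intro mult_right_mono power_increasing) auto
    moreover have "v * a = u ^ 1 * (a / \<epsilon>)" by (simp add: v_def)
    moreover have "u ^ 7 * (1 / \<epsilon> ^ 5) \<le> u ^ 8 * (1 / \<epsilon> ^ 5)"
      using u_ge_1 \<epsilon> by (intro mult_right_mono power_increasing) auto
    moreover have "u\<^sup>2 * v ^ 5 = u ^ 7 * (1 / \<epsilon> ^ 5)" by (simp add: v_def power_divide flip: power_add)
    ultimately show ?thesis by simp
  qed
  also have "\<dots> = 10 ^ 50 * ((a / \<epsilon> + 1 / \<epsilon> ^ 5) * u ^ 8)" by (simp add: algebra_simps)
  finally show ?thesis by (simp add: u_def)
qed

end

lemma tv_dist_le_1:
  assumes "finite \<Omega>"
  shows "tv_dist \<Omega> \<mu> \<tau> \<le> 1"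
proof -
  have "(\<Sum>x\<in>\<Omega>. \<bar>pmf \<mu> x - pmf \<tau> x\<bar>) \<le> (\<Sum>x\<in>\<Omega>. pmf \<mu> x + pmf \<tau> x)"
    by (intro sum_mono) (auto simp: abs_le_iff)
  also have "\<dots> = measure_pmf.prob \<mu> \<Omega> + measure_pmf.prob \<tau> \<Omega>"
    using assms by (simp add: sum.distrib measure_measure_pmf_finite)
  also have "\<dots> \<le> 1 + 1" by (intro add_mono) auto
  finally show ?thesis by (simp add: tv_dist_def)
qed

theorem theorem1p3:
  "\<exists>(C :: real) (p :: real poly) (T :: nat \<Rightarrow> real \<Rightarrow> nat algorithm).
     \<forall>(N :: nat) (\<epsilon> :: real). N \<ge> 1 \<and> \<epsilon> > 0 \<longrightarrow>
       distinguishes {1..N} \<epsilon> (T N \<epsilon>) \<and>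
       (\<exists>n. samples_at_most (T N \<epsilon>) n \<and>
            real n \<le> C * ((log 2 (log 2 (real N)) / \<epsilon> + 1 / \<epsilon> ^ 5) * poly p (log 2 (1 / \<epsilon>))))"
proof (intro exI allI impI)
  fix N :: nat and \<epsilon> :: real
  assume "N \<ge> 1 \<and> \<epsilon> > 0"
  then have N: "N \<ge> 1" and \<epsilon>: "\<epsilon> > 0" by auto
  have poly: "poly ([:1, 1:] ^ 8) x = (1 + x) ^ 8" for x :: real by (simp add: poly_power)
  show "distinguishes {1..N} \<epsilon> (if \<epsilon> < 1
      then tester (scale_param \<epsilon>) (confidence_param \<epsilon>) (depth_param N) {1..N} else Answer True) \<and>
       (\<exists>n. samples_at_most (if \<epsilon> < 1
      then tester (scale_param \<epsilon>) (confidence_param \<epsilon>) (depth_param N) {1..N} else Answer True) n \<and>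
            real n \<le> 10 ^ 50 * ((log 2 (log 2 (real N)) / \<epsilon> + 1 / \<epsilon> ^ 5) * poly ([:1, 1:] ^ 8) (log 2 (1 / \<epsilon>))))"
  proof (cases "\<epsilon> < 1")
    case True
    note \<epsilon>1 = \<epsilon> True
    have "distinguishes {1..N} \<epsilon> (tester (scale_param \<epsilon>) (confidence_param \<epsilon>) (depth_param N) {1..N})"
      using accuracy_bound[OF \<epsilon>1] scale_param_bounds(3)[OF \<epsilon>1] confidence_param_bounds(1)[OF \<epsilon>1] depth_param(1)[OF N]
      by (intro tester_distinguishes) auto
    moreover note samples_at_most_tester[OF scale_param_bounds(3)[OF \<epsilon>1], of "confidence_param \<epsilon>" "depth_param N" "{1..N}"]
    moreover note sample_count_bound[OF \<epsilon>1 depth_param(2)[OF N] log_log_nonneg[OF N]]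
    ultimately show ?thesis using True unfolding poly by auto
  next
    case False
    then have "\<not> tv_dist {1..N} \<mu> \<tau> > \<epsilon>" for \<mu> \<tau> using tv_dist_le_1[of "{1..N}" \<mu> \<tau>] by simp
    then have "distinguishes {1..N} \<epsilon> (Answer True)" by (auto simp: distinguishes_def)
    \<comment> \<open>For \<epsilon> > 2 the base \<open>1 + log 2 (1 / \<epsilon>)\<close> is
      negative; the bound stays nonnegative because the exponent 8 is even.\<close>
    moreover have "0 \<le> (10::real) ^ 50 * ((log 2 (log 2 (real N)) / \<epsilon> + 1 / \<epsilon> ^ 5) * (1 + log 2 (1 / \<epsilon>)) ^ 8)"
      using log_log_nonneg[OF N] \<epsilon> by (intro mult_nonneg_nonneg add_nonneg_nonneg) auto
    ultimately show ?thesis using False unfolding poly by (auto intro!: exI[of _ 0])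
  qed
qed

end
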